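(* Let $A$ be a category and $\mathcal C$ a contextual category. Let $A_{\mathrm{pre}}$ be the following precontextual category: its underlying category $A_+$ is obtained by freely adjoining a terminal object $z$ to $A$; $\ell(z)=0$ and $\ell(a)=1$ for $a\in A$; the length-1 display maps are the terminal arrows $a\to z$ for $a\in A$; and there are no (length-1) distinguished squares. Then there exists an isomorphism of contextual categories $$\mathcal C^{A_{\mathrm{pre}}}\cong\mathcal C^{A},$$ where the left-hand side is the exponential of a contextual category by a precontextual category and the right-hand side is the power of $\mathcal C$ by the category $A$ (both described in the context).
   Context: A precontextual category $\mathcal C$ consists of: a category $|\mathcal C|$ (with a set of objects); a length function $\ell$ from objects to $\mathbb N$; a function $\partial$ from objects to objects with $\ell(\partial a)=\ell(a)-1$ if $\ell(a)\ge 1$ and $\partial a=a$ if $\ell(a)=0$; for each object $a$ with $\ell(a)\ge1$ a morphism $\mathbf p_a:a\to\partial a$; and a set $\mathbf Q$ of commutative squares in $|\mathcal C|$ having left side some $\mathbf p_a$ and right side some $\mathbf p_b$. A display map (written $\twoheadrightarrow$) is a finite, possibly empty, composite of maps $\mathbf p_a$; its length is $\ell(\text{domain})-\ell(\text{codomain})$. A distinguished square is a finite vertical composite of elements of $\mathbf Q$; length-1 distinguished squares are the elements of $\mathbf Q$. $\mathcal C$ is a contextual category if moreover: there is a unique object $1_{\mathcal C}$ of length $0$, and it is terminal; every element of $\mathbf Q$ is a pullback; $\mathbf Q$ contains the identity square of every $\mathbf p_a$ and is closed under horizontal composition; for every $a$ with $\ell(a)\ge 1$ and $f:b\to\partial a$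 there is a unique element of $\mathbf Q$ with right side $\mathbf p_a$ and bottom $f$ (hence any display map has a unique distinguished pullback along any map into its codomain). A morphism (contextual functor) is a functor strictly preserving $\ell,\partial,\mathbf p$ and sending $\mathbf Q$ into $\mathbf Q$. Gap maps. In a contextual category, let $S$ be a commutative square with top $f':b'\to b$, bottom $f:a'\to a$, left side $b'\twoheadrightarrow a'$ and right side $p:b\twoheadrightarrow a$ display maps. Let $c$ be the top-left corner of the distinguished square with right side $p$ and bottom $f$. The induced map $b'\to c$ is the gap map of $S$; $S$ is a relative length-1 display map if its gap map is a length-1 display map. Exponential. For $\mathcal A$ precontextual and $\mathcal C$ contextual, $D(\mathcal A,\mathcal C)$ is the full subcategory of the functor category $|\mathcal C|^{|\mathcal A|}$ on functors preserving display maps (not necessarily their lengths) and sending every length-0 object to $1_{\mathcal C}$. An indexed sort is a natural transformation $\pi:G\Rightarrow F$ in $D(\mathcal A,\mathcal C)$ such that: (i) for each $a$ with $\ell(a)\ge1$ the naturality square at $\mathbf p_a$ (top $\pi_a$, bottom $\pi_{\partial a}$, sides $G(\mathbf p_a),F(\mathbf p_a)$) is a relative length-1 display map; (ii) for each square in $\mathbf Q$ of $\mathcal A$ with top $f':a\to b$ and sides $\mathbf p_a,\mathbf p_b$, if $G(a)\twoheadrightarrow x$, $G(b)\twoheadrightarrow y$ are the gap maps of the naturality squares at $\mathbf p_a,\mathbf p_b$, then the square with these sides, top $G(f')$ and bottom the induced map $x\to y$ is distinguished. An indexed distinguished square is a commutative square in $D(\mathcal A,\mathcal C)$ with top $\alpha':G'\Rightarrow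 G$, bottom $\alpha:F'\Rightarrow F$ and sides indexed sorts $\pi':G'\Rightarrow F'$, $\pi:G\Rightarrow F$, such that for each $a$ with $\ell(a)\ge 1$, if $G'(a)\twoheadrightarrow y$ and $G(a)\twoheadrightarrow x$ are the gap maps of the naturality squares of $\pi',\pi$ at $\mathbf p_a$, the square with these sides, top $\alpha'_a$ and bottom the induced map $y\to x$ is distinguished. The exponential $\mathcal C^{\mathcal A}$ is the contextual category whose length-$n$ objects are chains $F_n\to\cdots\to F_1\to F_0$ of indexed sorts in $D(\mathcal A,\mathcal C)$ with $F_0$ constant at $1_{\mathcal C}$; morphisms $(F_i)_{i\le n}\to(G_i)_{i\le m}$ are natural transformations $F_n\Rightarrow G_m$; $\partial$ removes $F_n$, with display map $F_n\to F_{n-1}$; elements of $\mathbf Q$ are the squares whose underlying square of natural transformations is an indexed distinguished square. Power by a category. For a category $A$, $\mathcal C^A$ is the contextual category whose length-$n$ objects are sequences $(F_0,\dots,F_n)$ of functors $A\to|\mathcal C|$ with $F_0$ constant at $1_{\mathcal C}$ and, for $1\le i\le n$, $\ell(F_i(a))=i$, $\partial(F_i(a))=F_{i-1}(a)$ and the maps $\mathbf p_{F_i(a)}$ natural in $a$; morphisms $(F_0,\dots,F_m)\to(G_0,\dots,G_n)$ are natural transformations $F_m\Rightarrow G_n$; $\partial$ removes the last functor, with display map the natural transformation $F_n\Rightarrow F_{n-1}$ just described; a square is in $\mathbf Q$ iff it is componentwise in $\mathbf Q$ of $\mathcal C$. *)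

theory Defs
  imports "HOL-Library.FuncSet"
begin

section \<open>Categories, functors, natural transformations\<close>

text \<open>\<open>Comp C g f\<close> is \<open>g\<close> after \<open>f\<close>; it is meaningful only when \<open>Cod C f = Dom C g\<close>.\<close>

record ('o, 'm) category =
  Obj :: "'o set"
  Arr :: "'m set"
  Dom :: "'m \<Rightarrow> 'o"
  Cod :: "'m \<Rightarrow> 'o"
  Id :: "'o \<Rightarrow> 'm"
  Comp :: "'m \<Rightarrow> 'm \<Rightarrow> 'm"

locale category =
  fixes C :: "('o, 'm, 'x) category_scheme"
  assumes Dom_in: "f \<in> Arr C \<Longrightarrow> Dom C f \<in> Obj C"
    and Cod_in: "f \<in> Arr C \<Longrightarrow> Cod C f \<in> Obj C"
    and Id_in: "a \<in> Obj C \<Longrightarrow> Id C a \<in> Arr C"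
    and Dom_Id: "a \<in> Obj C \<Longrightarrow> Dom C (Id C a) = a"
    and Cod_Id: "a \<in> Obj C \<Longrightarrow> Cod C (Id C a) = a"
    and Comp_in: "\<lbrakk>f \<in> Arr C; g \<in> Arr C; Cod C f = Dom C g\<rbrakk> \<Longrightarrow> Comp C g f \<in> Arr C"
    and Dom_Comp: "\<lbrakk>f \<in> Arr C; g \<in> Arr C; Cod C f = Dom C g\<rbrakk> \<Longrightarrow> Dom C (Comp C g f) = Dom C f"
    and Cod_Comp: "\<lbrakk>f \<in> Arr C; g \<in> Arr C; Cod C f = Dom C g\<rbrakk> \<Longrightarrow> Cod C (Comp C g f) = Cod C g"
    and Comp_Id: "f \<in> Arr C \<Longrightarrow> Comp C f (Id C (Dom C f)) = f"
    and Id_Comp: "f \<in> Arr C \<Longrightarrow> Comp C (Id C (Cod C f)) f = f"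
    and Comp_assoc:
      "\<lbrakk>f \<in> Arr C; g \<in> Arr C; h \<in> Arr C; Cod C f = Dom C g; Cod C g = Dom C h\<rbrakk>
        \<Longrightarrow> Comp C h (Comp C g f) = Comp C (Comp C h g) f"

definition homset :: "('o, 'm, 'x) category_scheme \<Rightarrow> 'o \<Rightarrow> 'o \<Rightarrow> 'm set" where
  "homset C a b = {f \<in> Arr C. Dom C f = a \<and> Cod C f = b}"

text \<open>Functors and natural transformations occur below as objects and arrows of categories, so
  their underlying maps are required to be extensional (\<open>\<rightarrow>\<^sub>E\<close>): equality in HOL is then equality
  of functors and of natural transformations.\<close>

record ('o, 'm, 'p, 'n) func =
  omap :: "'o \<Rightarrow> 'p"
  amap :: "'m \<Rightarrow> 'n"

locale is_functor = dom: category A + cod: category B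
  for A :: "('o, 'm, 'x) category_scheme" and B :: "('p, 'n, 'y) category_scheme" +
  fixes F :: "('o, 'm, 'p, 'n) func"
  assumes omap_in: "omap F \<in> Obj A \<rightarrow>\<^sub>E Obj B"
    and amap_in: "amap F \<in> Arr A \<rightarrow>\<^sub>E Arr B"
    and Dom_amap: "f \<in> Arr A \<Longrightarrow> Dom B (amap F f) = omap F (Dom A f)"
    and Cod_amap: "f \<in> Arr A \<Longrightarrow> Cod B (amap F f) = omap F (Cod A f)"
    and amap_Id: "a \<in> Obj A \<Longrightarrow> amap F (Id A a) = Id B (omap F a)"
    and amap_Comp: "\<lbrakk>f \<in> Arr A; g \<in> Arr A; Cod A f = Dom A g\<rbrakk>
        \<Longrightarrow> amap F (Comp A g f) = Comp B (amap F g) (amap F f)"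

definition id_func :: "('o, 'm, 'x) category_scheme \<Rightarrow> ('o, 'm, 'o, 'm) func" where
  "id_func A = \<lparr>omap = (\<lambda>a\<in>Obj A. a), amap = (\<lambda>f\<in>Arr A. f)\<rparr>"

definition comp_func :: "('o, 'm, 'x) category_scheme \<Rightarrow> ('p, 'n, 'q, 'l) func
    \<Rightarrow> ('o, 'm, 'p, 'n) func \<Rightarrow> ('o, 'm, 'q, 'l) func" where
  "comp_func A G F =
    \<lparr>omap = (\<lambda>a\<in>Obj A. omap G (omap F a)), amap = (\<lambda>f\<in>Arr A. amap G (amap F f))\<rparr>"

definition const_func :: "('o, 'm, 'x) category_scheme \<Rightarrow> ('p, 'n, 'y) category_scheme
    \<Rightarrow> 'p \<Rightarrow> ('o, 'm, 'p, 'n) func" where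
  "const_func A B c = \<lparr>omap = (\<lambda>_\<in>Obj A. c), amap = (\<lambda>_\<in>Arr A. Id B c)\<rparr>"

record ('o, 'm, 'p, 'n) nat_trans =
  nt_dom :: "('o, 'm, 'p, 'n) func"
  nt_cod :: "('o, 'm, 'p, 'n) func"
  nt_at :: "'o \<Rightarrow> 'n"

locale natural_transformation =
  dom: is_functor A B "nt_dom t" + cod: is_functor A B "nt_cod t"
  for A :: "('o, 'm, 'x) category_scheme" and B :: "('p, 'n, 'y) category_scheme"
    and t :: "('o, 'm, 'p, 'n) nat_trans" +
  assumes nt_at_in: "nt_at t \<in> Obj A \<rightarrow>\<^sub>E Arr B"
    and Dom_nt_at: "a \<in> Obj A \<Longrightarrow> Dom B (nt_at t a) = omap (nt_dom t) a"
    and Cod_nt_at: "a \<in> Obj A \<Longrightarrow> Cod B (nt_at t a) = omap (nt_cod t) a"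
    and naturality: "f \<in> Arr A \<Longrightarrow>
        Comp B (nt_at t (Cod A f)) (amap (nt_dom t) f) =
        Comp B (amap (nt_cod t) f) (nt_at t (Dom A f))"

definition nt_id :: "('o, 'm, 'x) category_scheme \<Rightarrow> ('p, 'n, 'y) category_scheme
    \<Rightarrow> ('o, 'm, 'p, 'n) func \<Rightarrow> ('o, 'm, 'p, 'n) nat_trans" where
  "nt_id A B F = \<lparr>nt_dom = F, nt_cod = F, nt_at = (\<lambda>a\<in>Obj A. Id B (omap F a))\<rparr>"

definition nt_comp :: "('o, 'm, 'x) category_scheme \<Rightarrow> ('p, 'n, 'y) category_scheme
    \<Rightarrow> ('o, 'm, 'p, 'n) nat_trans \<Rightarrow> ('o, 'm, 'p, 'n) nat_trans
    \<Rightarrow> ('o, 'm, 'p, 'n) nat_trans" where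
  "nt_comp A B t s =
    \<lparr>nt_dom = nt_dom s, nt_cod = nt_cod t, nt_at = (\<lambda>a\<in>Obj A. Comp B (nt_at t a) (nt_at s a))\<rparr>"


section \<open>Squares\<close>

record 'm square =
  sq_top :: 'm
  sq_bot :: 'm
  sq_left :: 'm
  sq_right :: 'm

definition comm_square :: "('o, 'm, 'x) category_scheme \<Rightarrow> 'm square \<Rightarrow> bool" where
  "comm_square C S \<longleftrightarrow>
    sq_top S \<in> Arr C \<and> sq_bot S \<in> Arr C \<and> sq_left S \<in> Arr C \<and> sq_right S \<in> Arr C \<and>
    Dom C (sq_top S) = Dom C (sq_left S) \<and> Cod C (sq_top S) = Dom C (sq_right S) \<and>
    Cod C (sq_left S) = Dom C (sq_bot S) \<and> Cod C (sq_bot S) = Cod C (sq_right S) \<and>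
    Comp C (sq_right S) (sq_top S) = Comp C (sq_bot S) (sq_left S)"

definition pullback_square :: "('o, 'm, 'x) category_scheme \<Rightarrow> 'm square \<Rightarrow> bool" where
  "pullback_square C S \<longleftrightarrow> comm_square C S \<and>
    (\<forall>u v. u \<in> Arr C \<and> v \<in> Arr C \<and> Dom C u = Dom C v \<and>
        Cod C u = Dom C (sq_right S) \<and> Cod C v = Dom C (sq_bot S) \<and>
        Comp C (sq_right S) u = Comp C (sq_bot S) v \<longrightarrow>
      (\<exists>!w. w \<in> homset C (Dom C u) (Dom C (sq_top S)) \<and>
        Comp C (sq_top S) w = u \<and> Comp C (sq_left S) w = v))"

text \<open>The map into the top left corner of the pullback square \<open>S\<close> with components \<open>u\<close>
  (towards the right side) and \<open>v\<close> (towards the bottom).\<close>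

definition pb_map :: "('o, 'm, 'x) category_scheme \<Rightarrow> 'm square \<Rightarrow> 'm \<Rightarrow> 'm \<Rightarrow> 'm" where
  "pb_map C S u v = (THE w. w \<in> homset C (Dom C u) (Dom C (sq_top S)) \<and>
     Comp C (sq_top S) w = u \<and> Comp C (sq_left S) w = v)"

definition hcomp :: "('o, 'm, 'x) category_scheme \<Rightarrow> 'm square \<Rightarrow> 'm square \<Rightarrow> 'm square" where
  "hcomp C S T = \<lparr>sq_top = Comp C (sq_top T) (sq_top S), sq_bot = Comp C (sq_bot T) (sq_bot S),
     sq_left = sq_left S, sq_right = sq_right T\<rparr>"

text \<open>\<open>vcomp C S T\<close> has \<open>S\<close> above \<open>T\<close>.\<close>

definition vcomp :: "('o, 'm, 'x) category_scheme \<Rightarrow> 'm square \<Rightarrow> 'm square \<Rightarrow> 'm square" where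
  "vcomp C S T = \<lparr>sq_top = sq_top S, sq_bot = sq_bot T,
     sq_left = Comp C (sq_left T) (sq_left S), sq_right = Comp C (sq_right T) (sq_right S)\<rparr>"


section \<open>Precontextual and contextual categories\<close>

text \<open>\<open>proj X a\<close> is \<open>\<^bold>p\<^sub>a\<close>; its value at objects of length 0 is irrelevant.\<close>

record ('o, 'm) precontextual = "('o, 'm) category" +
  len :: "'o \<Rightarrow> nat"
  bdry :: "'o \<Rightarrow> 'o"
  proj :: "'o \<Rightarrow> 'm"
  Qs :: "'m square set"

locale precontextual_category = category C
  for C :: "('o, 'm, 'x) precontextual_scheme" +
  assumes bdry_in: "a \<in> Obj C \<Longrightarrow> bdry C a \<in> Obj C"
    and len_bdry: "\<lbrakk>a \<in> Obj C; len C a \<ge> 1\<rbrakk> \<Longrightarrow> len C (bdry C a) = len C a - 1"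
    and bdry_0: "\<lbrakk>a \<in> Obj C; len C a = 0\<rbrakk> \<Longrightarrow> bdry C a = a"
    and proj_in: "\<lbrakk>a \<in> Obj C; len C a \<ge> 1\<rbrakk> \<Longrightarrow> proj C a \<in> homset C a (bdry C a)"
    and Qs_comm: "S \<in> Qs C \<Longrightarrow> comm_square C S"
    and Qs_left: "S \<in> Qs C \<Longrightarrow> \<exists>a\<in>Obj C. len C a \<ge> 1 \<and> sq_left S = proj C a"
    and Qs_right: "S \<in> Qs C \<Longrightarrow> \<exists>b\<in>Obj C. len C b \<ge> 1 \<and> sq_right S = proj C b"

definition one :: "('o, 'm, 'x) precontextual_scheme \<Rightarrow> 'o" where
  "one C = (THE a. a \<in> Obj C \<and> len C a = 0)"

locale contextual_category = precontextual_category C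
  for C :: "('o, 'm, 'x) precontextual_scheme" +
  assumes unique_len_0: "\<exists>!a. a \<in> Obj C \<and> len C a = 0"
    and one_terminal: "b \<in> Obj C \<Longrightarrow> \<exists>!f. f \<in> homset C b (one C)"
    and Qs_pullback: "S \<in> Qs C \<Longrightarrow> pullback_square C S"
    and Qs_Id: "\<lbrakk>a \<in> Obj C; len C a \<ge> 1\<rbrakk> \<Longrightarrow>
        \<lparr>sq_top = Id C a, sq_bot = Id C (bdry C a), sq_left = proj C a, sq_right = proj C a\<rparr> \<in> Qs C"
    and Qs_hcomp: "\<lbrakk>S \<in> Qs C; T \<in> Qs C; sq_right S = sq_left T\<rbrakk> \<Longrightarrow> hcomp C S T \<in> Qs C"
    and Qs_unique: "\<lbrakk>a \<in> Obj C; len C a \<ge> 1; f \<in> Arr C; Cod C f = bdry C a\<rbrakk> \<Longrightarrow>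
        \<exists>!S. S \<in> Qs C \<and> sq_right S = proj C a \<and> sq_bot S = f"

inductive_set display_maps :: "('o, 'm, 'x) precontextual_scheme \<Rightarrow> 'm set"
  for C :: "('o, 'm, 'x) precontextual_scheme" where
  empty: "a \<in> Obj C \<Longrightarrow> Id C a \<in> display_maps C"
| step: "\<lbrakk>a \<in> Obj C; len C a \<ge> 1; d \<in> display_maps C; Dom C d = bdry C a\<rbrakk>
    \<Longrightarrow> Comp C d (proj C a) \<in> display_maps C"

definition disp_len :: "('o, 'm, 'x) precontextual_scheme \<Rightarrow> 'm \<Rightarrow> nat" where
  "disp_len C d = len C (Dom C d) - len C (Cod C d)"

text \<open>The empty vertical composites are the squares with identity sides.\<close>

inductive_set distinguished :: "('o, 'm, 'x) precontextual_scheme \<Rightarrow> 'm square set"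
  for C :: "('o, 'm, 'x) precontextual_scheme" where
  empty: "f \<in> Arr C \<Longrightarrow>
    \<lparr>sq_top = f, sq_bot = f, sq_left = Id C (Dom C f), sq_right = Id C (Cod C f)\<rparr> \<in> distinguished C"
| step: "\<lbrakk>S \<in> Qs C; T \<in> distinguished C; sq_bot S = sq_top T\<rbrakk> \<Longrightarrow> vcomp C S T \<in> distinguished C"

definition map_square :: "('o, 'm, 'p, 'n) func \<Rightarrow> 'm square \<Rightarrow> 'n square" where
  "map_square F S = \<lparr>sq_top = amap F (sq_top S), sq_bot = amap F (sq_bot S),
     sq_left = amap F (sq_left S), sq_right = amap F (sq_right S)\<rparr>"

locale contextual_functor =
  dom: contextual_category X + cod: contextual_category Y + is_functor X Y F
  for X :: "('o, 'm, 'x) precontextual_scheme" and Y :: "('p, 'n, 'y) precontextual_scheme"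
    and F :: "('o, 'm, 'p, 'n) func" +
  assumes pres_len: "a \<in> Obj X \<Longrightarrow> len Y (omap F a) = len X a"
    and pres_bdry: "a \<in> Obj X \<Longrightarrow> omap F (bdry X a) = bdry Y (omap F a)"
    and pres_proj: "\<lbrakk>a \<in> Obj X; len X a \<ge> 1\<rbrakk> \<Longrightarrow> amap F (proj X a) = proj Y (omap F a)"
    and pres_Qs: "S \<in> Qs X \<Longrightarrow> map_square F S \<in> Qs Y"

definition contextual_isomorphism :: "('o, 'm, 'x) precontextual_scheme
    \<Rightarrow> ('p, 'n, 'y) precontextual_scheme \<Rightarrow> ('o, 'm, 'p, 'n) func \<Rightarrow> bool" where
  "contextual_isomorphism X Y F \<longleftrightarrow> contextual_functor X Y F \<and>
    (\<exists>G. contextual_functor Y X G \<and> comp_func X G F = id_func X \<and> comp_func Y F G = id_func Y)"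


section \<open>Gap maps\<close>

text \<open>The unique distinguished square with right side \<open>p\<close> and bottom \<open>f\<close>.\<close>

definition dist_pb :: "('o, 'm, 'x) precontextual_scheme \<Rightarrow> 'm \<Rightarrow> 'm \<Rightarrow> 'm square" where
  "dist_pb C p f = (THE T. T \<in> distinguished C \<and> sq_right T = p \<and> sq_bot T = f)"

definition gap_map :: "('o, 'm, 'x) precontextual_scheme \<Rightarrow> 'm square \<Rightarrow> 'm" where
  "gap_map C S = pb_map C (dist_pb C (sq_right S) (sq_bot S)) (sq_top S) (sq_left S)"

definition rel_display_1 :: "('o, 'm, 'x) precontextual_scheme \<Rightarrow> 'm square \<Rightarrow> bool" where
  "rel_display_1 C S \<longleftrightarrow> comm_square C S \<and>
    sq_left S \<in> display_maps C \<and> sq_right S \<in> display_maps C \<and>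
    gap_map C S \<in> display_maps C \<and> disp_len C (gap_map C S) = 1"


section \<open>The exponential by a precontextual category\<close>

definition in_D :: "('o, 'm, 'x) precontextual_scheme \<Rightarrow> ('p, 'n, 'y) precontextual_scheme
    \<Rightarrow> ('o, 'm, 'p, 'n) func \<Rightarrow> bool" where
  "in_D A C F \<longleftrightarrow> is_functor A C F \<and>
    (\<forall>d\<in>display_maps A. amap F d \<in> display_maps C) \<and>
    (\<forall>a\<in>Obj A. len A a = 0 \<longrightarrow> omap F a = one C)"

text \<open>The naturality square of \<open>t\<close> at \<open>\<^bold>p\<^sub>a\<close>, with top \<open>t\<close> at \<open>a\<close>.\<close>

definition nt_square :: "('o, 'm, 'x) precontextual_scheme \<Rightarrow> ('o, 'm, 'p, 'n) nat_trans
    \<Rightarrow> 'o \<Rightarrow> 'n square" where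
  "nt_square A t a = \<lparr>sq_top = nt_at t a, sq_bot = nt_at t (bdry A a),
     sq_left = amap (nt_dom t) (proj A a), sq_right = amap (nt_cod t) (proj A a)\<rparr>"

text \<open>The distinguished square whose top left corner is the codomain of the gap map of
  \<open>nt_square A t a\<close>.\<close>

definition gap_pb :: "('o, 'm, 'x) precontextual_scheme \<Rightarrow> ('p, 'n, 'y) precontextual_scheme
    \<Rightarrow> ('o, 'm, 'p, 'n) nat_trans \<Rightarrow> 'o \<Rightarrow> 'n square" where
  "gap_pb A C t a = dist_pb C (amap (nt_cod t) (proj A a)) (nt_at t (bdry A a))"

text \<open>The map from the corner of \<open>T\<close> to the corner of \<open>T'\<close> induced by \<open>h\<close> between the top right
  corners and \<open>k\<close> between the bottom left corners.\<close>

definition induced_map :: "('o, 'm, 'x) category_scheme \<Rightarrow> 'm square \<Rightarrow> 'm square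
    \<Rightarrow> 'm \<Rightarrow> 'm \<Rightarrow> 'm" where
  "induced_map C T T' h k = pb_map C T' (Comp C h (sq_top T)) (Comp C k (sq_left T))"

definition indexed_sort :: "('o, 'm, 'x) precontextual_scheme \<Rightarrow> ('p, 'n, 'y) precontextual_scheme
    \<Rightarrow> ('o, 'm, 'p, 'n) nat_trans \<Rightarrow> bool" where
  "indexed_sort A C t \<longleftrightarrow>
    natural_transformation A C t \<and> in_D A C (nt_dom t) \<and> in_D A C (nt_cod t) \<and>
    (\<forall>a\<in>Obj A. len A a \<ge> 1 \<longrightarrow> rel_display_1 C (nt_square A t a)) \<and>
    (\<forall>S\<in>Qs A. let a = Dom A (sq_top S); b = Cod A (sq_top S) in
      \<lparr>sq_top = amap (nt_dom t) (sq_top S),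
       sq_bot = induced_map C (gap_pb A C t a) (gap_pb A C t b)
         (amap (nt_cod t) (sq_top S)) (amap (nt_dom t) (sq_bot S)),
       sq_left = gap_map C (nt_square A t a),
       sq_right = gap_map C (nt_square A t b)\<rparr> \<in> distinguished C)"

definition nt_comm_square :: "('o, 'm, 'x) category_scheme \<Rightarrow> ('p, 'n, 'y) category_scheme
    \<Rightarrow> ('o, 'm, 'p, 'n) nat_trans square \<Rightarrow> bool" where
  "nt_comm_square A C S \<longleftrightarrow>
    natural_transformation A C (sq_top S) \<and> natural_transformation A C (sq_bot S) \<and>
    natural_transformation A C (sq_left S) \<and> natural_transformation A C (sq_right S) \<and>
    nt_dom (sq_top S) = nt_dom (sq_left S) \<and> nt_cod (sq_top S) = nt_dom (sq_right S) \<and>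
    nt_cod (sq_left S) = nt_dom (sq_bot S) \<and> nt_cod (sq_bot S) = nt_cod (sq_right S) \<and>
    nt_comp A C (sq_right S) (sq_top S) = nt_comp A C (sq_bot S) (sq_left S)"

definition indexed_dist_square :: "('o, 'm, 'x) precontextual_scheme
    \<Rightarrow> ('p, 'n, 'y) precontextual_scheme \<Rightarrow> ('o, 'm, 'p, 'n) nat_trans square \<Rightarrow> bool" where
  "indexed_dist_square A C S \<longleftrightarrow> nt_comm_square A C S \<and>
    indexed_sort A C (sq_left S) \<and> indexed_sort A C (sq_right S) \<and>
    (\<forall>a\<in>Obj A. len A a \<ge> 1 \<longrightarrow>
      \<lparr>sq_top = nt_at (sq_top S) a,
       sq_bot = induced_map C (gap_pb A C (sq_left S) a) (gap_pb A C (sq_right S) a)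
         (nt_at (sq_bot S) a) (nt_at (sq_top S) (bdry A a)),
       sq_left = gap_map C (nt_square A (sq_left S) a),
       sq_right = gap_map C (nt_square A (sq_right S) a)\<rparr> \<in> distinguished C)"

text \<open>Both \<open>C\<^sup>A\<close>-constructions have as morphisms \<open>x \<rightarrow> y\<close> the natural transformations between the
  last functors of \<open>x\<close> and \<open>y\<close>. Since \<open>x\<close> and \<open>y\<close> are not determined by those functors, an arrow
  records them.\<close>

record ('c, 't) arrow =
  src :: 'c
  tgt :: 'c
  und :: 't

definition trans_category :: "('o, 'm, 'x) category_scheme \<Rightarrow> ('p, 'n, 'y) category_scheme
    \<Rightarrow> 'c set \<Rightarrow> ('c \<Rightarrow> ('o, 'm, 'p, 'n) func)
    \<Rightarrow> ('c, ('c, ('o, 'm, 'p, 'n) nat_trans) arrow) category" where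
  "trans_category A C X U = \<lparr>
     Obj = X,
     Arr = {f. src f \<in> X \<and> tgt f \<in> X \<and> natural_transformation A C (und f) \<and>
               nt_dom (und f) = U (src f) \<and> nt_cod (und f) = U (tgt f)},
     Dom = src,
     Cod = tgt,
     Id = (\<lambda>x. \<lparr>src = x, tgt = x, und = nt_id A C (U x)\<rparr>),
     Comp = (\<lambda>g f. \<lparr>src = src f, tgt = tgt g, und = nt_comp A C (und g) (und f)\<rparr>)\<rparr>"

definition und_square :: "('c, 't) arrow square \<Rightarrow> 't square" where
  "und_square S = \<lparr>sq_top = und (sq_top S), sq_bot = und (sq_bot S),
     sq_left = und (sq_left S), sq_right = und (sq_right S)\<rparr>"

text \<open>The chain \<open>F\<^sub>n \<rightarrow> \<dots> \<rightarrow> F\<^sub>0\<close> is represented by the functors \<open>[F\<^sub>0, \<dots>, F\<^sub>n]\<close> and the sorts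
  \<open>[F\<^sub>1 \<rightarrow> F\<^sub>0, \<dots>, F\<^sub>n \<rightarrow> F\<^sub>n\<^sub>-\<^sub>1]\<close>.\<close>

record ('o, 'm, 'p, 'n) chain =
  functors :: "('o, 'm, 'p, 'n) func list"
  sorts :: "('o, 'm, 'p, 'n) nat_trans list"

definition sort_chains :: "('o, 'm, 'x) precontextual_scheme
    \<Rightarrow> ('p, 'n, 'y) precontextual_scheme \<Rightarrow> ('o, 'm, 'p, 'n) chain set" where
  "sort_chains A C = {x. length (functors x) = Suc (length (sorts x)) \<and>
     functors x ! 0 = const_func A C (one C) \<and>
     (\<forall>i < length (sorts x). indexed_sort A C (sorts x ! i) \<and>
        nt_dom (sorts x ! i) = functors x ! Suc i \<and> nt_cod (sorts x ! i) = functors x ! i)}"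

definition chain_len :: "('o, 'm, 'p, 'n) chain \<Rightarrow> nat" where
  "chain_len x = length (sorts x)"

definition chain_bdry :: "('o, 'm, 'p, 'n) chain \<Rightarrow> ('o, 'm, 'p, 'n) chain" where
  "chain_bdry x = (if chain_len x = 0 then x
     else \<lparr>functors = butlast (functors x), sorts = butlast (sorts x)\<rparr>)"

definition chain_proj :: "('o, 'm, 'p, 'n) chain
    \<Rightarrow> (('o, 'm, 'p, 'n) chain, ('o, 'm, 'p, 'n) nat_trans) arrow" where
  "chain_proj x = \<lparr>src = x, tgt = chain_bdry x, und = last (sorts x)\<rparr>"

definition exponential_cat :: "('p, 'n, 'y) precontextual_scheme
    \<Rightarrow> ('o, 'm, 'x) precontextual_scheme \<Rightarrow> (('o, 'm, 'p, 'n) chain,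
      (('o, 'm, 'p, 'n) chain, ('o, 'm, 'p, 'n) nat_trans) arrow) category" where
  "exponential_cat C A = trans_category A C (sort_chains A C) (\<lambda>x. last (functors x))"

definition exponential :: "('p, 'n, 'y) precontextual_scheme
    \<Rightarrow> ('o, 'm, 'x) precontextual_scheme \<Rightarrow> (('o, 'm, 'p, 'n) chain,
      (('o, 'm, 'p, 'n) chain, ('o, 'm, 'p, 'n) nat_trans) arrow) precontextual" where
  "exponential C A = category.extend (exponential_cat C A)
     (precontextual.fields chain_len chain_bdry chain_proj
       {S. comm_square (exponential_cat C A) S \<and>
           (\<exists>x\<in>sort_chains A C. chain_len x \<ge> 1 \<and> sq_left S = chain_proj x) \<and>
           (\<exists>y\<in>sort_chains A C. chain_len y \<ge> 1 \<and> sq_right S = chain_proj y) \<and>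
           indexed_dist_square A C (und_square S)})"


section \<open>The power by a category\<close>

definition proj_trans :: "('o, 'm, 'x) category_scheme \<Rightarrow> ('p, 'n, 'y) precontextual_scheme
    \<Rightarrow> ('o, 'm, 'p, 'n) func \<Rightarrow> ('o, 'm, 'p, 'n) func \<Rightarrow> ('o, 'm, 'p, 'n) nat_trans" where
  "proj_trans A C G F = \<lparr>nt_dom = G, nt_cod = F, nt_at = (\<lambda>a\<in>Obj A. proj C (omap G a))\<rparr>"

definition power_seqs :: "('o, 'm, 'x) category_scheme \<Rightarrow> ('p, 'n, 'y) precontextual_scheme
    \<Rightarrow> ('o, 'm, 'p, 'n) func list set" where
  "power_seqs A C = {Fs. Fs \<noteq> [] \<and> (\<forall>F\<in>set Fs. is_functor A C F) \<and>
     Fs ! 0 = const_func A C (one C) \<and>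
     (\<forall>i. 1 \<le> i \<and> i < length Fs \<longrightarrow>
        (\<forall>a\<in>Obj A. len C (omap (Fs ! i) a) = i \<and>
           bdry C (omap (Fs ! i) a) = omap (Fs ! (i - 1)) a) \<and>
        natural_transformation A C (proj_trans A C (Fs ! i) (Fs ! (i - 1))))}"

definition seq_len :: "('o, 'm, 'p, 'n) func list \<Rightarrow> nat" where
  "seq_len Fs = length Fs - 1"

definition seq_bdry :: "('o, 'm, 'p, 'n) func list \<Rightarrow> ('o, 'm, 'p, 'n) func list" where
  "seq_bdry Fs = (if seq_len Fs = 0 then Fs else butlast Fs)"

definition seq_proj :: "('o, 'm, 'x) category_scheme \<Rightarrow> ('p, 'n, 'y) precontextual_scheme
    \<Rightarrow> ('o, 'm, 'p, 'n) func list
    \<Rightarrow> (('o, 'm, 'p, 'n) func list, ('o, 'm, 'p, 'n) nat_trans) arrow" where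
  "seq_proj A C Fs = \<lparr>src = Fs, tgt = seq_bdry Fs,
     und = proj_trans A C (last Fs) (last (seq_bdry Fs))\<rparr>"

definition square_at :: "('o, 'm, 'p, 'n) nat_trans square \<Rightarrow> 'o \<Rightarrow> 'n square" where
  "square_at S a = \<lparr>sq_top = nt_at (sq_top S) a, sq_bot = nt_at (sq_bot S) a,
     sq_left = nt_at (sq_left S) a, sq_right = nt_at (sq_right S) a\<rparr>"

definition power_cat :: "('p, 'n, 'y) precontextual_scheme \<Rightarrow> ('o, 'm, 'x) category_scheme
    \<Rightarrow> (('o, 'm, 'p, 'n) func list,
      (('o, 'm, 'p, 'n) func list, ('o, 'm, 'p, 'n) nat_trans) arrow) category" where
  "power_cat C A = trans_category A C (power_seqs A C) last"

definition power_by_cat :: "('p, 'n, 'y) precontextual_scheme \<Rightarrow> ('o, 'm, 'x) category_scheme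
    \<Rightarrow> (('o, 'm, 'p, 'n) func list,
      (('o, 'm, 'p, 'n) func list, ('o, 'm, 'p, 'n) nat_trans) arrow) precontextual" where
  "power_by_cat C A = category.extend (power_cat C A)
     (precontextual.fields seq_len seq_bdry (seq_proj A C)
       {S. comm_square (power_cat C A) S \<and>
           (\<exists>x\<in>power_seqs A C. seq_len x \<ge> 1 \<and> sq_left S = seq_proj A C x) \<and>
           (\<exists>y\<in>power_seqs A C. seq_len y \<ge> 1 \<and> sq_right S = seq_proj A C y) \<and>
           (\<forall>a\<in>Obj A. square_at (und_square S) a \<in> Qs C)})"


section \<open>The precontextual category of a category\<close>

datatype 'o plus_obj = Base 'o | Apex

text \<open>\<open>ToApex x\<close> is the unique arrow from \<open>x\<close> to the adjoined terminal object; in particular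
  \<open>ToApex Apex\<close> is the identity of \<open>Apex\<close>.\<close>

datatype ('o, 'm) plus_arr = BaseArr 'm | ToApex "'o plus_obj"

fun plus_Dom :: "('o, 'm, 'x) category_scheme \<Rightarrow> ('o, 'm) plus_arr \<Rightarrow> 'o plus_obj" where
  "plus_Dom A (BaseArr f) = Base (Dom A f)"
| "plus_Dom A (ToApex x) = x"

fun plus_Cod :: "('o, 'm, 'x) category_scheme \<Rightarrow> ('o, 'm) plus_arr \<Rightarrow> 'o plus_obj" where
  "plus_Cod A (BaseArr f) = Base (Cod A f)"
| "plus_Cod A (ToApex x) = Apex"

fun plus_Id :: "('o, 'm, 'x) category_scheme \<Rightarrow> 'o plus_obj \<Rightarrow> ('o, 'm) plus_arr" where
  "plus_Id A (Base a) = BaseArr (Id A a)"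
| "plus_Id A Apex = ToApex Apex"

text \<open>The last equation matters only for \<open>g = ToApex x\<close>: \<open>BaseArr g\<close> and \<open>ToApex y\<close> are never
  composable in this order.\<close>

fun plus_Comp :: "('o, 'm, 'x) category_scheme \<Rightarrow> ('o, 'm) plus_arr \<Rightarrow> ('o, 'm) plus_arr
    \<Rightarrow> ('o, 'm) plus_arr" where
  "plus_Comp A (BaseArr g) (BaseArr f) = BaseArr (Comp A g f)"
| "plus_Comp A g f = ToApex (plus_Dom A f)"

definition adjoin_terminal :: "('o, 'm, 'x) category_scheme
    \<Rightarrow> ('o plus_obj, ('o, 'm) plus_arr) category" where
  "adjoin_terminal A = \<lparr>
     Obj = insert Apex (Base ` Obj A),
     Arr = BaseArr ` Arr A \<union> ToApex ` insert Apex (Base ` Obj A),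
     Dom = plus_Dom A, Cod = plus_Cod A, Id = plus_Id A, Comp = plus_Comp A\<rparr>"

definition pre_of_cat :: "('o, 'm, 'x) category_scheme
    \<Rightarrow> ('o plus_obj, ('o, 'm) plus_arr) precontextual" where
  "pre_of_cat A = category.extend (adjoin_terminal A)
     (precontextual.fields (\<lambda>x. if x = Apex then 0 else 1) (\<lambda>_. Apex) ToApex {})"

lemma category_adjoin_terminal:
  assumes "category A"
  shows "category (adjoin_terminal A)"
proof -
  interpret category A by fact
  show ?thesis
    by unfold_locales
      (auto simp: adjoin_terminal_def Dom_in Cod_in Id_in Dom_Id Cod_Id Comp_in Dom_Comp Cod_Comp
        Comp_Id Id_Comp Comp_assoc)
qed

lemma precontextual_pre_of_cat:
  assumes "category A"
  shows "precontextual_category (pre_of_cat A)"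
proof -
  interpret P: category "adjoin_terminal A"
    using assms by (rule category_adjoin_terminal)
  have sel: "Obj (pre_of_cat A) = Obj (adjoin_terminal A)" "Arr (pre_of_cat A) = Arr (adjoin_terminal A)"
    "Dom (pre_of_cat A) = Dom (adjoin_terminal A)" "Cod (pre_of_cat A) = Cod (adjoin_terminal A)"
    "Id (pre_of_cat A) = Id (adjoin_terminal A)" "Comp (pre_of_cat A) = Comp (adjoin_terminal A)"
    by (simp_all add: pre_of_cat_def precontextual.defs category.defs)
  have "category (pre_of_cat A)"
    unfolding category_def sel using P.category_axioms unfolding category_def .
  then show ?thesis
    unfolding precontextual_category_def precontextual_category_axioms_def
    by (auto simp: sel homset_def pre_of_cat_def adjoin_terminal_def precontextual.defs category.defs)
qed

end

theory Submission
  imports Defs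
begin

text \<open>
  A functor on \<open>A\<^sub>+\<close> sending the apex to the terminal object \<open>1\<close> is the same thing as a functor on
  \<open>A\<close>, since arrows into \<open>1\<close> are unique; it preserves display maps automatically, because every
  arrow into \<open>1\<close> is a display map. The distinguished pullback of such an arrow along the identity
  of \<open>1\<close> is an identity square, so the gap map of \<open>\<pi> : G \<Rightarrow> F\<close> at \<open>a\<close> is the component \<open>\<pi>\<^sub>a\<close> itself.
  Hence \<open>\<pi>\<close> is an indexed sort iff \<open>\<pi>\<^sub>a\<close> is the map \<open>\<^bold>p\<close> at \<open>G a\<close> for every \<open>a\<close>, and indexed
  distinguished squares are the pointwise distinguished ones. Restriction to \<open>A\<close> is therefore an
  isomorphism of all the structure, along which contextuality is transported from the power, where
  it follows from pointwise pullbacks.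
\<close>


section \<open>Functor categories\<close>

text \<open>A contextual isomorphism presupposes that both of its ends are contextual, so
  contextuality of the exponential has to be obtained along the way. Checking the axioms there would
  mean handling gap maps and chains of sorts; the power has the same axioms in pointwise form.
  Within the power the delicate axiom is the unique distinguished pullback: \<open>C\<close>
  supplies a corner for each object of \<open>A\<close> separately, with no connection between the
  choices, and the corners must be made into a functor. The pullback property forces its action on
  arrows, and the same property shows that the functor is unique as a functor and not only in its
  values on objects. Lengths are the second obstacle. A chain of sorts carries no condition on
  absolute lengths, whereas the i-th functor of a sequence in the power has values of length i. The
  condition is recovered by induction along the chain: it starts at the object of length 0, and a
  canonical projection lowers the length by exactly one.\<close>

lemma func_eqI:
  assumes F: "is_functor A B F" and G: "is_functor A B G"
    and o: "\<And>a. a \<in> Obj A \<Longrightarrow> omap F a = omap G a"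
    and m: "\<And>f. f \<in> Arr A \<Longrightarrow> amap F f = amap G f"
  shows "F = G"
proof (rule func.equality)
  show "omap F = omap G"
    using PiE_ext[OF is_functor.omap_in[OF F] is_functor.omap_in[OF G]] o by blast
  show "amap F = amap G"
    using PiE_ext[OF is_functor.amap_in[OF F] is_functor.amap_in[OF G]] m by blast
qed simp

lemma nat_trans_eqI:
  assumes s: "natural_transformation A B s" and t: "natural_transformation A B t"
    and "nt_dom s = nt_dom t" and "nt_cod s = nt_cod t"
    and a: "\<And>a. a \<in> Obj A \<Longrightarrow> nt_at s a = nt_at t a"
  shows "s = t"
proof (rule nat_trans.equality)
  show "nt_at s = nt_at t"
    using PiE_ext[OF natural_transformation.nt_at_in[OF s] natural_transformation.nt_at_in[OF t]] a
    by blast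
qed (use assms in simp_all)

lemma natural_transformationI:
  assumes "is_functor A B F" and "is_functor A B G" and "t \<in> extensional (Obj A)"
    and "\<And>a. a \<in> Obj A \<Longrightarrow> t a \<in> homset B (omap F a) (omap G a)"
    and "\<And>f. f \<in> Arr A \<Longrightarrow>
      Comp B (t (Cod A f)) (amap F f) = Comp B (amap G f) (t (Dom A f))"
  shows "natural_transformation A B \<lparr>nt_dom = F, nt_cod = G, nt_at = t\<rparr>"
proof -
  have "t \<in> Obj A \<rightarrow>\<^sub>E Arr B"
    using assms by (auto simp: PiE_def homset_def)
  then show ?thesis
    using assms unfolding natural_transformation_def natural_transformation_axioms_def
    by (auto simp: homset_def)
qed

lemma nat_trans_at:
  assumes "natural_transformation A B t" and "a \<in> Obj A"
  shows "nt_at t a \<in> Arr B" "Dom B (nt_at t a) = omap (nt_dom t) a"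
    "Cod B (nt_at t a) = omap (nt_cod t) a"
    "nt_at t a \<in> homset B (omap (nt_dom t) a) (omap (nt_cod t) a)"
proof -
  interpret natural_transformation A B t by fact
  show "nt_at t a \<in> Arr B" "Dom B (nt_at t a) = omap (nt_dom t) a"
    "Cod B (nt_at t a) = omap (nt_cod t) a"
    using nt_at_in Dom_nt_at Cod_nt_at assms(2) by auto
  then show "nt_at t a \<in> homset B (omap (nt_dom t) a) (omap (nt_cod t) a)"
    by (simp add: homset_def)
qed

lemma functor_at:
  assumes "is_functor A B F"
  shows "a \<in> Obj A \<Longrightarrow> omap F a \<in> Obj B" "f \<in> Arr A \<Longrightarrow> amap F f \<in> Arr B"
    "f \<in> Arr A \<Longrightarrow> Dom B (amap F f) = omap F (Dom A f)"
    "f \<in> Arr A \<Longrightarrow> Cod B (amap F f) = omap F (Cod A f)"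
proof -
  interpret is_functor A B F by fact
  show "a \<in> Obj A \<Longrightarrow> omap F a \<in> Obj B" "f \<in> Arr A \<Longrightarrow> amap F f \<in> Arr B"
    "f \<in> Arr A \<Longrightarrow> Dom B (amap F f) = omap F (Dom A f)"
    "f \<in> Arr A \<Longrightarrow> Cod B (amap F f) = omap F (Cod A f)"
    using omap_in amap_in Dom_amap Cod_amap by auto
qed

lemma nt_functors:
  assumes "natural_transformation A B t"
  shows "is_functor A B (nt_dom t)" "is_functor A B (nt_cod t)"
  using assms unfolding natural_transformation_def by auto

lemma functor_const_func:
  assumes "category A" and "category B" and "c \<in> Obj B"
  shows "is_functor A B (const_func A B c)"
proof -
  interpret A: category A by fact
  interpret B: category B by fact
  show ?thesis
    using assms(3) B.Comp_Id[OF B.Id_in[OF assms(3)]]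
    by unfold_locales (auto simp: const_func_def A.Dom_in A.Cod_in A.Id_in A.Comp_in
      B.Id_in B.Dom_Id B.Cod_Id)
qed

lemma natural_transformation_nt_id:
  assumes "is_functor A B F"
  shows "natural_transformation A B (nt_id A B F)"
proof -
  interpret F: is_functor A B F by fact
  have "Comp B (Id B (omap F (Cod A f))) (amap F f) = Comp B (amap F f) (Id B (omap F (Dom A f)))"
    if "f \<in> Arr A" for f
    using F.cod.Comp_Id F.cod.Id_Comp functor_at[OF assms] that by metis
  then show ?thesis
    unfolding nt_id_def
    by (intro natural_transformationI)
      (simp_all add: assms homset_def F.cod.Id_in F.cod.Dom_Id F.cod.Cod_Id functor_at[OF assms]
          F.dom.Dom_in F.dom.Cod_in)
qed

lemma natural_transformation_nt_comp:
  assumes s: "natural_transformation A B s" and t: "natural_transformation A B t"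
    and st: "nt_cod s = nt_dom t"
  shows "natural_transformation A B (nt_comp A B t s)"
proof -
  interpret A: category A using s unfolding natural_transformation_def is_functor_def by auto
  interpret B: category B using s unfolding natural_transformation_def is_functor_def by auto
  interpret S: natural_transformation A B s by fact
  interpret T: natural_transformation A B t by fact
  note at = nat_trans_at[OF s] nat_trans_at[OF t] functor_at[OF nt_functors(1)[OF s]]
    functor_at[OF nt_functors(1)[OF t]] functor_at[OF nt_functors(2)[OF t]]
    A.Dom_in A.Cod_in
  have nat: "Comp B (Comp B (nt_at t (Cod A f)) (nt_at s (Cod A f))) (amap (nt_dom s) f)
    = Comp B (amap (nt_cod t) f) (Comp B (nt_at t (Dom A f)) (nt_at s (Dom A f)))"
    if f: "f \<in> Arr A" for f
  proof -
    have "Comp B (Comp B (nt_at t (Cod A f)) (nt_at s (Cod A f))) (amap (nt_dom s) f)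
      = Comp B (nt_at t (Cod A f)) (Comp B (nt_at s (Cod A f)) (amap (nt_dom s) f))"
      using f st by (intro B.Comp_assoc[symmetric]) (auto simp: at)
    also have "\<dots> = Comp B (nt_at t (Cod A f)) (Comp B (amap (nt_dom t) f) (nt_at s (Dom A f)))"
      using S.naturality[OF f] st by simp
    also have "\<dots> = Comp B (Comp B (nt_at t (Cod A f)) (amap (nt_dom t) f)) (nt_at s (Dom A f))"
      using f st by (intro B.Comp_assoc) (auto simp: at)
    also have "\<dots> = Comp B (Comp B (amap (nt_cod t) f) (nt_at t (Dom A f))) (nt_at s (Dom A f))"
      using T.naturality[OF f] by simp
    also have "\<dots> = Comp B (amap (nt_cod t) f) (Comp B (nt_at t (Dom A f)) (nt_at s (Dom A f)))"
      using f st by (intro B.Comp_assoc[symmetric]) (auto simp: at)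
    finally show ?thesis .
  qed
  show ?thesis
    unfolding nt_comp_def
    by (rule natural_transformationI)
      (use nat st in \<open>auto simp: homset_def at nt_functors[OF s] nt_functors[OF t]
        B.Comp_in B.Dom_Comp B.Cod_Comp\<close>)
qed

lemma nt_id_simps [simp]:
  "nt_dom (nt_id A B F) = F" "nt_cod (nt_id A B F) = F"
  "a \<in> Obj A \<Longrightarrow> nt_at (nt_id A B F) a = Id B (omap F a)"
  by (simp_all add: nt_id_def)

lemma nt_comp_simps [simp]:
  "nt_dom (nt_comp A B t s) = nt_dom s" "nt_cod (nt_comp A B t s) = nt_cod t"
  "a \<in> Obj A \<Longrightarrow> nt_at (nt_comp A B t s) a = Comp B (nt_at t a) (nt_at s a)"
  by (simp_all add: nt_comp_def)

lemma nt_comp_eq_iff: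
  assumes "natural_transformation A B s" "natural_transformation A B t" "nt_cod s = nt_dom t"
    and "natural_transformation A B r" "nt_dom s = nt_dom r" "nt_cod t = nt_cod r"
  shows "nt_comp A B t s = r \<longleftrightarrow> (\<forall>a\<in>Obj A. Comp B (nt_at t a) (nt_at s a) = nt_at r a)"
proof
  assume "\<forall>a\<in>Obj A. Comp B (nt_at t a) (nt_at s a) = nt_at r a"
  then show "nt_comp A B t s = r"
    using assms by (intro nat_trans_eqI[OF natural_transformation_nt_comp]) auto
qed auto

text \<open>Stated for an arbitrary set \<open>X\<close> of objects with a map \<open>U\<close> to
  functors, because the exponential and the power both have this form. The laws hold componentwise
  for the transformations; the recorded endpoints keep objects apart that \<open>U\<close>
  identifies.\<close>

lemma category_trans_category:
  assumes B: "category A" "category B" and U: "\<And>x. x \<in> X \<Longrightarrow> is_functor A B (U x)"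
  shows "category (trans_category A B X U)"
proof -
  interpret B: category B by fact
  have Comp_Id: "nt_comp A B t (nt_id A B (nt_dom t)) = t"
    and Id_Comp: "nt_comp A B (nt_id A B (nt_cod t)) t = t"
    if t: "natural_transformation A B t" for t
    using nt_functors[OF t] t B.Comp_Id[OF nat_trans_at(1)[OF t]]
      B.Id_Comp[OF nat_trans_at(1)[OF t]]
    by (subst nt_comp_eq_iff;
        simp add: natural_transformation_nt_id nat_trans_at[OF t])+
  have assoc: "nt_comp A B r (nt_comp A B t s) = nt_comp A B (nt_comp A B r t) s"
    if "natural_transformation A B s" "natural_transformation A B t"
      "natural_transformation A B r" "nt_cod s = nt_dom t" "nt_cod t = nt_dom r" for r s t
    using that
    by (intro nat_trans_eqI)
      (auto simp: nat_trans_at intro!: natural_transformation_nt_comp B.Comp_assoc)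
  show ?thesis
    by unfold_locales
      (auto simp: trans_category_def Comp_Id[of "und _", simplified] assoc
        intro: natural_transformation_nt_comp natural_transformation_nt_id U,
       (metis Comp_Id Id_Comp arrow.surjective old.unit.exhaust)+)
qed

section \<open>Pointwise pullbacks\<close>

context category
begin

text \<open>Horizontal pasting of two commuting squares along the common edge \<open>y\<close>. Read
  on transposed squares it is vertical pasting, so one computation serves both.\<close>

lemma comm_paste:
  assumes "f \<in> Arr C" "f' \<in> Arr C" "g \<in> Arr C" "g' \<in> Arr C" "x \<in> Arr C" "y \<in> Arr C" "z \<in> Arr C"
    and "Cod C f = Dom C f'" "Cod C g = Dom C g'" "Cod C x = Dom C g" "Cod C f = Dom C y"
    and "Cod C f' = Dom C z" "Cod C y = Dom C g'"
    and "Comp C y f = Comp C g x" "Comp C z f' = Comp C g' y"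
  shows "Comp C z (Comp C f' f) = Comp C (Comp C g' g) x"
proof -
  have "Comp C z (Comp C f' f) = Comp C (Comp C g' y) f"
    using assms by (simp add: Comp_assoc)
  also have "\<dots> = Comp C g' (Comp C g x)"
    using assms by (simp add: Comp_assoc[symmetric])
  also have "\<dots> = Comp C (Comp C g' g) x"
    using assms by (simp add: Comp_assoc)
  finally show ?thesis .
qed

lemma comm_square_hcomp:
  assumes "comm_square C S" "comm_square C T" "sq_right S = sq_left T"
  shows "comm_square C (hcomp C S T)"
  using assms
  by (auto simp: comm_square_def hcomp_def Comp_in Dom_Comp Cod_Comp intro!: comm_paste[where y = "sq_left T"])

text \<open>The legs of a pullback are jointly monic, since \<open>w\<close> and \<open>w'\<close>
  mediate for the same cone. Equations between arrows into a corner are proved this way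
  below.\<close>

lemma pullback_unique:
  assumes S: "pullback_square C S"
    and w: "w \<in> homset C x (Dom C (sq_top S))" and w': "w' \<in> homset C x (Dom C (sq_top S))"
    and top: "Comp C (sq_top S) w = Comp C (sq_top S) w'"
    and left: "Comp C (sq_left S) w = Comp C (sq_left S) w'"
  shows "w = w'"
proof -
  let ?u = "Comp C (sq_top S) w" and ?v = "Comp C (sq_left S) w"
  have c: "comm_square C S"
    using S by (simp add: pullback_square_def)
  have "Comp C (sq_right S) ?u = Comp C (sq_bot S) ?v"
    using c w by (simp add: Comp_assoc comm_square_def homset_def)
  moreover have "?u \<in> Arr C" "?v \<in> Arr C" "Dom C ?u = x" "Dom C ?v = x"
    "Cod C ?u = Dom C (sq_right S)" "Cod C ?v = Dom C (sq_bot S)"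
    using c w by (simp_all add: comm_square_def homset_def Comp_in Dom_Comp Cod_Comp)
  ultimately have "\<exists>!w. w \<in> homset C x (Dom C (sq_top S)) \<and>
      Comp C (sq_top S) w = ?u \<and> Comp C (sq_left S) w = ?v"
    using S unfolding pullback_square_def by metis
  then show ?thesis
    using w w' top left by metis
qed

lemma pb_map:
  assumes "pullback_square C S" and "u \<in> Arr C" "v \<in> Arr C" "Dom C u = Dom C v"
    "Cod C u = Dom C (sq_right S)" "Cod C v = Dom C (sq_bot S)"
    "Comp C (sq_right S) u = Comp C (sq_bot S) v"
  shows "pb_map C S u v \<in> homset C (Dom C u) (Dom C (sq_top S))"
    "Comp C (sq_top S) (pb_map C S u v) = u" "Comp C (sq_left S) (pb_map C S u v) = v"
proof -
  have "\<exists>!w. w \<in> homset C (Dom C u) (Dom C (sq_top S)) \<and>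
      Comp C (sq_top S) w = u \<and> Comp C (sq_left S) w = v"
    using assms unfolding pullback_square_def by blast
  from theI'[OF this] show "pb_map C S u v \<in> homset C (Dom C u) (Dom C (sq_top S))"
    "Comp C (sq_top S) (pb_map C S u v) = u" "Comp C (sq_left S) (pb_map C S u v) = v"
    unfolding pb_map_def by blast+
qed

end

text \<open>Pullbacks of functors are computed pointwise from any family \<open>T\<close> of
  pullbacks, without coherence between different objects. In the power \<open>T a\<close> will be
  the distinguished square, so that the corner functor gets exactly the prescribed values.\<close>

lemma functor_pullback_exists:
  assumes A: "category A" and C: "category C"
    and p: "natural_transformation A C p" and q: "natural_transformation A C q"
    and cod: "nt_cod p = nt_cod q"
    and T: "\<And>a. a \<in> Obj A \<Longrightarrow>
      pullback_square C (T a) \<and> sq_right (T a) = nt_at p a \<and> sq_bot (T a) = nt_at q a"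
  obtains H where "is_functor A C H" "\<And>a. a \<in> Obj A \<Longrightarrow> omap H a = Dom C (sq_top (T a))"
    "natural_transformation A C \<lparr>nt_dom = H, nt_cod = nt_dom p, nt_at = (\<lambda>a\<in>Obj A. sq_top (T a))\<rparr>"
    "natural_transformation A C \<lparr>nt_dom = H, nt_cod = nt_dom q, nt_at = (\<lambda>a\<in>Obj A. sq_left (T a))\<rparr>"
proof -
  interpret A: category A by fact
  interpret C: category C by fact
  interpret P: natural_transformation A C p by fact
  interpret Q: natural_transformation A C q by fact
  let ?F = "nt_dom p" and ?G = "nt_dom q" and ?B = "nt_cod q"
  have B: "is_functor A C ?B" "is_functor A C ?F" "is_functor A C ?G"
    using nt_functors p q by metis+
  note at = nat_trans_at(1-3)[OF p, unfolded cod] nat_trans_at(1-3)[OF q]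
    functor_at[OF B(1)] functor_at[OF B(2)] functor_at[OF B(3)] A.Dom_in A.Cod_in
  have sq: "sq_top (T a) \<in> Arr C" "sq_left (T a) \<in> Arr C"
      "Dom C (sq_left (T a)) = Dom C (sq_top (T a))"
      "Cod C (sq_top (T a)) = omap ?F a" "Cod C (sq_left (T a)) = omap ?G a"
      "Comp C (nt_at p a) (sq_top (T a)) = Comp C (nt_at q a) (sq_left (T a))"
    if a: "a \<in> Obj A" for a
  proof -
    have c: "comm_square C (T a)" and r: "sq_right (T a) = nt_at p a" "sq_bot (T a) = nt_at q a"
      using T[OF a] by (simp_all add: pullback_square_def)
    show "sq_top (T a) \<in> Arr C" "sq_left (T a) \<in> Arr C"
      "Dom C (sq_left (T a)) = Dom C (sq_top (T a))"
      "Cod C (sq_top (T a)) = omap ?F a" "Cod C (sq_left (T a)) = omap ?G a"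
      "Comp C (nt_at p a) (sq_top (T a)) = Comp C (nt_at q a) (sq_left (T a))"
      using c[unfolded comm_square_def r] a by (simp_all add: at)
  qed
  \<comment> \<open>The only possible action on \<open>f\<close>: the map of corners that makes both
    projections natural.\<close>
  define m where "m f = pb_map C (T (Cod A f)) (Comp C (amap ?F f) (sq_top (T (Dom A f))))
    (Comp C (amap ?G f) (sq_left (T (Dom A f))))" for f
  have m: "m f \<in> homset C (Dom C (sq_top (T (Dom A f)))) (Dom C (sq_top (T (Cod A f))))"
    "Comp C (sq_top (T (Cod A f))) (m f) = Comp C (amap ?F f) (sq_top (T (Dom A f)))"
    "Comp C (sq_left (T (Cod A f))) (m f) = Comp C (amap ?G f) (sq_left (T (Dom A f)))"
    if f: "f \<in> Arr A" for f
  proof -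
    let ?u = "Comp C (amap ?F f) (sq_top (T (Dom A f)))"
    let ?v = "Comp C (amap ?G f) (sq_left (T (Dom A f)))"
    \<comment> \<open>The two legs form a cone: naturality of \<open>p\<close> and the square at
      \<open>Dom A f\<close> lead to \<open>q\<close>, and naturality of \<open>q\<close> leads back
      to the required form.\<close>
    have "Comp C (nt_at p (Cod A f)) ?u =
      Comp C (Comp C (amap ?B f) (nt_at q (Dom A f))) (sq_left (T (Dom A f)))"
      using f P.naturality[OF f] by (intro C.comm_paste) (auto simp: at sq cod)
    also have "\<dots> = Comp C (Comp C (nt_at q (Cod A f)) (amap ?G f)) (sq_left (T (Dom A f)))"
      using Q.naturality[OF f] by simp
    also have "\<dots> = Comp C (nt_at q (Cod A f)) ?v"
      using f by (simp add: C.Comp_assoc at sq)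
    finally have eq: "Comp C (nt_at p (Cod A f)) ?u = Comp C (nt_at q (Cod A f)) ?v" .
    have T': "pullback_square C (T (Cod A f))" "sq_right (T (Cod A f)) = nt_at p (Cod A f)"
      "sq_bot (T (Cod A f)) = nt_at q (Cod A f)"
      using T f A.Cod_in by blast+
    have uv: "?u \<in> Arr C" "?v \<in> Arr C" "Dom C ?u = Dom C (sq_top (T (Dom A f)))"
      "Dom C ?u = Dom C ?v"
      "Cod C ?u = Dom C (sq_right (T (Cod A f)))" "Cod C ?v = Dom C (sq_bot (T (Cod A f)))"
      using f by (simp_all add: at sq T' C.Comp_in C.Dom_Comp C.Cod_Comp)
    show "m f \<in> homset C (Dom C (sq_top (T (Dom A f)))) (Dom C (sq_top (T (Cod A f))))"
      "Comp C (sq_top (T (Cod A f))) (m f) = ?u" "Comp C (sq_left (T (Cod A f))) (m f) = ?v"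
      using C.pb_map[OF T'(1) uv(1,2,4,5,6)] eq unfolding m_def T'(2,3) uv(3) by simp_all
  qed
  note m' = m(1)[unfolded homset_def, simplified]
  \<comment> \<open>Both functor laws follow from joint monicity: the two sides have equal
    composites with the top and with the left projection.\<close>
  have m_Id: "m (Id A a) = Id C (Dom C (sq_top (T a)))" if a: "a \<in> Obj A" for a
  proof (rule C.pullback_unique)
    show "pullback_square C (T a)" using T[OF a] by blast
    show "m (Id A a) \<in> homset C (Dom C (sq_top (T a))) (Dom C (sq_top (T a)))"
      using m(1)[of "Id A a"] a by (simp add: A.Id_in A.Dom_Id A.Cod_Id)
    show "Id C (Dom C (sq_top (T a))) \<in> homset C (Dom C (sq_top (T a))) (Dom C (sq_top (T a)))"
      using sq[OF a] by (simp add: homset_def C.Id_in C.Dom_Id C.Cod_Id C.Dom_in)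
    show "Comp C (sq_top (T a)) (m (Id A a)) = Comp C (sq_top (T a)) (Id C (Dom C (sq_top (T a))))"
      using m(2)[of "Id A a"] a sq[OF a] C.Comp_Id[of "sq_top (T a)"] C.Id_Comp[of "sq_top (T a)"]
      by (simp add: A.Id_in A.Dom_Id A.Cod_Id P.dom.amap_Id)
    show "Comp C (sq_left (T a)) (m (Id A a)) = Comp C (sq_left (T a)) (Id C (Dom C (sq_top (T a))))"
      using m(3)[of "Id A a"] a sq[OF a] C.Comp_Id[of "sq_left (T a)"] C.Id_Comp[of "sq_left (T a)"]
      by (simp add: A.Id_in A.Dom_Id A.Cod_Id Q.dom.amap_Id)
  qed
  have m_Comp: "m (Comp A g f) = Comp C (m g) (m f)"
    if f: "f \<in> Arr A" and g: "g \<in> Arr A" and fg: "Cod A f = Dom A g" for f g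
  proof (rule C.pullback_unique)
    note gf = A.Comp_in[OF f g fg] A.Dom_Comp[OF f g fg] A.Cod_Comp[OF f g fg]
    show "pullback_square C (T (Cod A g))" using T g A.Cod_in by blast
    show "m (Comp A g f) \<in> homset C (Dom C (sq_top (T (Dom A f)))) (Dom C (sq_top (T (Cod A g))))"
      using m(1)[OF gf(1)] gf by simp
    show "Comp C (m g) (m f) \<in> homset C (Dom C (sq_top (T (Dom A f)))) (Dom C (sq_top (T (Cod A g))))"
      using m'[OF f] m'[OF g] fg by (simp add: homset_def C.Comp_in C.Dom_Comp C.Cod_Comp)
    have "Comp C (sq_top (T (Cod A g))) (Comp C (m g) (m f))
      = Comp C (Comp C (amap ?F g) (amap ?F f)) (sq_top (T (Dom A f)))"
      using f g fg m'[OF f] m'[OF g] m(2)[OF f] m(2)[OF g]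
      by (intro C.comm_paste[where y = "sq_top (T (Dom A g))"]) (auto simp: at sq)
    then show "Comp C (sq_top (T (Cod A g))) (m (Comp A g f))
      = Comp C (sq_top (T (Cod A g))) (Comp C (m g) (m f))"
      using m(2)[OF gf(1)] P.dom.amap_Comp[OF f g fg] gf by simp
    have "Comp C (sq_left (T (Cod A g))) (Comp C (m g) (m f))
      = Comp C (Comp C (amap ?G g) (amap ?G f)) (sq_left (T (Dom A f)))"
      using f g fg m'[OF f] m'[OF g] m(3)[OF f] m(3)[OF g]
      by (intro C.comm_paste[where y = "sq_left (T (Dom A g))"]) (auto simp: at sq)
    then show "Comp C (sq_left (T (Cod A g))) (m (Comp A g f))
      = Comp C (sq_left (T (Cod A g))) (Comp C (m g) (m f))"
      using m(3)[OF gf(1)] Q.dom.amap_Comp[OF f g fg] gf by simp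
  qed
  define H where "H = \<lparr>omap = (\<lambda>a\<in>Obj A. Dom C (sq_top (T a))), amap = (\<lambda>f\<in>Arr A. m f)\<rparr>"
  have H: "is_functor A C H"
    by unfold_locales
      (use m' in \<open>auto simp: H_def A.Dom_in A.Cod_in A.Id_in A.Comp_in C.Dom_in sq m_Id m_Comp\<close>)
  have oH: "omap H a = Dom C (sq_top (T a))" if "a \<in> Obj A" for a
    using that by (simp add: H_def)
  show thesis
  proof (rule that[OF H oH])
    show "natural_transformation A C
        \<lparr>nt_dom = H, nt_cod = ?F, nt_at = (\<lambda>a\<in>Obj A. sq_top (T a))\<rparr>"
      by (rule natural_transformationI[OF H B(2)])
        (auto simp: homset_def sq H_def A.Dom_in A.Cod_in m(2))
    show "natural_transformation A C
        \<lparr>nt_dom = H, nt_cod = ?G, nt_at = (\<lambda>a\<in>Obj A. sq_left (T a))\<rparr>"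
      by (rule natural_transformationI[OF H B(3)])
        (auto simp: homset_def sq H_def A.Dom_in A.Cod_in m(3))
  qed
qed

text \<open>Equal components of the projections have equal domains, which settles objects. On
  arrows, naturality of both projections prescribes the composites with jointly monic legs. Objects
  of the power are functors, so agreement on objects alone would not identify them.\<close>

lemma functor_pullback_unique:
  assumes A: "category A" and C: "category C"
    and t: "natural_transformation A C t" and t': "natural_transformation A C t'"
    and l: "natural_transformation A C l" and l': "natural_transformation A C l'"
    and "nt_dom t = nt_dom l" "nt_dom t' = nt_dom l'" "nt_cod t = nt_cod t'" "nt_cod l = nt_cod l'"
    and T: "\<And>a. a \<in> Obj A \<Longrightarrow> pullback_square C (T a) \<and> sq_top (T a) = nt_at t a \<and>
      sq_left (T a) = nt_at l a \<and> nt_at t' a = nt_at t a \<and> nt_at l' a = nt_at l a"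
  shows "nt_dom t = nt_dom t'"
proof (rule func_eqI)
  interpret A: category A by fact
  interpret C: category C by fact
  show H: "is_functor A C (nt_dom t)" "is_functor A C (nt_dom t')"
    using nt_functors t t' by blast+
  show o: "omap (nt_dom t) a = omap (nt_dom t') a" if "a \<in> Obj A" for a
    using nat_trans_at(2)[OF t that] nat_trans_at(2)[OF t' that] T[OF that] by simp
  show "amap (nt_dom t) f = amap (nt_dom t') f" if f: "f \<in> Arr A" for f
  proof (rule C.pullback_unique)
    have ab: "Dom A f \<in> Obj A" "Cod A f \<in> Obj A"
      using f by (simp_all add: A.Dom_in A.Cod_in)
    show "pullback_square C (T (Cod A f))" using T ab by blast
    show "amap (nt_dom t) f \<in> homset C (omap (nt_dom t) (Dom A f)) (Dom C (sq_top (T (Cod A f))))"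
      using f ab by (simp add: homset_def functor_at[OF H(1)] T nat_trans_at[OF t])
    show "amap (nt_dom t') f \<in> homset C (omap (nt_dom t) (Dom A f)) (Dom C (sq_top (T (Cod A f))))"
      using f ab o by (simp add: homset_def functor_at[OF H(2)] T nat_trans_at[OF t])
    show "Comp C (sq_top (T (Cod A f))) (amap (nt_dom t) f)
        = Comp C (sq_top (T (Cod A f))) (amap (nt_dom t') f)"
      using natural_transformation.naturality[OF t f] natural_transformation.naturality[OF t' f]
        T ab assms(9) by simp
    show "Comp C (sq_left (T (Cod A f))) (amap (nt_dom t) f)
        = Comp C (sq_left (T (Cod A f))) (amap (nt_dom t') f)"
      using natural_transformation.naturality[OF l f] natural_transformation.naturality[OF l' f]
        T ab assms(7,8,10) by simp
  qed
qed

text \<open>The mediating maps are formed object by object; that they are natural and that no other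
  choice exists both come from uniqueness in the pointwise pullbacks.\<close>

lemma nt_pullback:
  assumes A: "category A" and C: "category C"
    and S: "nt_comm_square A C S" and pb: "\<And>a. a \<in> Obj A \<Longrightarrow> pullback_square C (square_at S a)"
    and u: "natural_transformation A C u" and v: "natural_transformation A C v"
    and uv: "nt_dom u = nt_dom v" "nt_cod u = nt_dom (sq_right S)" "nt_cod v = nt_dom (sq_bot S)"
      "nt_comp A C (sq_right S) u = nt_comp A C (sq_bot S) v"
  shows "\<exists>!w. natural_transformation A C w \<and> nt_dom w = nt_dom u \<and> nt_cod w = nt_dom (sq_top S) \<and>
    nt_comp A C (sq_top S) w = u \<and> nt_comp A C (sq_left S) w = v"
proof -
  interpret A: category A by fact
  interpret C: category C by fact
  have nt: "natural_transformation A C (sq_top S)" "natural_transformation A C (sq_left S)"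
      "natural_transformation A C (sq_right S)" "natural_transformation A C (sq_bot S)"
    and dc: "nt_cod (sq_top S) = nt_dom (sq_right S)" "nt_dom (sq_left S) = nt_dom (sq_top S)"
      "nt_cod (sq_left S) = nt_dom (sq_bot S)"
    using S by (simp_all add: nt_comm_square_def)
  have F: "is_functor A C (nt_dom u)" "is_functor A C (nt_dom (sq_top S))"
      "is_functor A C (nt_dom (sq_right S))" "is_functor A C (nt_dom (sq_bot S))"
    using nt_functors u nt by blast+
  note at = nat_trans_at(1-3)[OF u] nat_trans_at(1-3)[OF v, folded uv(1)]
    nat_trans_at(1-3)[OF nt(1)] nat_trans_at(1-3)[OF nt(2), unfolded dc(2)]
    nat_trans_at(1-3)[OF nt(3)]  nat_trans_at(1-3)[OF nt(4)]
    functor_at[OF F(1)] functor_at[OF F(2)] functor_at[OF F(3)] functor_at[OF F(4)] A.Dom_in A.Cod_in dc uv(2,3)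
  have [simp]: "sq_top (square_at S a) = nt_at (sq_top S) a" "sq_left (square_at S a) = nt_at (sq_left S) a"
    "sq_right (square_at S a) = nt_at (sq_right S) a" "sq_bot (square_at S a) = nt_at (sq_bot S) a" for a
    by (simp_all add: square_at_def)
  define m where "m a = pb_map C (square_at S a) (nt_at u a) (nt_at v a)" for a
  have eq: "Comp C (nt_at (sq_right S) a) (nt_at u a) = Comp C (nt_at (sq_bot S) a) (nt_at v a)"
    if "a \<in> Obj A" for a
    using arg_cong[OF uv(4), of "\<lambda>t. nt_at t a"] that by simp
  have m: "m a \<in> homset C (omap (nt_dom u) a) (omap (nt_dom (sq_top S)) a)"
    "Comp C (nt_at (sq_top S) a) (m a) = nt_at u a"
    "Comp C (nt_at (sq_left S) a) (m a) = nt_at v a" if a: "a \<in> Obj A" for a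
    using C.pb_map[OF pb[OF a], of "nt_at u a" "nt_at v a"] eq[OF a] a unfolding m_def
    by (simp_all add: at)
  note m' = m(1)[unfolded homset_def, simplified]
  let ?w = "\<lparr>nt_dom = nt_dom u, nt_cod = nt_dom (sq_top S), nt_at = (\<lambda>a\<in>Obj A. m a)\<rparr>"
  have w: "natural_transformation A C ?w"
  proof (rule natural_transformationI[OF F(1,2)])
    fix f assume f: "f \<in> Arr A"
    have ab: "Dom A f \<in> Obj A" "Cod A f \<in> Obj A"
      using f by (simp_all add: A.Dom_in A.Cod_in)
    \<comment> \<open>The naturality equation is tested against both projections. After composition
      with one of them \<open>m\<close> becomes \<open>u\<close> or \<open>v\<close>, and naturality
      of the projection and of \<open>u\<close> or \<open>v\<close> finishes.\<close>
    have "Comp C (m (Cod A f)) (amap (nt_dom u) f) = Comp C (amap (nt_dom (sq_top S)) f) (m (Dom A f))"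
    proof (rule C.pullback_unique[OF pb[OF ab(2)], of _ "omap (nt_dom u) (Dom A f)"])
      show "Comp C (m (Cod A f)) (amap (nt_dom u) f)
        \<in> homset C (omap (nt_dom u) (Dom A f)) (Dom C (sq_top (square_at S (Cod A f))))"
        "Comp C (amap (nt_dom (sq_top S)) f) (m (Dom A f))
        \<in> homset C (omap (nt_dom u) (Dom A f)) (Dom C (sq_top (square_at S (Cod A f))))"
        using f m'[OF ab(1)] m'[OF ab(2)] ab
        by (simp_all add: homset_def at C.Comp_in C.Dom_Comp C.Cod_Comp)
      have "Comp C (nt_at (sq_top S) (Cod A f)) (Comp C (amap (nt_dom (sq_top S)) f) (m (Dom A f)))
        = Comp C (Comp C (amap (nt_dom (sq_right S)) f) (nt_at (sq_top S) (Dom A f))) (m (Dom A f))"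
        using natural_transformation.naturality[OF nt(1) f] m'[OF ab(1)] f ab
        by (simp add: at C.Comp_assoc)
      also have "\<dots> = Comp C (amap (nt_dom (sq_right S)) f) (nt_at u (Dom A f))"
        using m'[OF ab(1)] m(2)[OF ab(1)] f ab by (simp add: at C.Comp_assoc[symmetric])
      also have "\<dots> = Comp C (nt_at u (Cod A f)) (amap (nt_dom u) f)"
        using natural_transformation.naturality[OF u f] uv by simp
      also have "\<dots> = Comp C (nt_at (sq_top S) (Cod A f)) (Comp C (m (Cod A f)) (amap (nt_dom u) f))"
        using m'[OF ab(2)] m(2)[OF ab(2)] f ab by (simp add: at C.Comp_assoc)
      finally show "Comp C (sq_top (square_at S (Cod A f))) (Comp C (m (Cod A f)) (amap (nt_dom u) f))
        = Comp C (sq_top (square_at S (Cod A f))) (Comp C (amap (nt_dom (sq_top S)) f) (m (Dom A f)))"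
        by simp
      have "Comp C (nt_at (sq_left S) (Cod A f)) (Comp C (amap (nt_dom (sq_top S)) f) (m (Dom A f)))
        = Comp C (Comp C (amap (nt_dom (sq_bot S)) f) (nt_at (sq_left S) (Dom A f))) (m (Dom A f))"
        using natural_transformation.naturality[OF nt(2) f] m'[OF ab(1)] f ab
        by (simp add: at C.Comp_assoc)
      also have "\<dots> = Comp C (amap (nt_dom (sq_bot S)) f) (nt_at v (Dom A f))"
        using m'[OF ab(1)] m(3)[OF ab(1)] f ab by (simp add: at C.Comp_assoc[symmetric])
      also have "\<dots> = Comp C (nt_at v (Cod A f)) (amap (nt_dom u) f)"
        using natural_transformation.naturality[OF v f] uv by simp
      also have "\<dots> = Comp C (nt_at (sq_left S) (Cod A f)) (Comp C (m (Cod A f)) (amap (nt_dom u) f))"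
        using m'[OF ab(2)] m(3)[OF ab(2)] f ab by (simp add: at C.Comp_assoc)
      finally show "Comp C (sq_left (square_at S (Cod A f))) (Comp C (m (Cod A f)) (amap (nt_dom u) f))
        = Comp C (sq_left (square_at S (Cod A f))) (Comp C (amap (nt_dom (sq_top S)) f) (m (Dom A f)))"
        by simp
    qed
    then show "Comp C ((\<lambda>a\<in>Obj A. m a) (Cod A f)) (amap (nt_dom u) f)
      = Comp C (amap (nt_dom (sq_top S)) f) ((\<lambda>a\<in>Obj A. m a) (Dom A f))"
      using ab by simp
  qed (auto simp: m)
  show ?thesis
  proof (rule ex1I[of _ ?w])
    show "natural_transformation A C ?w \<and> nt_dom ?w = nt_dom u \<and> nt_cod ?w = nt_dom (sq_top S) \<and>
      nt_comp A C (sq_top S) ?w = u \<and> nt_comp A C (sq_left S) ?w = v"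
      using w nt u v uv dc m by (simp add: nt_comp_eq_iff)
    fix w' assume w': "natural_transformation A C w' \<and> nt_dom w' = nt_dom u \<and>
      nt_cod w' = nt_dom (sq_top S) \<and> nt_comp A C (sq_top S) w' = u \<and> nt_comp A C (sq_left S) w' = v"
    show "w' = ?w"
    proof (rule nat_trans_eqI[OF _ w])
      fix a assume a: "a \<in> Obj A"
      have "nt_at w' a = m a"
      proof (rule C.pullback_unique[OF pb[OF a], of _ "omap (nt_dom u) a"])
        show "nt_at w' a \<in> homset C (omap (nt_dom u) a) (Dom C (sq_top (square_at S a)))"
          "m a \<in> homset C (omap (nt_dom u) a) (Dom C (sq_top (square_at S a)))"
          using w' m(1)[OF a] nat_trans_at(4)[of A C w' a] a by (auto simp: at)
        have "nt_at (nt_comp A C (sq_top S) w') a = nt_at u a"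
          "nt_at (nt_comp A C (sq_left S) w') a = nt_at v a" using w' by auto
        then show "Comp C (sq_top (square_at S a)) (nt_at w' a) = Comp C (sq_top (square_at S a)) (m a)"
          "Comp C (sq_left (square_at S a)) (nt_at w' a) = Comp C (sq_left (square_at S a)) (m a)"
          using a m[OF a] by simp_all
      qed
      then show "nt_at w' a = nt_at ?w a" using a by simp
    qed (use w' in auto)
  qed
qed

section \<open>The power is contextual\<close>

context contextual_category
begin

lemma one_in: "one C \<in> Obj C" and len_one: "len C (one C) = 0"
  using theI'[OF unique_len_0] unfolding one_def by auto

lemma one_eqI: "a \<in> Obj C \<Longrightarrow> len C a = 0 \<Longrightarrow> a = one C"
  using unique_len_0 one_in len_one by blast

lemma to_one_unique:
  "f \<in> homset C b (one C) \<Longrightarrow> g \<in> homset C b (one C) \<Longrightarrow> f = g"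
  using one_terminal[of b] Dom_in by (simp add: homset_def) blast

lemma proj_at:
  assumes "a \<in> Obj C" "len C a \<ge> 1"
  shows "proj C a \<in> Arr C" "Dom C (proj C a) = a" "Cod C (proj C a) = bdry C a"
  using proj_in[OF assms] by (auto simp: homset_def)

end

text \<open>The power and the exponential extend the record built by \<open>trans_category\<close>
  with further fields. Being a category depends on the six shared fields and passes between the
  record types.\<close>

lemma category_cong:
  assumes "Obj D = Obj C" "Arr D = Arr C" "Dom D = Dom C" "Cod D = Cod C" "Id D = Id C" "Comp D = Comp C"
  shows "category D \<longleftrightarrow> category C"
  unfolding category_def assms ..

lemma seq_len_bdry: "seq_len (seq_bdry x) = seq_len x - 1"
  and seq_bdry_0: "seq_len x = 0 \<Longrightarrow> seq_bdry x = x"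
  by (simp_all add: seq_len_def seq_bdry_def)

section \<open>Arrows and squares of natural transformations with recorded endpoints\<close>

lemma arrow_eqI:
  fixes f g :: "('c, 't) arrow"
  shows "src f = src g \<Longrightarrow> tgt f = tgt g \<Longrightarrow> und f = und g \<Longrightarrow> f = g"
  by simp

lemma trans_category_simps [simp]:
  "Obj (trans_category A C X U) = X" "Dom (trans_category A C X U) = src"
  "Cod (trans_category A C X U) = tgt"
  "Id (trans_category A C X U) x = \<lparr>src = x, tgt = x, und = nt_id A C (U x)\<rparr>"
  "Comp (trans_category A C X U) g f = \<lparr>src = src f, tgt = tgt g, und = nt_comp A C (und g) (und f)\<rparr>"
  "f \<in> Arr (trans_category A C X U) \<longleftrightarrow> src f \<in> X \<and> tgt f \<in> X \<and>
    natural_transformation A C (und f) \<and> nt_dom (und f) = U (src f) \<and> nt_cod (und f) = U (tgt f)"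
  by (auto simp: trans_category_def)

text \<open>The composites along the two sides of a square have the same endpoints by the shape of
  the square, so commutativity concerns the underlying transformations alone.\<close>

lemma comm_square_trans_category:
  "comm_square (trans_category A C X U) S \<longleftrightarrow>
    sq_top S \<in> Arr (trans_category A C X U) \<and> sq_bot S \<in> Arr (trans_category A C X U) \<and>
    sq_left S \<in> Arr (trans_category A C X U) \<and> sq_right S \<in> Arr (trans_category A C X U) \<and>
    src (sq_top S) = src (sq_left S) \<and> tgt (sq_top S) = src (sq_right S) \<and>
    tgt (sq_left S) = src (sq_bot S) \<and> tgt (sq_bot S) = tgt (sq_right S) \<and>
    nt_comm_square A C (und_square S)"
  (is "?L \<longleftrightarrow> ?R")
proof
  assume L: ?L
  from L have "Comp (trans_category A C X U) (sq_right S) (sq_top S)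
    = Comp (trans_category A C X U) (sq_bot S) (sq_left S)"
    unfolding comm_square_def by blast
  from arg_cong[OF this, of und] have
    "nt_comp A C (und (sq_right S)) (und (sq_top S)) = nt_comp A C (und (sq_bot S)) (und (sq_left S))"
    by simp
  moreover from L have "sq_top S \<in> Arr (trans_category A C X U)" "sq_bot S \<in> Arr (trans_category A C X U)"
    "sq_left S \<in> Arr (trans_category A C X U)" "sq_right S \<in> Arr (trans_category A C X U)"
    "src (sq_top S) = src (sq_left S)" "tgt (sq_top S) = src (sq_right S)"
    "tgt (sq_left S) = src (sq_bot S)" "tgt (sq_bot S) = tgt (sq_right S)"
    unfolding comm_square_def trans_category_simps by blast+
  ultimately show ?R
    by (simp add: nt_comm_square_def und_square_def)
next
  assume R: ?R
  then have "nt_comp A C (und (sq_right S)) (und (sq_top S)) = nt_comp A C (und (sq_bot S)) (und (sq_left S))"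
    unfolding nt_comm_square_def und_square_def square.simps by blast
  then have "Comp (trans_category A C X U) (sq_right S) (sq_top S)
    = Comp (trans_category A C X U) (sq_bot S) (sq_left S)"
    using R unfolding trans_category_simps by argo
  then show ?L
    using R unfolding comm_square_def trans_category_simps by argo
qed

lemma proj_trans_simps [simp]:
  "nt_dom (proj_trans A C G F) = G" "nt_cod (proj_trans A C G F) = F"
  "a \<in> Obj A \<Longrightarrow> nt_at (proj_trans A C G F) a = proj C (omap G a)"
  by (simp_all add: proj_trans_def)

lemma seq_proj_simps [simp]:
  "src (seq_proj A C x) = x" "tgt (seq_proj A C x) = seq_bdry x"
  "und (seq_proj A C x) = proj_trans A C (last x) (last (seq_bdry x))"
  by (simp_all add: seq_proj_def)

lemma square_at_simps [simp]:
  "sq_top (square_at S a) = nt_at (sq_top S) a" "sq_bot (square_at S a) = nt_at (sq_bot S) a"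
  "sq_left (square_at S a) = nt_at (sq_left S) a" "sq_right (square_at S a) = nt_at (sq_right S) a"
  by (simp_all add: square_at_def)

lemma und_square_simps [simp]:
  "sq_top (und_square S) = und (sq_top S)" "sq_bot (und_square S) = und (sq_bot S)"
  "sq_left (und_square S) = und (sq_left S)" "sq_right (und_square S) = und (sq_right S)"
  by (simp_all add: und_square_def)

lemma power_simps [simp]:
  "Obj (power_by_cat C A) = power_seqs A C"
  "Arr (power_by_cat C A) = Arr (trans_category A C (power_seqs A C) last)"
  "Dom (power_by_cat C A) = src" "Cod (power_by_cat C A) = tgt"
  "Id (power_by_cat C A) = Id (trans_category A C (power_seqs A C) last)"
  "Comp (power_by_cat C A) = Comp (trans_category A C (power_seqs A C) last)"
  "len (power_by_cat C A) = seq_len" "bdry (power_by_cat C A) = seq_bdry"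
  "proj (power_by_cat C A) = seq_proj A C"
  by (simp_all add: power_by_cat_def power_cat_def category.defs precontextual.defs trans_category_def)

lemma comm_square_power:
  "comm_square (power_by_cat C A) S = comm_square (trans_category A C (power_seqs A C) last) S"
  by (simp add: comm_square_def)

lemma Qs_power:
  "S \<in> Qs (power_by_cat C A) \<longleftrightarrow> comm_square (trans_category A C (power_seqs A C) last) S \<and>
    (\<exists>x\<in>power_seqs A C. seq_len x \<ge> 1 \<and> sq_left S = seq_proj A C x) \<and>
    (\<exists>y\<in>power_seqs A C. seq_len y \<ge> 1 \<and> sq_right S = seq_proj A C y) \<and>
    (\<forall>a\<in>Obj A. square_at (und_square S) a \<in> Qs C)"
  by (simp add: power_by_cat_def power_cat_def category.defs precontextual.defs)

section \<open>The contextual axioms for the power\<close>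

locale contextual_power = A: category A + C: contextual_category C
  for A :: "('o, 'm, 'x) category_scheme" and C :: "('p, 'n, 'y) precontextual_scheme"
begin

lemma one_seq_in: "[const_func A C (one C)] \<in> power_seqs A C"
  using functor_const_func[OF A.category_axioms C.category_axioms C.one_in]
  by (simp add: power_seqs_def)

text \<open>The condition at an index mentions only this index and its predecessor, so appending
  \<open>H\<close> leaves the earlier conditions alone. \<open>H\<close> stands at index
  \<open>length x\<close>, which is therefore the length of its values.\<close>

lemma power_seqs_snoc:
  assumes "x \<noteq> []"
  shows "x @ [H] \<in> power_seqs A C \<longleftrightarrow> x \<in> power_seqs A C \<and> is_functor A C H \<and>
    (\<forall>a\<in>Obj A. len C (omap H a) = length x \<and> bdry C (omap H a) = omap (last x) a) \<and>
    natural_transformation A C (proj_trans A C H (last x))"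
proof -
  define Q where "Q Fs i \<longleftrightarrow> (\<forall>a\<in>Obj A. len C (omap (Fs ! i) a) = i \<and>
      bdry C (omap (Fs ! i) a) = omap (Fs ! (i - 1)) a) \<and>
    natural_transformation A C (proj_trans A C (Fs ! i) (Fs ! (i - 1)))" for Fs i
  have in_iff: "Fs \<in> power_seqs A C \<longleftrightarrow> Fs \<noteq> [] \<and> (\<forall>F\<in>set Fs. is_functor A C F) \<and>
      Fs ! 0 = const_func A C (one C) \<and> (\<forall>i. 1 \<le> i \<and> i < length Fs \<longrightarrow> Q Fs i)" for Fs
    unfolding power_seqs_def Q_def by simp
  have "Q (x @ [H]) i = Q x i" if "i < length x" for i
    using that by (simp add: Q_def nth_append less_imp_diff_less)
  then have "(\<forall>i. 1 \<le> i \<and> i < length (x @ [H]) \<longrightarrow> Q (x @ [H]) i) \<longleftrightarrow>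
      (\<forall>i. 1 \<le> i \<and> i < length x \<longrightarrow> Q x i) \<and> Q (x @ [H]) (length x)"
    using assms by (simp add: less_Suc_eq Suc_le_eq) blast
  moreover have "Q (x @ [H]) (length x) \<longleftrightarrow>
    (\<forall>a\<in>Obj A. len C (omap H a) = length x \<and> bdry C (omap H a) = omap (last x) a) \<and>
    natural_transformation A C (proj_trans A C H (last x))"
    using assms by (simp add: Q_def nth_append last_conv_nth)
  moreover have "(x @ [H]) ! 0 = x ! 0"
    using assms by (simp add: nth_append)
  ultimately show ?thesis
    unfolding in_iff using assms by (simp del: One_nat_def) blast
qed

lemma power_seqs_cases:
  assumes "x \<in> power_seqs A C"
  obtains "x = [const_func A C (one C)]" "seq_len x = 0"
  | y H where "x = y @ [H]" "y \<in> power_seqs A C" "seq_len x = Suc (seq_len y)"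
    "seq_bdry x = y" "is_functor A C H"
    "\<And>a. a \<in> Obj A \<Longrightarrow> len C (omap H a) = length y"
    "\<And>a. a \<in> Obj A \<Longrightarrow> bdry C (omap H a) = omap (last y) a"
    "natural_transformation A C (proj_trans A C H (last y))"
proof -
  have x: "x \<noteq> []" "x ! 0 = const_func A C (one C)"
    using assms by (auto simp: power_seqs_def)
  then obtain y H where yH: "x = y @ [H]" by (metis append_butlast_last_id)
  show thesis
  proof (cases "y = []")
    case True
    then show ?thesis using that(1) x yH by (simp add: seq_len_def)
  next
    case False
    then show ?thesis
      using that(2)[OF yH] assms power_seqs_snoc[OF False, of H]
      by (cases y) (auto simp: yH seq_len_def seq_bdry_def)
  qed
qed

lemma last_power_seqs:
  assumes "x \<in> power_seqs A C"
  shows "is_functor A C (last x)" "a \<in> Obj A \<Longrightarrow> len C (omap (last x) a) = seq_len x"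
  using assms
  by (cases x rule: power_seqs_cases; use functor_const_func[OF A.category_axioms C.category_axioms C.one_in]
     in \<open>simp add: const_func_def C.len_one seq_len_def\<close>)+

lemma category_power: "category (power_by_cat C A)"
proof -
  have "category (trans_category A C (power_seqs A C) last)"
    by (intro category_trans_category A.category_axioms C.category_axioms last_power_seqs)
  then show ?thesis
    by (subst category_cong[where C = "trans_category A C (power_seqs A C) last"]) simp_all
qed

lemma seq_bdry_in: "x \<in> power_seqs A C \<Longrightarrow> seq_bdry x \<in> power_seqs A C"
  by (cases x rule: power_seqs_cases) (auto simp: seq_bdry_def one_seq_in)

lemma seq_proj_in:
  assumes "x \<in> power_seqs A C" "seq_len x \<ge> 1"
  shows "seq_proj A C x \<in> Arr (trans_category A C (power_seqs A C) last)"
  using assms(1) by (cases x rule: power_seqs_cases) (use assms in \<open>auto simp: seq_bdry_in\<close>)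

lemma precontextual_power: "precontextual_category (power_by_cat C A)"
proof -
  interpret P: category "power_by_cat C A" by (rule category_power)
  show ?thesis
    by unfold_locales
      (use seq_proj_in in \<open>auto simp: seq_bdry_in Qs_power comm_square_power homset_def
        seq_len_bdry seq_bdry_0\<close>)
qed

lemma one_power: "one (power_by_cat C A) = [const_func A C (one C)]"
  unfolding one_def[of "power_by_cat C A"] using one_seq_in
  by (intro the_equality) (auto simp: seq_len_def elim: power_seqs_cases)

text \<open>Each component is the unique arrow to \<open>one C\<close>; naturality is an equation
  between arrows into \<open>one C\<close> and holds by itself.\<close>

lemma one_power_terminal:
  assumes x: "x \<in> power_seqs A C"
  shows "\<exists>!f. f \<in> homset (power_by_cat C A) x [const_func A C (one C)]"
proof -
  let ?K = "const_func A C (one C)"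
  note K = functor_const_func[OF A.category_axioms C.category_axioms C.one_in]
  have F: "is_functor A C (last x)" using last_power_seqs x by blast
  define b where "b a = (THE f. f \<in> homset C (omap (last x) a) (one C))" for a
  have b: "b a \<in> homset C (omap (last x) a) (one C)" if "a \<in> Obj A" for a
    using theI'[OF C.one_terminal[of "omap (last x) a"]] that functor_at[OF F] by (simp add: b_def)
  have oK: "omap ?K a = one C" if "a \<in> Obj A" for a using that by (simp add: const_func_def)
  let ?t = "\<lparr>nt_dom = last x, nt_cod = ?K, nt_at = (\<lambda>a\<in>Obj A. b a)\<rparr>"
  have t: "natural_transformation A C ?t"
  proof (rule natural_transformationI[OF F K])
    fix f assume f: "f \<in> Arr A"
    then show "Comp C ((\<lambda>a\<in>Obj A. b a) (Cod A f)) (amap (last x) f)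
      = Comp C (amap ?K f) ((\<lambda>a\<in>Obj A. b a) (Dom A f))"
      using b[of "Dom A f"] b[of "Cod A f"] functor_at[OF F] functor_at[OF K] oK
      by (intro C.to_one_unique[of _ "omap (last x) (Dom A f)"])
        (auto simp: homset_def A.Dom_in A.Cod_in C.Comp_in C.Dom_Comp C.Cod_Comp)
  qed (auto simp: b oK)
  show ?thesis
  proof (rule ex1I[of _ "\<lparr>src = x, tgt = [?K], und = ?t\<rparr>"])
    show "\<lparr>src = x, tgt = [?K], und = ?t\<rparr> \<in> homset (power_by_cat C A) x [?K]"
      using t x one_seq_in by (simp add: homset_def)
    fix f assume f: "f \<in> homset (power_by_cat C A) x [?K]"
    have "und f = ?t"
    proof (rule nat_trans_eqI[OF _ t])
      fix a assume a: "a \<in> Obj A"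
      have "nt_at (und f) a \<in> homset C (omap (last x) a) (one C)"
        using f nat_trans_at(4)[of A C "und f" a] a oK[OF a] by (auto simp: homset_def)
      from C.to_one_unique[OF this b[OF a]] show "nt_at (und f) a = nt_at ?t a"
        using a by simp
    qed (use f in \<open>auto simp: homset_def\<close>)
    moreover have "src f = x" "tgt f = [?K]"
      using f by (simp_all add: homset_def)
    ultimately show "f = \<lparr>src = x, tgt = [?K], und = ?t\<rparr>"
      by (intro arrow_eqI) simp_all
  qed
qed

text \<open>Pointwise membership in \<open>Qs C\<close> gives pointwise pullbacks, hence a unique
  mediating transformation. It becomes a unique arrow of the power because the hom-set fixes both
  endpoints.\<close>

lemma Qs_power_pullback:
  assumes S: "S \<in> Qs (power_by_cat C A)"
  shows "pullback_square (power_by_cat C A) S"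
  unfolding pullback_square_def
proof (intro conjI allI impI)
  show c: "comm_square (power_by_cat C A) S"
    using S by (simp add: Qs_power comm_square_power)
  then have ct: "comm_square (trans_category A C (power_seqs A C) last) S"
    by (simp add: comm_square_power)
  fix u v
  assume uv: "u \<in> Arr (power_by_cat C A) \<and> v \<in> Arr (power_by_cat C A) \<and>
    Dom (power_by_cat C A) u = Dom (power_by_cat C A) v \<and>
    Cod (power_by_cat C A) u = Dom (power_by_cat C A) (sq_right S) \<and>
    Cod (power_by_cat C A) v = Dom (power_by_cat C A) (sq_bot S) \<and>
    Comp (power_by_cat C A) (sq_right S) u = Comp (power_by_cat C A) (sq_bot S) v"
  then have u: "u \<in> Arr (power_by_cat C A)" and v: "v \<in> Arr (power_by_cat C A)"
    and src: "src u = src v" "tgt u = src (sq_right S)" "tgt v = src (sq_bot S)"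
    and Comp_eq: "Comp (power_by_cat C A) (sq_right S) u = Comp (power_by_cat C A) (sq_bot S) v"
    unfolding power_simps(3,4) by blast+
  have uv_eq: "nt_comp A C (und (sq_right S)) (und u) = nt_comp A C (und (sq_bot S)) (und v)"
    using arg_cong[OF Comp_eq, of und] by simp
  define P where "P w \<longleftrightarrow> natural_transformation A C w \<and> nt_dom w = nt_dom (und u) \<and>
    nt_cod w = nt_dom (sq_top (und_square S)) \<and>
    nt_comp A C (sq_top (und_square S)) w = und u \<and>
    nt_comp A C (sq_left (und_square S)) w = und v" for w
  have "\<exists>!w. P w"
    unfolding P_def using ct u v src uv_eq S C.Qs_pullback
    by (intro nt_pullback A.category_axioms C.category_axioms)
      (auto simp: comm_square_trans_category Qs_power)
  then obtain w where P: "P w" and unique: "\<And>w'. P w' \<Longrightarrow> w' = w"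
    by blast
  note w = P[unfolded P_def und_square_simps]
  let ?w = "\<lparr>src = src u, tgt = src (sq_top S), und = w\<rparr>"
  show "\<exists>!w. w \<in> homset (power_by_cat C A) (Dom (power_by_cat C A) u) (Dom (power_by_cat C A) (sq_top S)) \<and>
    Comp (power_by_cat C A) (sq_top S) w = u \<and> Comp (power_by_cat C A) (sq_left S) w = v"
  proof (rule ex1I[of _ ?w])
    show "?w \<in> homset (power_by_cat C A) (Dom (power_by_cat C A) u) (Dom (power_by_cat C A) (sq_top S)) \<and>
      Comp (power_by_cat C A) (sq_top S) ?w = u \<and> Comp (power_by_cat C A) (sq_left S) ?w = v"
      using ct u v src w by (auto simp: homset_def comm_square_trans_category intro!: arrow_eqI)
    fix w' assume "w' \<in> homset (power_by_cat C A) (Dom (power_by_cat C A) u)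
      (Dom (power_by_cat C A) (sq_top S)) \<and>
      Comp (power_by_cat C A) (sq_top S) w' = u \<and> Comp (power_by_cat C A) (sq_left S) w' = v"
    then have w': "w' \<in> homset (power_by_cat C A) (src u) (src (sq_top S))"
      and w'_eq: "Comp (power_by_cat C A) (sq_top S) w' = u" "Comp (power_by_cat C A) (sq_left S) w' = v"
      unfolding power_simps(3,4) by blast+
    have "und w' = w"
      using w' u ct arg_cong[OF w'_eq(1), of und] arg_cong[OF w'_eq(2), of und]
      by (intro unique) (auto simp: P_def homset_def comm_square_trans_category)
    moreover have "src w' = src u" "tgt w' = src (sq_top S)"
      using w' by (simp_all add: homset_def)
    ultimately show "w' = ?w"
      by (intro arrow_eqI) simp_all
  qed
qed

lemma Qs_power_Id:
  assumes x: "x \<in> power_seqs A C" "seq_len x \<ge> 1"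
  shows "\<lparr>sq_top = Id (power_by_cat C A) x, sq_bot = Id (power_by_cat C A) (seq_bdry x),
    sq_left = seq_proj A C x, sq_right = seq_proj A C x\<rparr> \<in> Qs (power_by_cat C A)"
proof -
  interpret P: category "power_by_cat C A" by (rule category_power)
  have p: "seq_proj A C x \<in> Arr (power_by_cat C A)" using seq_proj_in x by simp
  have "comm_square (power_by_cat C A) \<lparr>sq_top = Id (power_by_cat C A) x,
    sq_bot = Id (power_by_cat C A) (seq_bdry x), sq_left = seq_proj A C x, sq_right = seq_proj A C x\<rparr>"
    using P.Comp_Id[OF p] P.Id_Comp[OF p] P.Id_in[of x] P.Id_in[of "seq_bdry x"] p x
    by (simp add: comm_square_def seq_bdry_in del: power_simps(2,5,6)) simp
  moreover have "\<lparr>sq_top = Id C (omap (last x) a), sq_bot = Id C (omap (last (seq_bdry x)) a),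
     sq_left = proj C (omap (last x) a), sq_right = proj C (omap (last x) a)\<rparr> \<in> Qs C"
    if a: "a \<in> Obj A" for a
    using x(1)
  proof (cases x rule: power_seqs_cases)
    case 1
    then show ?thesis using x by simp
  next
    case (2 y H)
    then have "omap H a \<in> Obj C" "len C (omap H a) \<ge> 1"
      using a functor_at[OF 2(5)] x by (auto simp: seq_len_def)
    from C.Qs_Id[OF this] 2 a show ?thesis by simp
  qed
  ultimately show ?thesis
    using x by (auto simp: Qs_power comm_square_power square_at_def)
qed

lemma Qs_power_hcomp:
  assumes S: "S \<in> Qs (power_by_cat C A)" and T: "T \<in> Qs (power_by_cat C A)"
    and eq: "sq_right S = sq_left T"
  shows "hcomp (power_by_cat C A) S T \<in> Qs (power_by_cat C A)"
proof -
  interpret P: category "power_by_cat C A" by (rule category_power)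
  have "comm_square (power_by_cat C A) (hcomp (power_by_cat C A) S T)"
    using S T eq by (intro P.comm_square_hcomp) (auto simp: Qs_power comm_square_power)
  moreover have "square_at (und_square (hcomp (power_by_cat C A) S T)) a \<in> Qs C" if a: "a \<in> Obj A" for a
  proof -
    have "square_at (und_square (hcomp (power_by_cat C A) S T)) a
      = hcomp C (square_at (und_square S) a) (square_at (und_square T) a)"
      using a by (simp add: square_at_def und_square_def hcomp_def)
    then show ?thesis
      using C.Qs_hcomp S T eq a by (simp add: Qs_power)
  qed
  ultimately show ?thesis
    using S T by (auto simp: Qs_power comm_square_power hcomp_def)
qed

text \<open>For existence, the distinguished squares of \<open>C\<close> at the single objects are
  glued to a functor \<open>K\<close>; their left sides are canonical projections, so
  \<open>K\<close> prolongs the sequence \<open>src f\<close>. For uniqueness, a competing square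
  has the same components, and these determine its new functor even on arrows.\<close>

lemma Qs_power_unique:
  assumes x: "x \<in> power_seqs A C" "seq_len x \<ge> 1" and f: "f \<in> Arr (power_by_cat C A)" "tgt f = seq_bdry x"
  shows "\<exists>!S. S \<in> Qs (power_by_cat C A) \<and> sq_right S = seq_proj A C x \<and> sq_bot S = f"
proof -
  let ?P = "trans_category A C (power_seqs A C) last"
  obtain y H where yH: "x = y @ [H]" "y \<in> power_seqs A C" "seq_len x = Suc (seq_len y)"
    "seq_bdry x = y" "is_functor A C H"
    "\<And>a. a \<in> Obj A \<Longrightarrow> len C (omap H a) = length y"
    "\<And>a. a \<in> Obj A \<Longrightarrow> bdry C (omap H a) = omap (last y) a"
    "natural_transformation A C (proj_trans A C H (last y))"
    using x by (cases x rule: power_seqs_cases) auto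
  let ?p = "proj_trans A C H (last y)" and ?q = "und f"
  have q: "natural_transformation A C ?q" "nt_dom ?q = last (src f)" "nt_cod ?q = last y"
    and fs: "src f \<in> power_seqs A C" "src f \<noteq> []"
    using f yH by (auto simp: power_seqs_def)
  \<comment> \<open>The distinguished square of \<open>C\<close> over the component of
    \<open>f\<close> at \<open>a\<close>.\<close>
  define T where "T a = (THE S. S \<in> Qs C \<and> sq_right S = proj C (omap H a) \<and> sq_bot S = nt_at ?q a)" for a
  have ex1: "\<exists>!S. S \<in> Qs C \<and> sq_right S = proj C (omap H a) \<and> sq_bot S = nt_at ?q a"
    if a: "a \<in> Obj A" for a
    using C.Qs_unique[of "omap H a" "nt_at ?q a"] functor_at(1)[OF yH(5) a] yH(6,7)[OF a]
      nat_trans_at[OF q(1) a] q(3) yH(2)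
    by (cases y) (auto simp: power_seqs_def)
  have T: "T a \<in> Qs C" "sq_right (T a) = proj C (omap H a)" "sq_bot (T a) = nt_at ?q a"
    if a: "a \<in> Obj A" for a
    using theI'[OF ex1[OF a]] unfolding T_def by auto
  have TI: "S = T a" if "a \<in> Obj A" "S \<in> Qs C" "sq_right S = proj C (omap H a)" "sq_bot S = nt_at ?q a" for S a
    using ex1[OF that(1)] T[OF that(1)] that by blast
  obtain K where K: "is_functor A C K" "\<And>a. a \<in> Obj A \<Longrightarrow> omap K a = Dom C (sq_top (T a))"
    "natural_transformation A C \<lparr>nt_dom = K, nt_cod = nt_dom ?p, nt_at = (\<lambda>a\<in>Obj A. sq_top (T a))\<rparr>"
    "natural_transformation A C \<lparr>nt_dom = K, nt_cod = nt_dom ?q, nt_at = (\<lambda>a\<in>Obj A. sq_left (T a))\<rparr>"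
    by (rule functor_pullback_exists[OF A.category_axioms C.category_axioms yH(8) q(1), of T])
      (use T q C.Qs_pullback in auto)
  \<comment> \<open>The left side of a square in \<open>Qs C\<close> is the projection of some
    \<open>b\<close>. Comparing domains gives \<open>b = omap K a\<close>, comparing codomains gives
    its boundary. The boundary has length \<open>length (src f) - 1\<close>, which fixes the length
    of \<open>b\<close>.\<close>
  have left: "sq_left (T a) = proj C (omap K a) \<and> len C (omap K a) = length (src f) \<and>
      bdry C (omap K a) = omap (last (src f)) a" if a: "a \<in> Obj A" for a
  proof -
    obtain b where b: "b \<in> Obj C" "len C b \<ge> 1" "sq_left (T a) = proj C b"
      using C.Qs_left[OF T(1)[OF a]] by auto
    have c: "comm_square C (T a)" using C.Qs_comm[OF T(1)[OF a]] .
    have "omap K a = b"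
      using K(2)[OF a] c b C.proj_at[OF b(1,2)] by (simp add: comm_square_def)
    moreover have "bdry C b = omap (last (src f)) a"
      using c b C.proj_at[OF b(1,2)] T(3)[OF a] nat_trans_at(2)[OF q(1) a] q(2) by (simp add: comm_square_def)
    moreover have "len C b = length (src f)"
      using calculation(2) last_power_seqs(2)[OF fs(1) a] C.len_bdry[OF b(1,2)] b(2) fs(2)
      by (cases "src f") (auto simp: seq_len_def)
    ultimately show ?thesis using b by simp
  qed
  \<comment> \<open>Hence the left transformation delivered by the gluing is the one carried by the
    display map of \<open>src f @ [K]\<close>.\<close>
  have leq: "\<lparr>nt_dom = K, nt_cod = nt_dom ?q, nt_at = (\<lambda>a\<in>Obj A. sq_left (T a))\<rparr>
    = proj_trans A C K (last (src f))"
    using left q(2) by (auto simp: proj_trans_def intro!: restrict_ext)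
  let ?z = "src f @ [K]"
  have z: "?z \<in> power_seqs A C"
    using K left fs leq by (subst power_seqs_snoc) auto
  have zb: "seq_bdry ?z = src f" "seq_len ?z \<ge> 1"
    using fs(2) by (cases "src f"; simp add: seq_bdry_def seq_len_def)+
  define S where "S = \<lparr>sq_top = \<lparr>src = ?z, tgt = x,
        und = \<lparr>nt_dom = K, nt_cod = nt_dom ?p, nt_at = (\<lambda>a\<in>Obj A. sq_top (T a))\<rparr>\<rparr>,
      sq_bot = f, sq_left = seq_proj A C ?z, sq_right = seq_proj A C x\<rparr>"
  have Sq: "square_at (und_square S) a = T a" if a: "a \<in> Obj A" for a
    using T[OF a] left[OF a] a yH by (intro square.equality) (simp_all add: S_def)
  have Tc: "Comp C (sq_right (T a)) (sq_top (T a)) = Comp C (sq_bot (T a)) (sq_left (T a))"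
    if a: "a \<in> Obj A" for a
    using C.Qs_comm[OF T(1)[OF a]] by (simp add: comm_square_def)
  have "nt_comp A C ?p \<lparr>nt_dom = K, nt_cod = nt_dom ?p, nt_at = (\<lambda>a\<in>Obj A. sq_top (T a))\<rparr>
    = nt_comp A C ?q (proj_trans A C K (last (src f)))"
    using K(3) K(4)[unfolded leq] q yH(8) left T Tc
    by (intro nat_trans_eqI[of A C] natural_transformation_nt_comp) auto
  then have cS: "comm_square ?P S"
    using seq_proj_in[OF z zb(2)] seq_proj_in[OF x] f x z K(3) zb yH(1,4)
    by (auto simp: comm_square_trans_category nt_comm_square_def S_def)
  show ?thesis
  proof (rule ex1I[of _ S])
    show "S \<in> Qs (power_by_cat C A) \<and> sq_right S = seq_proj A C x \<and> sq_bot S = f"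
      unfolding Qs_power using cS x z zb T Sq by (auto simp: S_def)
    fix S' assume S': "S' \<in> Qs (power_by_cat C A) \<and> sq_right S' = seq_proj A C x \<and> sq_bot S' = f"
    then have cS': "comm_square ?P S'" by (simp add: Qs_power)
    obtain z' where z': "z' \<in> power_seqs A C" "seq_len z' \<ge> 1" "sq_left S' = seq_proj A C z'"
      using S' by (auto simp: Qs_power)
    obtain y' K' where K': "z' = y' @ [K']" "seq_bdry z' = y'"
      using z' by (cases z' rule: power_seqs_cases) auto
    have y': "y' = src f"
      using cS' z' K' S' by (auto simp: comm_square_trans_category nt_comm_square_def)
    \<comment> \<open>Uniqueness in \<open>C\<close>, used at each object: the component of
      \<open>S'\<close> has the same right side and bottom as \<open>T a\<close>.\<close>
    have Sq': "square_at (und_square S') a = T a" if a: "a \<in> Obj A" for a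
      using S' a yH by (intro TI) (auto simp: Qs_power)
    have at': "nt_at (und (sq_top S')) a = sq_top (T a)" "nt_at (und (sq_left S')) a = sq_left (T a)"
      if "a \<in> Obj A" for a
      using arg_cong[OF Sq'[OF that], of sq_top] arg_cong[OF Sq'[OF that], of sq_left] by simp_all
    have at: "nt_at (und (sq_top S)) a = sq_top (T a)" "nt_at (und (sq_left S)) a = sq_left (T a)"
      if "a \<in> Obj A" for a
      using arg_cong[OF Sq[OF that], of sq_top] arg_cong[OF Sq[OF that], of sq_left] by simp_all
    have "nt_dom (und (sq_top S)) = nt_dom (und (sq_top S'))"
    proof (rule functor_pullback_unique[OF A.category_axioms C.category_axioms])
      show "natural_transformation A C (und (sq_top S))" "natural_transformation A C (und (sq_top S'))"
        "natural_transformation A C (und (sq_left S))" "natural_transformation A C (und (sq_left S'))"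
        "nt_dom (und (sq_top S)) = nt_dom (und (sq_left S))"
        "nt_dom (und (sq_top S')) = nt_dom (und (sq_left S'))"
        using cS cS' by (auto simp: comm_square_trans_category nt_comm_square_def)
      show "nt_cod (und (sq_top S)) = nt_cod (und (sq_top S'))"
        "nt_cod (und (sq_left S)) = nt_cod (und (sq_left S'))"
        using cS' S' z' K' y' yH zb by (auto simp: comm_square_trans_category nt_comm_square_def S_def)
      fix a assume "a \<in> Obj A"
      then show "pullback_square C (T a) \<and> sq_top (T a) = nt_at (und (sq_top S)) a \<and>
        sq_left (T a) = nt_at (und (sq_left S)) a \<and>
        nt_at (und (sq_top S')) a = nt_at (und (sq_top S)) a \<and>
        nt_at (und (sq_left S')) a = nt_at (und (sq_left S)) a"
        using at at' T C.Qs_pullback by simp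
    qed
    moreover have "nt_dom (und (sq_top S')) = K'"
      using cS' z' K' by (auto simp: comm_square_trans_category nt_comm_square_def)
    ultimately have "K' = K" by (simp add: S_def)
    then have zz: "z' = ?z" using K' y' by simp
    have src': "src (sq_top S') = ?z" "tgt (sq_top S') = x"
      using cS' z' zz S' by (auto simp: comm_square_trans_category nt_comm_square_def)
    have "und (sq_top S') = und (sq_top S)"
      using cS cS' src' at at'
      by (intro nat_trans_eqI[of A C]) (auto simp: comm_square_trans_category nt_comm_square_def S_def)
    then show "S' = S"
      using S' z' zz src' by (intro square.equality arrow_eqI) (auto simp: S_def)
  qed
qed

lemma contextual_power: "contextual_category (power_by_cat C A)"
proof -
  interpret P: precontextual_category "power_by_cat C A" by (rule precontextual_power)
  show ?thesis
  proof
    show "\<exists>!x. x \<in> Obj (power_by_cat C A) \<and> len (power_by_cat C A) x = 0"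
      using one_seq_in by (intro ex1I[of _ "[const_func A C (one C)]"])
        (auto simp: seq_len_def elim: power_seqs_cases)
  qed (use one_power_terminal Qs_power_pullback Qs_power_Id Qs_power_hcomp Qs_power_unique
      in \<open>simp_all add: one_power del: power_simps(2,5,6)\<close>)
qed

end

section \<open>Transport along bijective functors\<close>

lemma map_square_simps [simp]:
  "sq_top (map_square F S) = amap F (sq_top S)" "sq_bot (map_square F S) = amap F (sq_bot S)"
  "sq_left (map_square F S) = amap F (sq_left S)" "sq_right (map_square F S) = amap F (sq_right S)"
  by (simp_all add: map_square_def)

text \<open>Bijectivity is assumed in place of an inverse functor since it can be verified as
  injectivity and surjectivity; the inverse is then recovered with its functor laws.\<close>

locale bijective_functor = is_functor X Y F
  for X :: "('o, 'm, 'x) category_scheme" and Y :: "('p, 'n, 'y) category_scheme"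
    and F :: "('o, 'm, 'p, 'n) func" +
  assumes bij_omap: "bij_betw (omap F) (Obj X) (Obj Y)"
    and bij_amap: "bij_betw (amap F) (Arr X) (Arr Y)"
begin

text \<open>The restrictions to \<open>Obj Y\<close> and \<open>Arr Y\<close> provide the
  extensionality that \<open>is_functor\<close> demands.\<close>

definition inverse_func :: "('p, 'n, 'o, 'm) func" where
  "inverse_func = \<lparr>omap = (\<lambda>b\<in>Obj Y. inv_into (Obj X) (omap F) b),
     amap = (\<lambda>g\<in>Arr Y. inv_into (Arr X) (amap F) g)\<rparr>"

lemma omap_inverse:
  "b \<in> Obj Y \<Longrightarrow> omap inverse_func b \<in> Obj X" "b \<in> Obj Y \<Longrightarrow> omap F (omap inverse_func b) = b"
  "a \<in> Obj X \<Longrightarrow> omap F a \<in> Obj Y" "a \<in> Obj X \<Longrightarrow> omap inverse_func (omap F a) = a"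
  using bij_omap bij_betw_imp_surj_on[OF bij_omap] bij_betwE[OF bij_omap]
  by (auto simp: inverse_func_def bij_betw_inv_into_right bij_betw_inv_into_left inv_into_into)

lemma amap_inverse:
  "g \<in> Arr Y \<Longrightarrow> amap inverse_func g \<in> Arr X" "g \<in> Arr Y \<Longrightarrow> amap F (amap inverse_func g) = g"
  "f \<in> Arr X \<Longrightarrow> amap F f \<in> Arr Y" "f \<in> Arr X \<Longrightarrow> amap inverse_func (amap F f) = f"
  using bij_amap bij_betw_imp_surj_on[OF bij_amap] bij_betwE[OF bij_amap]
  by (auto simp: inverse_func_def bij_betw_inv_into_right bij_betw_inv_into_left inv_into_into)

lemma omap_eq_iff: "a \<in> Obj X \<Longrightarrow> b \<in> Obj X \<Longrightarrow> omap F a = omap F b \<longleftrightarrow> a = b"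
  by (metis omap_inverse(4))

lemma amap_eq_iff: "f \<in> Arr X \<Longrightarrow> g \<in> Arr X \<Longrightarrow> amap F f = amap F g \<longleftrightarrow> f = g"
  by (metis amap_inverse(4))

lemma amap_homset_iff:
  assumes "f \<in> Arr X" "a \<in> Obj X" "b \<in> Obj X"
  shows "amap F f \<in> homset Y (omap F a) (omap F b) \<longleftrightarrow> f \<in> homset X a b"
  using assms by (simp add: homset_def amap_inverse Dom_amap Cod_amap omap_eq_iff dom.Dom_in dom.Cod_in)

lemma functor_inverse: "is_functor Y X inverse_func"
proof
  show "omap inverse_func \<in> Obj Y \<rightarrow>\<^sub>E Obj X" "amap inverse_func \<in> Arr Y \<rightarrow>\<^sub>E Arr X"
    using omap_inverse(1) amap_inverse(1) by (auto simp: inverse_func_def)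
  fix g assume g: "g \<in> Arr Y"
  show "Dom X (amap inverse_func g) = omap inverse_func (Dom Y g)"
    "Cod X (amap inverse_func g) = omap inverse_func (Cod Y g)"
    using Dom_amap[of "amap inverse_func g"] Cod_amap[of "amap inverse_func g"] g
    by (metis amap_inverse(1,2) omap_inverse(4) dom.Dom_in dom.Cod_in)+
  fix h assume h: "h \<in> Arr Y" and gh: "Cod Y g = Dom Y h"
  let ?g = "amap inverse_func g" and ?h = "amap inverse_func h"
  have c: "?g \<in> Arr X" "?h \<in> Arr X" "Cod X ?g = Dom X ?h"
    using g h gh amap_inverse(1) by (auto, metis Cod_amap Dom_amap amap_inverse(1,2) omap_inverse(4)
      dom.Dom_in dom.Cod_in)
  have "amap F (Comp X ?h ?g) = Comp Y h g"
    using amap_Comp[OF c] g h by (simp add: amap_inverse)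
  then show "amap inverse_func (Comp Y h g) = Comp X ?h ?g"
    using amap_inverse(4) dom.Comp_in[OF c] by metis
next
  fix b assume b: "b \<in> Obj Y"
  have "amap F (Id X (omap inverse_func b)) = Id Y b"
    using b amap_Id by (simp add: omap_inverse)
  then show "amap inverse_func (Id Y b) = Id X (omap inverse_func b)"
    using amap_inverse(4) dom.Id_in omap_inverse(1)[OF b] by metis
qed

lemma comp_inverse: "comp_func X inverse_func F = id_func X" "comp_func Y F inverse_func = id_func Y"
  by (auto simp: comp_func_def id_func_def omap_inverse amap_inverse intro!: restrict_ext)

text \<open>Injectivity on objects reflects the matching of endpoints, injectivity on arrows the
  equation of composites; both speak only about sides that lie in \<open>X\<close>.\<close>

lemma comm_square_map_iff:
  assumes "sq_top S \<in> Arr X" "sq_bot S \<in> Arr X" "sq_left S \<in> Arr X" "sq_right S \<in> Arr X"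
  shows "comm_square Y (map_square F S) \<longleftrightarrow> comm_square X S"
proof -
  have "Comp Y (amap F (sq_right S)) (amap F (sq_top S)) = Comp Y (amap F (sq_bot S)) (amap F (sq_left S))
    \<longleftrightarrow> Comp X (sq_right S) (sq_top S) = Comp X (sq_bot S) (sq_left S)"
    if "Cod X (sq_top S) = Dom X (sq_right S)" "Cod X (sq_left S) = Dom X (sq_bot S)"
    using amap_Comp assms that amap_eq_iff dom.Comp_in by metis
  then show ?thesis
    using assms by (auto simp: comm_square_def amap_inverse Dom_amap Cod_amap omap_eq_iff
      dom.Dom_in dom.Cod_in)
qed

lemma map_square_inverse:
  assumes "comm_square Y S"
  shows "map_square F (map_square inverse_func S) = S" "comm_square X (map_square inverse_func S)"
proof -
  show eq: "map_square F (map_square inverse_func S) = S"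
    using assms by (intro square.equality) (simp_all add: comm_square_def amap_inverse)
  show "comm_square X (map_square inverse_func S)"
    using assms comm_square_map_iff[of "map_square inverse_func S"]
    by (simp add: eq, simp add: comm_square_def amap_inverse)
qed

lemma map_square_inject:
  assumes "comm_square X S" "comm_square X T" "map_square F S = map_square F T"
  shows "S = T"
proof -
  have "sq_top S = sq_top T" "sq_bot S = sq_bot T" "sq_left S = sq_left T" "sq_right S = sq_right T"
    using assms(1,2) arg_cong[OF assms(3), of sq_top] arg_cong[OF assms(3), of sq_bot]
      arg_cong[OF assms(3), of sq_left] arg_cong[OF assms(3), of sq_right]
    by (simp_all add: comm_square_def amap_eq_iff)
  then show ?thesis by (intro square.equality) simp_all
qed

text \<open>Cones over \<open>S\<close> and their mediating arrows correspond under the bijection on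
  arrows, so the unique mediating arrow in \<open>Y\<close> has exactly one preimage, and this
  preimage mediates in \<open>X\<close>.\<close>

lemma pullback_square_reflect:
  assumes pb: "pullback_square Y (map_square F S)" and c: "comm_square X S"
  shows "pullback_square X S"
  unfolding pullback_square_def
proof (intro conjI c allI impI, elim conjE)
  have S: "sq_top S \<in> Arr X" "sq_bot S \<in> Arr X" "sq_left S \<in> Arr X" "sq_right S \<in> Arr X"
    "Dom X (sq_top S) = Dom X (sq_left S)"
    using c by (simp_all add: comm_square_def)
  fix u v
  assume uv: "u \<in> Arr X" "v \<in> Arr X" "Dom X u = Dom X v" "Cod X u = Dom X (sq_right S)"
    "Cod X v = Dom X (sq_bot S)" "Comp X (sq_right S) u = Comp X (sq_bot S) v"
  have "Comp Y (amap F (sq_right S)) (amap F u) = Comp Y (amap F (sq_bot S)) (amap F v)"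
    using amap_Comp[of u "sq_right S"] amap_Comp[of v "sq_bot S"] uv S by simp
  then have ex1: "\<exists>!w. w \<in> homset Y (Dom Y (amap F u)) (Dom Y (amap F (sq_top S))) \<and>
      Comp Y (amap F (sq_top S)) w = amap F u \<and> Comp Y (amap F (sq_left S)) w = amap F v"
    using uv S
    by (intro pb[unfolded pullback_square_def map_square_simps, THEN conjunct2, rule_format])
      (simp add: amap_inverse Dom_amap Cod_amap)
  \<comment> \<open>The composites can be translated once \<open>w\<close> has the right endpoints,
    so the two equations are treated under the hom-set condition.\<close>
  have iff: "(amap F w \<in> homset Y (Dom Y (amap F u)) (Dom Y (amap F (sq_top S))) \<and>
      Comp Y (amap F (sq_top S)) (amap F w) = amap F u \<and> Comp Y (amap F (sq_left S)) (amap F w) = amap F v)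
    \<longleftrightarrow> (w \<in> homset X (Dom X u) (Dom X (sq_top S)) \<and>
      Comp X (sq_top S) w = u \<and> Comp X (sq_left S) w = v)" if w: "w \<in> Arr X" for w
  proof -
    have "amap F w \<in> homset Y (Dom Y (amap F u)) (Dom Y (amap F (sq_top S))) \<longleftrightarrow>
        w \<in> homset X (Dom X u) (Dom X (sq_top S))"
      using amap_homset_iff[OF w, of "Dom X u" "Dom X (sq_top S)"] uv S
      by (simp add: Dom_amap dom.Dom_in)
    moreover have "Comp Y (amap F (sq_top S)) (amap F w) = amap F u \<longleftrightarrow> Comp X (sq_top S) w = u"
      "Comp Y (amap F (sq_left S)) (amap F w) = amap F v \<longleftrightarrow> Comp X (sq_left S) w = v"
      if "w \<in> homset X (Dom X u) (Dom X (sq_top S))"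
      using that amap_Comp[of w "sq_top S"] amap_Comp[of w "sq_left S"] uv S
      by (auto simp: homset_def amap_eq_iff dom.Comp_in)
    ultimately show ?thesis by blast
  qed
  from ex1 obtain w where w: "w \<in> homset Y (Dom Y (amap F u)) (Dom Y (amap F (sq_top S))) \<and>
      Comp Y (amap F (sq_top S)) w = amap F u \<and> Comp Y (amap F (sq_left S)) w = amap F v" by blast
  then have w': "amap inverse_func w \<in> Arr X" "amap F (amap inverse_func w) = w"
    by (auto simp: homset_def amap_inverse)
  show "\<exists>!w. w \<in> homset X (Dom X u) (Dom X (sq_top S)) \<and>
    Comp X (sq_top S) w = u \<and> Comp X (sq_left S) w = v"
  proof (rule ex1I[of _ "amap inverse_func w"])
    show "amap inverse_func w \<in> homset X (Dom X u) (Dom X (sq_top S)) \<and>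
      Comp X (sq_top S) (amap inverse_func w) = u \<and> Comp X (sq_left S) (amap inverse_func w) = v"
      using iff[OF w'(1)] w unfolding w'(2) by blast
    fix z assume z: "z \<in> homset X (Dom X u) (Dom X (sq_top S)) \<and>
      Comp X (sq_top S) z = u \<and> Comp X (sq_left S) z = v"
    then have zA: "z \<in> Arr X" by (simp add: homset_def)
    have "amap F z = w" using ex1 w iff[OF zA] z by blast
    then show "z = amap inverse_func w" using amap_inverse(4)[OF zA] by simp
  qed
qed

end

text \<open>Here \<open>X\<close> is merely a category with extra fields that correspond to those of
  \<open>Y\<close>; all contextual axioms of \<open>X\<close> are read off from \<open>Y\<close>. In
  the hypothesis on \<open>Qs\<close>, commutativity in \<open>X\<close> ensures that the sides are
  arrows of \<open>X\<close>, where \<open>F\<close> is injective.\<close>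

lemma contextual_isomorphismI:
  assumes X: "category X" and Y: "contextual_category Y" and F: "is_functor X Y F"
    and bo: "bij_betw (omap F) (Obj X) (Obj Y)" and ba: "bij_betw (amap F) (Arr X) (Arr Y)"
    and bdry_in: "\<And>a. a \<in> Obj X \<Longrightarrow> bdry X a \<in> Obj X"
    and proj_in: "\<And>a. a \<in> Obj X \<Longrightarrow> len X a \<ge> 1 \<Longrightarrow> proj X a \<in> Arr X"
    and len: "\<And>a. a \<in> Obj X \<Longrightarrow> len Y (omap F a) = len X a"
    and bdry: "\<And>a. a \<in> Obj X \<Longrightarrow> omap F (bdry X a) = bdry Y (omap F a)"
    and proj: "\<And>a. a \<in> Obj X \<Longrightarrow> len X a \<ge> 1 \<Longrightarrow> amap F (proj X a) = proj Y (omap F a)"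
    and Qs: "\<And>S. S \<in> Qs X \<longleftrightarrow> comm_square X S \<and> map_square F S \<in> Qs Y"
  shows "contextual_isomorphism X Y F"
proof -
  interpret X: category X by fact
  interpret Y: contextual_category Y by fact
  interpret F: bijective_functor X Y F
    using F bo ba by (simp add: bijective_functor_def bijective_functor_axioms_def)
  let ?G = F.inverse_func
  have proj_hom: "proj X a \<in> homset X a (bdry X a)" if a: "a \<in> Obj X" "len X a \<ge> 1" for a
  proof -
    have "proj Y (omap F a) \<in> homset Y (omap F a) (omap F (bdry X a))"
      using Y.proj_in[of "omap F a"] a len[OF a(1)] bdry F.omap_inverse(3) by simp
    then show ?thesis
      using F.amap_homset_iff proj_in a bdry_in proj by metis
  qed
  \<comment> \<open>An arrow lying over a projection of \<open>Y\<close> is itself the projection at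
    the preimage of the object. This identifies the sides of squares in \<open>Qs X\<close>.\<close>
  have proj_reflect: "\<exists>a\<in>Obj X. 1 \<le> len X a \<and> f = proj X a"
    if f: "f \<in> Arr X" and b: "b \<in> Obj Y" "1 \<le> len Y b" "amap F f = proj Y b" for f b
  proof (intro bexI conjI)
    show a: "omap ?G b \<in> Obj X" using F.omap_inverse b by blast
    show l: "1 \<le> len X (omap ?G b)" using len[OF a] b by (simp add: F.omap_inverse)
    show "f = proj X (omap ?G b)"
      using F.amap_eq_iff[OF f proj_in[OF a l]] proj[OF a l] b by (simp add: F.omap_inverse)
  qed
  interpret X: precontextual_category X
  proof
    fix a assume a: "a \<in> Obj X"
    show "bdry X a \<in> Obj X" using bdry_in a .
    show "len X (bdry X a) = len X a - 1" if "1 \<le> len X a"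
      using Y.len_bdry[of "omap F a"] that a len[OF a] len[OF bdry_in[OF a]] bdry[OF a]
      by (simp add: F.omap_inverse)
    show "bdry X a = a" if "len X a = 0"
      using Y.bdry_0[of "omap F a"] that a len[OF a] bdry[OF a] F.omap_eq_iff[OF bdry_in[OF a] a]
      by (simp add: F.omap_inverse)
    show "proj X a \<in> homset X a (bdry X a)" if "1 \<le> len X a"
      using proj_hom a that .
  next
    fix S assume S: "S \<in> Qs X"
    then show c: "comm_square X S" using Qs by blast
    have S': "map_square F S \<in> Qs Y" using S Qs by blast
    have A: "sq_left S \<in> Arr X" "sq_right S \<in> Arr X" using c by (simp_all add: comm_square_def)
    show "\<exists>a\<in>Obj X. 1 \<le> len X a \<and> sq_left S = proj X a"
      using Y.Qs_left[OF S'] proj_reflect[OF A(1)] by auto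
    show "\<exists>a\<in>Obj X. 1 \<le> len X a \<and> sq_right S = proj X a"
      using Y.Qs_right[OF S'] proj_reflect[OF A(2)] by auto
  qed
  note one_Y = Y.one_in Y.len_one
  have len0: "\<exists>!a. a \<in> Obj X \<and> len X a = 0"
  proof (rule ex1I[of _ "omap ?G (one Y)"])
    show "omap ?G (one Y) \<in> Obj X \<and> len X (omap ?G (one Y)) = 0"
      using len[of "omap ?G (one Y)"] one_Y by (simp add: F.omap_inverse)
    fix a assume "a \<in> Obj X \<and> len X a = 0"
    then have "a \<in> Obj X" "omap F a = one Y"
      using Y.unique_len_0 one_Y len[of a] F.omap_inverse(3)[of a] by metis+
    then show "a = omap ?G (one Y)" using F.omap_inverse(4) by metis
  qed
  have one_X: "one X \<in> Obj X" "omap F (one X) = one Y"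
  proof -
    have "one X \<in> Obj X \<and> len X (one X) = 0" using theI'[OF len0] unfolding one_def by auto
    then show "one X \<in> Obj X" "omap F (one X) = one Y"
      using Y.unique_len_0 one_Y len[of "one X"] F.omap_inverse(3)[of "one X"] by metis+
  qed
  interpret X: contextual_category X
  proof
    show "\<exists>!a. a \<in> Obj X \<and> len X a = 0" by (rule len0)
    show "\<exists>!f. f \<in> homset X b (one X)" if b: "b \<in> Obj X" for b
    proof -
      obtain h where h: "h \<in> homset Y (omap F b) (one Y)"
        and unique: "\<And>h'. h' \<in> homset Y (omap F b) (one Y) \<Longrightarrow> h' = h"
        using Y.one_terminal[of "omap F b"] F.omap_inverse(3)[OF b] by blast
      have h': "amap ?G h \<in> Arr X" "amap F (amap ?G h) = h"
        using h by (auto simp: homset_def F.amap_inverse)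
      show ?thesis
      proof (rule ex1I[of _ "amap ?G h"])
        show "amap ?G h \<in> homset X b (one X)"
          using F.amap_homset_iff[OF h'(1) b one_X(1)] h h' one_X by simp
        fix f assume f: "f \<in> homset X b (one X)"
        then have fA: "f \<in> Arr X" by (simp add: homset_def)
        have "amap F f = h"
          using F.amap_homset_iff[OF fA b one_X(1)] f one_X unique by simp
        then show "f = amap ?G h" using F.amap_inverse(4)[OF fA] by simp
      qed
    qed
    show "pullback_square X S" if "S \<in> Qs X" for S
      using that Qs Y.Qs_pullback F.pullback_square_reflect by blast
    show "\<lparr>sq_top = Id X a, sq_bot = Id X (bdry X a), sq_left = proj X a, sq_right = proj X a\<rparr> \<in> Qs X"
      if a: "a \<in> Obj X" "1 \<le> len X a" for a
    proof -
      have p: "proj X a \<in> Arr X" "Dom X (proj X a) = a" "Cod X (proj X a) = bdry X a"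
        using proj_hom[OF a] by (auto simp: homset_def)
      have "comm_square X \<lparr>sq_top = Id X a, sq_bot = Id X (bdry X a), sq_left = proj X a, sq_right = proj X a\<rparr>"
        using p a X.Comp_Id[OF p(1)] X.Id_Comp[OF p(1)]
        by (simp add: comm_square_def X.Id_in X.Dom_Id X.Cod_Id bdry_in)
      then show ?thesis
        using Y.Qs_Id[of "omap F a"] a by (simp add: Qs map_square_def F.amap_Id bdry_in bdry proj
          F.omap_inverse len)
    qed
    show "hcomp X S T \<in> Qs X" if ST: "S \<in> Qs X" "T \<in> Qs X" "sq_right S = sq_left T" for S T
    proof -
      have c: "comm_square X S" "comm_square X T" using ST Qs by blast+
      have tb: "Cod X (sq_top S) = Dom X (sq_top T)" "Cod X (sq_bot S) = Dom X (sq_bot T)"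
        "Comp X (sq_left T) (sq_top S) = Comp X (sq_bot S) (sq_left S)"
        "Comp X (sq_right T) (sq_top T) = Comp X (sq_bot T) (sq_left T)"
        using c ST(3) by (simp_all add: comm_square_def)
      have A: "sq_top S \<in> Arr X" "sq_bot S \<in> Arr X" "sq_left S \<in> Arr X" "sq_top T \<in> Arr X"
        "sq_bot T \<in> Arr X" "sq_left T \<in> Arr X" "sq_right T \<in> Arr X"
        using c by (simp_all add: comm_square_def)
      have "map_square F (hcomp X S T) = hcomp Y (map_square F S) (map_square F T)"
        using F.amap_Comp A tb by (simp add: map_square_def hcomp_def)
      moreover have "hcomp Y (map_square F S) (map_square F T) \<in> Qs Y"
        using Y.Qs_hcomp ST Qs by simp
      moreover have "comm_square Y (hcomp Y (map_square F S) (map_square F T))"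
        using calculation(2) Y.Qs_comm by blast
      moreover have "Comp X (sq_top T) (sq_top S) \<in> Arr X" "Comp X (sq_bot T) (sq_bot S) \<in> Arr X"
        using A tb X.Comp_in by blast+
      ultimately show ?thesis
        using F.comm_square_map_iff[of "hcomp X S T"] A unfolding Qs
        by (simp add: hcomp_def[of X])
    qed
    show "\<exists>!S. S \<in> Qs X \<and> sq_right S = proj X a \<and> sq_bot S = f"
      if a: "a \<in> Obj X" "1 \<le> len X a" and f: "f \<in> Arr X" "Cod X f = bdry X a" for a f
    proof -
      \<comment> \<open>The distinguished square over the image of the cospan is taken back along
        the inverse functor.\<close>
      have "\<exists>!S. S \<in> Qs Y \<and> sq_right S = proj Y (omap F a) \<and> sq_bot S = amap F f"
        using a f len by (intro Y.Qs_unique) (simp_all add: F.omap_inverse F.amap_inverse F.Cod_amap bdry)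
      then obtain S where S: "S \<in> Qs Y" "sq_right S = proj Y (omap F a)" "sq_bot S = amap F f"
        and unique: "\<And>S'. S' \<in> Qs Y \<Longrightarrow> sq_right S' = proj Y (omap F a) \<Longrightarrow> sq_bot S' = amap F f \<Longrightarrow> S' = S"
        by blast
      note inv = F.map_square_inverse[OF Y.Qs_comm[OF S(1)]]
      show ?thesis
      proof (rule ex1I[of _ "map_square ?G S"])
        show "map_square ?G S \<in> Qs X \<and> sq_right (map_square ?G S) = proj X a \<and>
            sq_bot (map_square ?G S) = f"
          using inv S a f proj_in[OF a] by (simp add: Qs proj[symmetric] F.amap_inverse)
        fix S' assume S': "S' \<in> Qs X \<and> sq_right S' = proj X a \<and> sq_bot S' = f"
        then have "map_square F S' = S"
          using Qs by (intro unique) (simp_all add: proj[OF a])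
        then show "S' = map_square ?G S"
          using S' Qs inv by (intro F.map_square_inject) auto
      qed
    qed
  qed
  have "contextual_functor X Y F"
    using len bdry proj Qs by unfold_locales auto
  moreover have "contextual_functor Y X ?G"
  proof -
    interpret G: is_functor Y X ?G by (rule F.functor_inverse)
    show ?thesis
    proof
      fix b assume b: "b \<in> Obj Y"
      let ?a = "omap ?G b"
      have a: "?a \<in> Obj X" "omap F ?a = b" using b by (simp_all add: F.omap_inverse)
      show l: "len X ?a = len Y b" using len[OF a(1)] a by simp
      show "omap ?G (bdry Y b) = bdry X ?a"
        using bdry[OF a(1)] a F.omap_inverse(4)[OF bdry_in[OF a(1)]] by simp
      show "amap ?G (proj Y b) = proj X ?a" if "1 \<le> len Y b"
        using proj[of ?a] proj_in[of ?a] that a l F.amap_inverse(4)[of "proj X ?a"] by simp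
    next
      show "map_square ?G S \<in> Qs X" if "S \<in> Qs Y" for S
        using F.map_square_inverse[OF Y.Qs_comm[OF that]] that by (simp add: Qs)
    qed
  qed
  ultimately show ?thesis
    unfolding contextual_isomorphism_def using F.comp_inverse by blast
qed

section \<open>Distinguished squares over the terminal object\<close>

context contextual_category
begin

text \<open>Every projection lowers the length by one, so lengths fall strictly along a nonempty
  composite and only the empty one preserves them.\<close>

lemma display_maps_len:
  assumes "d \<in> display_maps C"
  shows "d \<in> Arr C \<and> len C (Cod C d) \<le> len C (Dom C d) \<and>
    (len C (Cod C d) = len C (Dom C d) \<longrightarrow> d = Id C (Dom C d))"
  using assms
proof induction
  case (empty a)
  then show ?case by (simp add: Id_in Dom_Id Cod_Id)
next
  case (step a d)
  note p = proj_at[OF step(1,2)]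
  have "Dom C (Comp C d (proj C a)) = a" "Cod C (Comp C d (proj C a)) = Cod C d"
    "Comp C d (proj C a) \<in> Arr C"
    using step p by (simp_all add: Dom_Comp Cod_Comp Comp_in)
  then show ?case
    using step len_bdry[OF step(1,2)] by auto
qed

text \<open>\<open>disp_len\<close> compares the lengths of the endpoints only. Splitting off one
  projection leaves a display map between objects of equal length, hence an identity; the empty
  composite is excluded by its length 0.\<close>

lemma display_map_1_iff:
  "d \<in> display_maps C \<and> disp_len C d = 1 \<longleftrightarrow> (\<exists>a\<in>Obj C. len C a \<ge> 1 \<and> d = proj C a)"
proof (intro iffI; elim conjE bexE)
  assume d: "d \<in> display_maps C" and l: "disp_len C d = 1"
  then show "\<exists>a\<in>Obj C. len C a \<ge> 1 \<and> d = proj C a"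
  proof cases
    case (empty a)
    then show ?thesis using l by (simp add: disp_len_def Dom_Id Cod_Id)
  next
    case (step a e)
    note p = proj_at[OF step(2,3)] and e = display_maps_len[OF step(4)]
    have "Dom C d = a" "Cod C d = Cod C e"
      using step p e by (simp_all add: Dom_Comp Cod_Comp)
    then have "e = Id C (bdry C a)"
      using e step l len_bdry[OF step(2,3)] by (auto simp: disp_len_def)
    then have "d = proj C a"
      using step p Id_Comp[OF p(1)] by simp
    then show ?thesis using step by blast
  qed
next
  fix a assume a: "a \<in> Obj C" "len C a \<ge> 1" and d: "d = proj C a"
  note p = proj_at[OF a]
  have "Comp C (Id C (bdry C a)) (proj C a) \<in> display_maps C"
    using a bdry_in by (intro display_maps.intros) (simp_all add: Dom_Id)
  then show "d \<in> display_maps C \<and> disp_len C d = 1"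
    using p a Id_Comp[OF p(1)] len_bdry[OF a] by (simp add: d disp_len_def)
qed

text \<open>By terminality, the projection of \<open>b\<close> followed by the arrow from
  \<open>bdry C b\<close> to \<open>one C\<close> equals \<open>f\<close>. This is the inductive
  step of the arguments on the length of \<open>b\<close>.\<close>

lemma bang_factor:
  assumes "f \<in> homset C b (one C)" "len C b \<ge> 1"
  obtains g where "g \<in> homset C (bdry C b) (one C)" "f = Comp C g (proj C b)"
    "b \<in> Obj C"
proof -
  have b: "b \<in> Obj C" using assms Dom_in by (auto simp: homset_def)
  note p = proj_at[OF b assms(2)]
  obtain g where g: "g \<in> homset C (bdry C b) (one C)" using one_terminal bdry_in[OF b] by blast
  then have "Comp C g (proj C b) \<in> homset C b (one C)"
    using p by (simp add: homset_def Comp_in Dom_Comp Cod_Comp)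
  with assms to_one_unique have "f = Comp C g (proj C b)" by blast
  with that g b show thesis by blast
qed

lemma bang_0:
  assumes "f \<in> homset C b (one C)" "len C b = 0"
  shows "b = one C" "f = Id C (one C)"
proof -
  show b: "b = one C" using assms Dom_in by (auto simp: homset_def intro!: one_eqI)
  show "f = Id C (one C)"
    using assms one_in unfolding b
    by (intro to_one_unique) (simp_all add: homset_def Id_in Dom_Id Cod_Id)
qed

text \<open>Induction on the length of \<open>b\<close>, splitting off its projection. At length 0
  the object is \<open>one C\<close> and \<open>f\<close> is its identity, an empty
  composite.\<close>

lemma to_one_display: "f \<in> homset C b (one C) \<Longrightarrow> f \<in> display_maps C"
proof (induction "len C b" arbitrary: b f)
  case 0
  then show ?case using bang_0[of f b] one_in by (simp add: display_maps.empty)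
next
  case (Suc n)
  then obtain g where g: "g \<in> homset C (bdry C b) (one C)" "f = Comp C g (proj C b)" "b \<in> Obj C"
    using bang_factor[of f b] by auto
  have "g \<in> display_maps C"
    using Suc(1)[of "bdry C b" g] Suc(2) g len_bdry[of b] by simp
  then show ?case
    using g Suc(2) by (auto simp: homset_def intro!: display_maps.step)
qed

lemma distinguished_comm_square: "T \<in> distinguished C \<Longrightarrow> comm_square C T"
proof (induction rule: distinguished.induct)
  case (empty f)
  then show ?case
    using Comp_Id[OF empty] Id_Comp[OF empty]
    by (simp add: comm_square_def Id_in Dom_Id Cod_Id Dom_in Cod_in)
next
  case (step S T)
  note c = Qs_comm[OF step(1)]
  have "Comp C (sq_bot T) (Comp C (sq_left T) (sq_left S))
    = Comp C (Comp C (sq_right T) (sq_right S)) (sq_top S)"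
    using c step by (intro comm_paste[where y = "sq_bot S"]) (simp_all add: comm_square_def)
  then show ?case
    using c step by (simp add: comm_square_def vcomp_def Comp_in Dom_Comp Cod_Comp)
qed

text \<open>Each square of \<open>Qs C\<close> in a vertical composite lowers the length along the
  left side by one. If the length is kept, no such square occurs and \<open>T\<close> is an empty
  composite.\<close>

lemma distinguished_left: "T \<in> distinguished C \<Longrightarrow> sq_left T \<in> display_maps C \<and>
    (len C (Dom C (sq_left T)) = len C (Cod C (sq_left T)) \<longrightarrow>
      T = \<lparr>sq_top = sq_bot T, sq_bot = sq_bot T,
        sq_left = Id C (Dom C (sq_bot T)), sq_right = Id C (Cod C (sq_bot T))\<rparr>)"
proof (induction rule: distinguished.induct)
  case (empty f)
  then show ?case by (simp add: display_maps.empty Dom_in)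
next
  case (step S T)
  obtain a where a: "a \<in> Obj C" "len C a \<ge> 1" "sq_left S = proj C a"
    using Qs_left[OF step(1)] by blast
  note p = proj_at[OF a(1,2)] and c = Qs_comm[OF step(1)] distinguished_comm_square[OF step(2)]
  have D: "Dom C (sq_left T) = bdry C a" "sq_left T \<in> Arr C"
    using c step(3) a p by (simp_all add: comm_square_def)
  have "Dom C (Comp C (sq_left T) (proj C a)) = a"
    "Cod C (Comp C (sq_left T) (proj C a)) = Cod C (sq_left T)"
    using D p by (simp_all add: Dom_Comp Cod_Comp)
  moreover have "len C (Cod C (sq_left T)) < len C a"
    using display_maps_len[of "sq_left T"] step D len_bdry[OF a(1,2)] a(2) by auto
  ultimately show ?case
    using step a D by (simp add: vcomp_def display_maps.step)
qed

text \<open>Links the vertical composites allowed in indexed distinguished squares with the single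
  squares required in the power. A left side that is one projection has room for one square of
  \<open>Qs C\<close> only; the composite below it is empty and is absorbed.\<close>

lemma distinguished_proj_iff:
  assumes "sq_left S = proj C a" "a \<in> Obj C" "len C a \<ge> 1"
  shows "S \<in> distinguished C \<longleftrightarrow> S \<in> Qs C"
proof
  note p = proj_at[OF assms(2,3)]
  assume "S \<in> distinguished C"
  then show "S \<in> Qs C"
  proof cases
    case (empty f)
    have "len C (Dom C (Id C (Dom C f))) = len C (Cod C (Id C (Dom C f)))"
      using empty by (simp add: Dom_Id Cod_Id Dom_in)
    then show ?thesis using empty assms p len_bdry[OF assms(2,3)] by simp
  next
    case (step S' T)
    obtain b where b: "b \<in> Obj C" "len C b \<ge> 1" "sq_left S' = proj C b"
      using Qs_left[OF step(2)] by blast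
    note pb = proj_at[OF b(1,2)]
    note c = Qs_comm[OF step(2)] distinguished_comm_square[OF step(3)]
    have D: "Dom C (sq_left T) = bdry C b" "sq_left T \<in> Arr C"
      using c step(4) b pb by (simp_all add: comm_square_def)
    \<comment> \<open>Comparing domains gives \<open>a = b\<close>; comparing codomains shows that
      the left side of \<open>T\<close> both starts and ends at \<open>bdry C a\<close>, so
      \<open>T\<close> is an empty composite.\<close>
    have "proj C a = Comp C (sq_left T) (proj C b)"
      using step assms(1) b by (simp add: vcomp_def)
    from arg_cong[OF this, of "Dom C"] arg_cong[OF this, of "Cod C"]
    have ba: "a = b" "bdry C a = Cod C (sq_left T)"
      unfolding p using D pb Dom_Comp[OF pb(1) D(2)] Cod_Comp[OF pb(1) D(2)] by simp_all
    have "len C (Dom C (sq_left T)) = len C (Cod C (sq_left T))"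
      unfolding D(1) ba(1)[symmetric] ba(2) ..
    note T = distinguished_left[OF step(3), THEN conjunct2, THEN mp, OF this]
    have "sq_bot T = sq_bot S'" "sq_left T = Id C (Dom C (sq_bot S'))"
      "sq_right T = Id C (Cod C (sq_bot S'))"
      using arg_cong[OF T, of sq_left] arg_cong[OF T, of sq_right] arg_cong[OF T, of sq_top] step(4)
      by simp_all
    then have "vcomp C S' T = S'"
      using c(1) Id_Comp[of "sq_left S'"] Id_Comp[of "sq_right S'"]
      by (intro square.equality) (simp_all add: vcomp_def comm_square_def)
    then show ?thesis using step by simp
  qed
next
  assume S: "S \<in> Qs C"
  note c = Qs_comm[OF S]
  have "vcomp C S \<lparr>sq_top = sq_bot S, sq_bot = sq_bot S, sq_left = Id C (Dom C (sq_bot S)),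
      sq_right = Id C (Cod C (sq_bot S))\<rparr> \<in> distinguished C"
    using S c by (intro distinguished.intros) (simp_all add: comm_square_def)
  moreover have "vcomp C S \<lparr>sq_top = sq_bot S, sq_bot = sq_bot S, sq_left = Id C (Dom C (sq_bot S)),
      sq_right = Id C (Cod C (sq_bot S))\<rparr> = S"
    using c Id_Comp[of "sq_left S"] Id_Comp[of "sq_right S"]
    by (intro square.equality) (simp_all add: vcomp_def comm_square_def)
  ultimately show "S \<in> distinguished C" by simp
qed

text \<open>The trivial pullback of \<open>f\<close> along the identity of its codomain.\<close>

definition id_square :: "'m \<Rightarrow> 'm square" where
  "id_square f = \<lparr>sq_top = Id C (Dom C f), sq_bot = Id C (Cod C f), sq_left = f, sq_right = f\<rparr>"

text \<open>Induction from the bottom upwards: over an identity the only square of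
  \<open>Qs C\<close> with a given right side is the one of \<open>Qs_Id\<close>, whose top is again
  an identity, so the next square meets the same situation. This is the uniqueness half of
  evaluating \<open>dist_pb\<close> at an identity.\<close>

lemma distinguished_id_bot:
  "T \<in> distinguished C \<Longrightarrow> c \<in> Obj C \<Longrightarrow> sq_bot T = Id C c \<Longrightarrow> T = id_square (sq_right T)"
proof (induction rule: distinguished.induct)
  case (empty f)
  then show ?case by (simp add: id_square_def Id_in Dom_Id Cod_Id)
next
  case (step S T)
  let ?r = "sq_right T"
  note c = Qs_comm[OF step(1)] distinguished_comm_square[OF step(2)]
  have T: "T = id_square ?r" using step by (simp add: vcomp_def)
  have b': "Id C (Cod C ?r) = Id C c" "sq_top T = Id C (Dom C ?r)" "sq_left T = ?r"
    using arg_cong[OF T, of sq_bot] arg_cong[OF T, of sq_top] arg_cong[OF T, of sq_left] step(6)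
    by (simp_all add: id_square_def vcomp_def)
  obtain b where b: "b \<in> Obj C" "len C b \<ge> 1" "sq_right S = proj C b"
    using Qs_right[OF step(1)] by blast
  note p = proj_at[OF b(1,2)]
  have r: "Dom C ?r = bdry C b" "?r \<in> Arr C"
    using c step(3) b(3) p b'(2) by (auto simp: comm_square_def Cod_Id Dom_in)
  have "S = \<lparr>sq_top = Id C b, sq_bot = Id C (bdry C b), sq_left = proj C b, sq_right = proj C b\<rparr>"
  proof -
    have "\<exists>!S. S \<in> Qs C \<and> sq_right S = proj C b \<and> sq_bot S = Id C (bdry C b)"
      using b bdry_in by (intro Qs_unique) (simp_all add: Id_in Cod_Id)
    then show ?thesis
      using Qs_Id[OF b(1,2)] step(1,3) b(3) b'(2) r(1) by (metis square.select_convs(2,4))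
  qed
  then show ?case
    using b'(1,3) r p step(6) by (simp add: vcomp_def id_square_def Dom_Comp Cod_Comp)
qed

text \<open>Stacks the identity squares of the projections of \<open>b\<close>, of its boundary and
  so on; the tower ends at \<open>one C\<close> with the empty composite on its identity.\<close>

lemma id_square_bang_distinguished:
  "f \<in> homset C b (one C) \<Longrightarrow> id_square f \<in> distinguished C"
proof (induction "len C b" arbitrary: b f)
  case 0
  then show ?case
    using bang_0[of f b] one_in distinguished.empty[of "Id C (one C)" C]
    by (simp add: id_square_def Id_in Dom_Id Cod_Id)
next
  case (Suc n)
  then obtain g where g: "g \<in> homset C (bdry C b) (one C)" "f = Comp C g (proj C b)" "b \<in> Obj C"
    using bang_factor[of f b] by auto
  have l: "len C b \<ge> 1" using Suc by simp
  note p = proj_at[OF g(3) l]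
  let ?S = "\<lparr>sq_top = Id C b, sq_bot = Id C (bdry C b), sq_left = proj C b, sq_right = proj C b\<rparr>"
  have "id_square g \<in> distinguished C"
    using Suc(1)[of "bdry C b" g] Suc(2) g len_bdry[of b] by simp
  then have "vcomp C ?S (id_square g) \<in> distinguished C"
    using Qs_Id[OF g(3) l] g(1) by (intro distinguished.step) (simp_all add: id_square_def homset_def)
  moreover have "vcomp C ?S (id_square g) = id_square f"
    using g p by (simp add: vcomp_def id_square_def homset_def Dom_Comp Cod_Comp)
  ultimately show ?case by simp
qed

lemma dist_pb_bang:
  assumes f: "f \<in> homset C b (one C)"
  shows "dist_pb C f (Id C (one C)) = id_square f"
  unfolding dist_pb_def
proof (rule the_equality)
  show "id_square f \<in> distinguished C \<and> sq_right (id_square f) = f \<and> sq_bot (id_square f) = Id C (one C)"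
    using id_square_bang_distinguished[OF f] f by (simp add: id_square_def homset_def)
qed (metis distinguished_id_bot one_in)

text \<open>The top of the square is an identity, so the first equation forces the mediating arrow
  to be \<open>u\<close>; the second compares arrows into \<open>one C\<close>.\<close>

lemma pb_map_id_square:
  assumes f: "f \<in> homset C b (one C)" and u: "u \<in> homset C x b" and v: "v \<in> homset C x (one C)"
  shows "pb_map C (id_square f) u v = u"
  unfolding pb_map_def
proof (rule the_equality)
  have "Comp C f u \<in> homset C x (one C)"
    using f u by (simp add: homset_def Comp_in Dom_Comp Cod_Comp)
  then have "Comp C f u = v" using to_one_unique v by blast
  moreover have "b \<in> Obj C" "Comp C (Id C b) u = u"
    using u Id_Comp[of u] by (auto simp: homset_def Cod_in)
  ultimately show "u \<in> homset C (Dom C u) (Dom C (sq_top (id_square f))) \<and>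
    Comp C (sq_top (id_square f)) u = u \<and> Comp C (sq_left (id_square f)) u = v"
    using u f by (simp add: id_square_def homset_def Dom_Id)
  fix w assume "w \<in> homset C (Dom C u) (Dom C (sq_top (id_square f))) \<and>
    Comp C (sq_top (id_square f)) w = u \<and> Comp C (sq_left (id_square f)) w = v"
  then show "w = u"
    using f \<open>b \<in> Obj C\<close> Id_Comp[of w] by (auto simp: id_square_def homset_def Dom_Id)
qed

end

section \<open>Functors and sorts on the adjoined terminal object\<close>

lemma pre_simps [simp]:
  "Obj (pre_of_cat A) = insert Apex (Base ` Obj A)"
  "Arr (pre_of_cat A) = BaseArr ` Arr A \<union> ToApex ` insert Apex (Base ` Obj A)"
  "Dom (pre_of_cat A) = plus_Dom A" "Cod (pre_of_cat A) = plus_Cod A"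
  "Id (pre_of_cat A) = plus_Id A" "Comp (pre_of_cat A) = plus_Comp A"
  "len (pre_of_cat A) x = (if x = Apex then 0 else 1)" "bdry (pre_of_cat A) x = Apex"
  "proj (pre_of_cat A) = ToApex" "Qs (pre_of_cat A) = {}"
  by (simp_all add: pre_of_cat_def adjoin_terminal_def precontextual.defs category.defs)

section \<open>Restriction of functors and transformations to the base category\<close>

definition restrict_func :: "('o, 'm, 'x) category_scheme
    \<Rightarrow> ('o plus_obj, ('o, 'm) plus_arr, 'p, 'n) func \<Rightarrow> ('o, 'm, 'p, 'n) func" where
  "restrict_func A F =
    \<lparr>omap = (\<lambda>a\<in>Obj A. omap F (Base a)), amap = (\<lambda>f\<in>Arr A. amap F (BaseArr f))\<rparr>"

definition restrict_nt :: "('o, 'm, 'x) category_scheme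
    \<Rightarrow> ('o plus_obj, ('o, 'm) plus_arr, 'p, 'n) nat_trans \<Rightarrow> ('o, 'm, 'p, 'n) nat_trans" where
  "restrict_nt A t = \<lparr>nt_dom = restrict_func A (nt_dom t), nt_cod = restrict_func A (nt_cod t),
     nt_at = (\<lambda>a\<in>Obj A. nt_at t (Base a))\<rparr>"

lemma restrict_func_simps [simp]:
  "a \<in> Obj A \<Longrightarrow> omap (restrict_func A F) a = omap F (Base a)"
  "f \<in> Arr A \<Longrightarrow> amap (restrict_func A F) f = amap F (BaseArr f)"
  by (simp_all add: restrict_func_def)

lemma restrict_nt_simps [simp]:
  "nt_dom (restrict_nt A t) = restrict_func A (nt_dom t)"
  "nt_cod (restrict_nt A t) = restrict_func A (nt_cod t)"
  "a \<in> Obj A \<Longrightarrow> nt_at (restrict_nt A t) a = nt_at t (Base a)"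
  by (simp_all add: restrict_nt_def)

context contextual_power
begin

abbreviation A_pre where "A_pre \<equiv> pre_of_cat A"

lemma category_pre: "category A_pre"
  using precontextual_pre_of_cat[OF A.category_axioms] by (rule precontextual_category.axioms(1))

text \<open>Working form of \<open>in_D A_pre C\<close>, without the clause on display maps, which
  \<open>in_D_pre_iff\<close> derives.\<close>

definition pointed :: "('o plus_obj, ('o, 'm) plus_arr, 'p, 'n) func \<Rightarrow> bool" where
  "pointed F \<longleftrightarrow> is_functor A_pre C F \<and> omap F Apex = one C"

lemma pointed_functor: "pointed F \<Longrightarrow> is_functor A_pre C F"
  by (simp add: pointed_def)

lemma pointed_const: "pointed (const_func A_pre C (one C))"
  using functor_const_func[OF category_pre C.category_axioms C.one_in]
  by (simp add: pointed_def const_func_def)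

lemma pointed_ToApex:
  assumes "pointed F" "x \<in> Obj A_pre"
  shows "amap F (ToApex x) \<in> homset C (omap F x) (one C)"
proof -
  have "ToApex x \<in> Arr A_pre" using assms(2) by auto
  then show ?thesis
    using functor_at(2-4)[OF pointed_functor[OF assms(1)], of "ToApex x"] assms by (simp add: homset_def pointed_def)
qed

text \<open>Whatever is composed after the projection \<open>ToApex a\<close>, the result is
  \<open>ToApex a\<close> again, so composites never grow beyond one step.\<close>

lemma display_maps_pre:
  "d \<in> display_maps A_pre \<Longrightarrow> (\<exists>a\<in>Obj A_pre. d = plus_Id A a) \<or> (\<exists>x\<in>Obj A_pre. d = ToApex x)"
proof (induction rule: display_maps.induct)
  case (step a d)
  then show ?case by (cases d) auto
qed auto

lemma in_D_pre_iff: "in_D A_pre C F \<longleftrightarrow> pointed F"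
proof
  assume F: "pointed F"
  then interpret F: is_functor A_pre C F by (rule pointed_functor)
  have "amap F d \<in> display_maps C" if "d \<in> display_maps A_pre" for d
    using display_maps_pre[OF that]
  proof (elim disjE bexE)
    fix a assume a: "a \<in> Obj A_pre" "d = plus_Id A a"
    have "amap F d = Id C (omap F a)" using F.amap_Id[OF a(1)] a(2) by simp
    then show ?thesis
      using functor_at(1)[OF F.is_functor_axioms a(1)] by (simp add: display_maps.empty)
  next
    fix x assume "x \<in> Obj A_pre" "d = ToApex x"
    then show ?thesis using pointed_ToApex[OF F] C.to_one_display by blast
  qed
  then show "in_D A_pre C F"
    using F by (auto simp: in_D_def pointed_def)
qed (auto simp: in_D_def pointed_def)

lemma functor_restrict:
  assumes "is_functor A_pre C F"
  shows "is_functor A C (restrict_func A F)"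
proof -
  interpret F: is_functor A_pre C F by fact
  have arr: "BaseArr f \<in> Arr A_pre" if "f \<in> Arr A" for f using that by simp
  have obj: "Base a \<in> Obj A_pre" if "a \<in> Obj A" for a using that by simp
  note at = functor_at[OF assms]
  show ?thesis
  proof
    show "omap (restrict_func A F) \<in> Obj A \<rightarrow>\<^sub>E Obj C" "amap (restrict_func A F) \<in> Arr A \<rightarrow>\<^sub>E Arr C"
      using at(1)[OF obj] at(2)[OF arr] by (auto simp: restrict_func_def)
    fix f assume f: "f \<in> Arr A"
    show "Dom C (amap (restrict_func A F) f) = omap (restrict_func A F) (Dom A f)"
      "Cod C (amap (restrict_func A F) f) = omap (restrict_func A F) (Cod A f)"
      using at(3,4)[OF arr[OF f]] f by (simp_all add: A.Dom_in A.Cod_in)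
    fix g assume g: "g \<in> Arr A" and fg: "Cod A f = Dom A g"
    show "amap (restrict_func A F) (Comp A g f) =
        Comp C (amap (restrict_func A F) g) (amap (restrict_func A F) f)"
      using F.amap_Comp[OF arr[OF f] arr[OF g]] f g fg by (simp add: A.Comp_in)
  next
    fix a assume a: "a \<in> Obj A"
    show "amap (restrict_func A F) (Id A a) = Id C (omap (restrict_func A F) a)"
      using F.amap_Id[OF obj[OF a]] a by (simp add: A.Id_in)
  qed
qed

text \<open>An arrow of the enlarged category lies in \<open>A\<close> or ends at the apex; in the
  latter case its image ends at \<open>one C\<close> and is forced.\<close>

lemma restrict_func_inject:
  assumes F: "pointed F" and G: "pointed G" and eq: "restrict_func A F = restrict_func A G"
  shows "F = G"
proof (rule func_eqI[OF pointed_functor[OF F] pointed_functor[OF G]])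
  have o: "omap F (Base a) = omap G (Base a)" if "a \<in> Obj A" for a
    using arg_cong[OF eq, of "\<lambda>F. omap F a"] that by simp
  show oo: "omap F x = omap G x" if "x \<in> Obj A_pre" for x
    using that o F G by (auto simp: pointed_def)
  fix f assume f: "f \<in> Arr A_pre"
  show "amap F f = amap G f"
  proof (cases f)
    case (BaseArr g)
    then show ?thesis using arg_cong[OF eq, of "\<lambda>F. amap F g"] f by auto
  next
    case (ToApex x)
    then have x: "x \<in> Obj A_pre" using f by auto
    show ?thesis
      using pointed_ToApex[OF F x] pointed_ToApex[OF G x] oo[OF x] C.to_one_unique ToApex by metis
  qed
qed

text \<open>\<open>G\<close> is extended by \<open>one C\<close> at the apex and by the unique
  arrows \<open>bang\<close>; a functor law whose target is the apex is an equation between arrows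
  into \<open>one C\<close>.\<close>

lemma restrict_func_surj:
  assumes G: "is_functor A C G"
  obtains F where "pointed F" "restrict_func A F = G"
proof -
  interpret G: is_functor A C G by fact
  define ob where "ob x = (case x of Base a \<Rightarrow> omap G a | Apex \<Rightarrow> one C)" for x
  define bang where "bang b = (THE f. f \<in> homset C b (one C))" for b
  have bang: "bang b \<in> homset C b (one C)" if "b \<in> Obj C" for b
    using theI'[OF C.one_terminal[OF that]] by (simp add: bang_def)
  define F where "F = \<lparr>omap = (\<lambda>x\<in>Obj A_pre. ob x),
    amap = (\<lambda>f\<in>Arr A_pre. case f of BaseArr g \<Rightarrow> amap G g | ToApex x \<Rightarrow> bang (ob x))\<rparr>"
  have ob: "ob x \<in> Obj C" if "x \<in> Obj A_pre" for x
    using that functor_at(1)[OF G] C.one_in by (auto simp: ob_def)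
  have o[simp]: "omap F x = ob x" if "x \<in> Obj A_pre" for x
    using that by (simp add: F_def)
  have [simp]: "ob (Base a) = omap G a" "ob Apex = one C" for a by (simp_all add: ob_def)
  have amap_Base: "amap F (BaseArr g) = amap G g" if "g \<in> Arr A" for g
    using that by (simp add: F_def)
  have To: "amap F (ToApex x) = bang (ob x)" if "x \<in> Obj A_pre" for x
    using that by (auto simp: F_def)
  have hom: "amap F f \<in> homset C (ob (plus_Dom A f)) (ob (plus_Cod A f))" if "f \<in> Arr A_pre" for f
    using that functor_at(2-4)[OF G] bang[OF functor_at(1)[OF G]] bang[OF C.one_in]
    by (cases f) (auto simp: amap_Base To homset_def)
  have dc: "plus_Dom A f \<in> Obj A_pre" "plus_Cod A f \<in> Obj A_pre" if "f \<in> Arr A_pre" for f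
    using that by (cases f; auto simp: A.Dom_in A.Cod_in)+
  have "is_functor A_pre C F"
  proof (intro is_functor.intro category_pre C.category_axioms is_functor_axioms.intro)
    show "omap F \<in> Obj A_pre \<rightarrow>\<^sub>E Obj C" using functor_at(1)[OF G] C.one_in by (auto simp: F_def)
    show "amap F \<in> Arr A_pre \<rightarrow>\<^sub>E Arr C"
    proof (rule PiE_I)
      show "amap F f \<in> Arr C" if "f \<in> Arr A_pre" for f using hom[OF that] by (simp add: homset_def)
      show "amap F f = undefined" if "f \<notin> Arr A_pre" for f
        using that unfolding F_def by (simp del: pre_simps)
    qed
    fix f assume f: "f \<in> Arr A_pre"
    show "Dom C (amap F f) = omap F (Dom A_pre f)" "Cod C (amap F f) = omap F (Cod A_pre f)"
      using hom[OF f] dc[OF f] o[OF dc(1)[OF f]] o[OF dc(2)[OF f]]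
      by (simp_all add: homset_def del: o)
    fix g assume g: "g \<in> Arr A_pre" and fg: "Cod A_pre f = Dom A_pre g"
    show "amap F (Comp A_pre g f) = Comp C (amap F g) (amap F f)"
    proof (cases g)
      case (BaseArr g')
      \<comment> \<open>An arrow that ends at an object of \<open>A\<close> can only come from
        \<open>A\<close>.\<close>
      then obtain f' where f': "f = BaseArr f'" using fg by (cases f) auto
      then show ?thesis
        using f g fg BaseArr G.amap_Comp[of f' g'] A.Comp_in[of f' g'] by (auto simp: amap_Base)
    next
      case (ToApex y)
      have "Comp A_pre g f = ToApex (plus_Dom A f)" using ToApex by (cases f) auto
      moreover have "Comp C (amap F g) (amap F f) \<in> homset C (ob (plus_Dom A f)) (one C)"
        using hom[OF f] hom[OF g] fg ToApex by (simp add: homset_def C.Comp_in C.Dom_Comp C.Cod_Comp)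
      ultimately show ?thesis
        using C.to_one_unique[OF bang[OF ob[OF dc(1)[OF f]]]] To[OF dc(1)[OF f]] by metis
    qed
  next
    fix x assume x: "x \<in> Obj A_pre"
    show "amap F (Id A_pre x) = Id C (omap F x)"
    proof (cases x)
      case (Base a)
      then show ?thesis using x G.amap_Id[of a] by (auto simp: amap_Base A.Id_in)
    next
      case Apex
      have "Id C (one C) \<in> homset C (one C) (one C)"
        using C.one_in by (simp add: homset_def C.Id_in C.Dom_Id C.Cod_Id)
      then show ?thesis
        using Apex To[of Apex] C.to_one_unique[OF bang[OF C.one_in]] by simp
    qed
  qed
  then have "pointed F" by (simp add: pointed_def)
  moreover have "restrict_func A F = G"
    using \<open>pointed F\<close> functor_restrict[OF pointed_functor] by (intro func_eqI[OF _ G]) (auto simp: amap_Base)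
  ultimately show thesis by (rule that)
qed

lemma nt_restrict:
  assumes t: "natural_transformation A_pre C t"
  shows "natural_transformation A C (restrict_nt A t)"
  unfolding restrict_nt_def
proof (rule natural_transformationI)
  show "is_functor A C (restrict_func A (nt_dom t))" "is_functor A C (restrict_func A (nt_cod t))"
    using nt_functors[OF t] by (simp_all add: functor_restrict)
  show "(\<lambda>a\<in>Obj A. nt_at t (Base a)) a \<in> homset C (omap (restrict_func A (nt_dom t)) a)
      (omap (restrict_func A (nt_cod t)) a)" if "a \<in> Obj A" for a
    using nat_trans_at(4)[OF t, of "Base a"] that by simp
  show "Comp C ((\<lambda>a\<in>Obj A. nt_at t (Base a)) (Cod A f)) (amap (restrict_func A (nt_dom t)) f)
      = Comp C (amap (restrict_func A (nt_cod t)) f) ((\<lambda>a\<in>Obj A. nt_at t (Base a)) (Dom A f))"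
    if f: "f \<in> Arr A" for f
    using natural_transformation.naturality[OF t, of "BaseArr f"] f by (simp add: A.Dom_in A.Cod_in)
qed simp

text \<open>The component that restriction forgets sits at the apex. As the codomain is pointed, it
  ends at \<open>one C\<close> and is determined by its domain.\<close>

lemma restrict_nt_inject:
  assumes s: "natural_transformation A_pre C s" and t: "natural_transformation A_pre C t"
    and dom: "nt_dom s = nt_dom t" and cod: "nt_cod s = nt_cod t" "pointed (nt_cod t)"
    and eq: "restrict_nt A s = restrict_nt A t"
  shows "s = t"
proof (rule nat_trans_eqI[OF s t dom cod(1)])
  fix x assume x: "x \<in> Obj A_pre"
  show "nt_at s x = nt_at t x"
  proof (cases x)
    case (Base a)
    then show ?thesis using arg_cong[OF eq, of "\<lambda>t. nt_at t a"] x by auto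
  next
    case Apex
    then show ?thesis
      using nat_trans_at(4)[OF s x] nat_trans_at(4)[OF t x] dom cod C.to_one_unique
      by (metis pointed_def)
  qed
qed

lemma restrict_nt_surj:
  assumes F: "pointed F" and G: "pointed G" and s: "natural_transformation A C s"
    and "nt_dom s = restrict_func A F" "nt_cod s = restrict_func A G"
  obtains t where "natural_transformation A_pre C t" "nt_dom t = F" "nt_cod t = G" "restrict_nt A t = s"
proof -
  \<comment> \<open>Both functors take the value \<open>one C\<close> at the apex, so the identity
    is the only possible component there.\<close>
  define m where "m x = (case x of Base a \<Rightarrow> nt_at s a | Apex \<Rightarrow> Id C (one C))" for x
  let ?t = "\<lparr>nt_dom = F, nt_cod = G, nt_at = (\<lambda>x\<in>Obj A_pre. m x)\<rparr>"
  have m: "m x \<in> homset C (omap F x) (omap G x)" if x: "x \<in> Obj A_pre" for x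
  proof (cases x)
    case (Base a)
    then show ?thesis
      using nat_trans_at(4)[OF s, of a] assms x by (auto simp: m_def)
  next
    case Apex
    then show ?thesis
      using F G C.one_in by (simp add: m_def pointed_def homset_def C.Id_in C.Dom_Id C.Cod_Id)
  qed
  have t: "natural_transformation A_pre C ?t"
  proof (rule natural_transformationI[OF pointed_functor[OF F] pointed_functor[OF G]])
    fix f assume f: "f \<in> Arr A_pre"
    show "Comp C ((\<lambda>x\<in>Obj A_pre. m x) (Cod A_pre f)) (amap F f) =
      Comp C (amap G f) ((\<lambda>x\<in>Obj A_pre. m x) (Dom A_pre f))"
    proof (cases f)
      case (BaseArr g)
      then show ?thesis
        using natural_transformation.naturality[OF s, of g] f assms
        by (auto simp: A.Dom_in A.Cod_in m_def)
    next
      case (ToApex x)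
      then have x: "x \<in> Obj A_pre" "Apex \<in> Obj A_pre" using f by auto
      have "Comp C (m Apex) (amap F (ToApex x)) \<in> homset C (omap F x) (one C)"
        "Comp C (amap G (ToApex x)) (m x) \<in> homset C (omap F x) (one C)"
        using m[OF x(1)] m[OF x(2)] pointed_ToApex[OF F x(1)] pointed_ToApex[OF G x(1)] F G
        by (simp_all add: homset_def C.Comp_in C.Dom_Comp C.Cod_Comp pointed_def)
      from C.to_one_unique[OF this] show ?thesis using ToApex x by simp
    qed
  qed (use m in auto)
  have "restrict_nt A ?t = s"
    using t s assms(4,5) nt_restrict[OF t] by (intro nat_trans_eqI) (auto simp: m_def)
  with t show thesis by (intro that[of ?t]) simp_all
qed

lemma restrict_nt_id: "restrict_nt A (nt_id A_pre C F) = nt_id A C (restrict_func A F)"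
  by (auto simp: restrict_nt_def nt_id_def intro!: restrict_ext)

lemma restrict_nt_comp:
  "restrict_nt A (nt_comp A_pre C t s) = nt_comp A C (restrict_nt A t) (restrict_nt A s)"
  by (auto simp: restrict_nt_def nt_comp_def intro!: restrict_ext)

text \<open>The pullback of \<open>F a \<rightarrow> 1\<close> along the identity of \<open>1\<close> is trivial, so the gap maps of a
  transformation of pointed functors are its components.\<close>

lemma gap_pb_pre:
  assumes t: "natural_transformation A_pre C t" and p: "pointed (nt_dom t)" "pointed (nt_cod t)"
    and a: "a \<in> Obj A"
  shows "gap_pb A_pre C t (Base a) = C.id_square (amap (nt_cod t) (ToApex (Base a)))"
    and "gap_map C (nt_square A_pre t (Base a)) = nt_at t (Base a)"
proof -
  have x: "Base a \<in> Obj A_pre" "Apex \<in> Obj A_pre" using a by auto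
  note To = pointed_ToApex[OF p(2) x(1)] pointed_ToApex[OF p(1) x(1)]
  \<comment> \<open>The bottom of the naturality square at \<open>Base a\<close> is the component at
    the apex, an endomorphism of \<open>one C\<close> and hence the identity.\<close>
  have "nt_at t Apex \<in> homset C (one C) (one C)" "Id C (one C) \<in> homset C (one C) (one C)"
    using nat_trans_at(4)[OF t x(2)] p C.one_in
    by (simp_all add: pointed_def homset_def C.Id_in C.Dom_Id C.Cod_Id)
  then have Apex: "nt_at t Apex = Id C (one C)" by (rule C.to_one_unique)
  show pb: "gap_pb A_pre C t (Base a) = C.id_square (amap (nt_cod t) (ToApex (Base a)))"
    using C.dist_pb_bang[OF To(1)] by (simp add: gap_pb_def Apex)
  show "gap_map C (nt_square A_pre t (Base a)) = nt_at t (Base a)"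
    using pb C.pb_map_id_square[OF To(1) nat_trans_at(4)[OF t x(1)] To(2)]
    by (simp add: gap_map_def gap_pb_def nt_square_def)
qed

text \<open>\<open>Qs A_pre\<close> is empty and the apex has length 0, so being a sort is one
  condition at each \<open>Base a\<close>. The sides of the naturality square end at
  \<open>one C\<close> and are display maps; what remains is that the gap map, here the component,
  has length 1.\<close>

lemma indexed_sort_pre_iff:
  assumes t: "natural_transformation A_pre C t" and p: "pointed (nt_dom t)" "pointed (nt_cod t)"
  shows "indexed_sort A_pre C t \<longleftrightarrow> (\<forall>a\<in>Obj A. len C (omap (nt_dom t) (Base a)) \<ge> 1 \<and>
    nt_at t (Base a) = proj C (omap (nt_dom t) (Base a)))"
proof -
  have "rel_display_1 C (nt_square A_pre t (Base a)) \<longleftrightarrow> len C (omap (nt_dom t) (Base a)) \<ge> 1 \<and>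
    nt_at t (Base a) = proj C (omap (nt_dom t) (Base a))" if a: "a \<in> Obj A" for a
  proof -
    have x: "Base a \<in> Obj A_pre" "Apex \<in> Obj A_pre" "ToApex (Base a) \<in> Arr A_pre" using a by auto
    note To = pointed_ToApex[OF p(2) x(1)] pointed_ToApex[OF p(1) x(1)]
    have "comm_square C (nt_square A_pre t (Base a))"
      using natural_transformation.naturality[OF t x(3)] nat_trans_at[OF t x(1)]
        nat_trans_at[OF t x(2)] To p
      by (simp add: comm_square_def nt_square_def homset_def pointed_def)
    moreover have "amap (nt_dom t) (ToApex (Base a)) \<in> display_maps C"
      "amap (nt_cod t) (ToApex (Base a)) \<in> display_maps C"
      using To C.to_one_display by blast+
    ultimately have "rel_display_1 C (nt_square A_pre t (Base a)) \<longleftrightarrow>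
        nt_at t (Base a) \<in> display_maps C \<and> disp_len C (nt_at t (Base a)) = 1"
      unfolding rel_display_1_def gap_pb_pre(2)[OF t p a] by (simp add: nt_square_def)
    also have "\<dots> \<longleftrightarrow> (\<exists>c\<in>Obj C. len C c \<ge> 1 \<and> nt_at t (Base a) = proj C c)"
      by (rule C.display_map_1_iff)
    \<comment> \<open>The object \<open>c\<close> is no choice: it is the domain of the
      component.\<close>
    also have "\<dots> \<longleftrightarrow> len C (omap (nt_dom t) (Base a)) \<ge> 1 \<and>
        nt_at t (Base a) = proj C (omap (nt_dom t) (Base a))"
      using nat_trans_at(2)[OF t x(1)] C.proj_at(2) functor_at(1)[OF nt_functors(1)[OF t] x(1)]
      by metis
    finally show ?thesis .
  qed
  then show ?thesis
    using t p by (auto simp: indexed_sort_def in_D_pre_iff)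
qed

text \<open>By the last clause the restriction of a sort is fixed by the functors at its ends. For
  this reason chains of sorts and mere sequences of functors can carry the same data.\<close>

lemma indexed_sortD:
  assumes "indexed_sort A_pre C t"
  shows "natural_transformation A_pre C t" "pointed (nt_dom t)" "pointed (nt_cod t)"
    "a \<in> Obj A \<Longrightarrow> len C (omap (nt_dom t) (Base a)) \<ge> 1"
    "a \<in> Obj A \<Longrightarrow> nt_at t (Base a) = proj C (omap (nt_dom t) (Base a))"
    "restrict_nt A t = proj_trans A C (restrict_func A (nt_dom t)) (restrict_func A (nt_cod t))"
proof -
  show t: "natural_transformation A_pre C t" "pointed (nt_dom t)" "pointed (nt_cod t)"
    using assms by (simp_all add: indexed_sort_def in_D_pre_iff)
  then have *: "\<forall>a\<in>Obj A. len C (omap (nt_dom t) (Base a)) \<ge> 1 \<and>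
      nt_at t (Base a) = proj C (omap (nt_dom t) (Base a))"
    using indexed_sort_pre_iff assms by blast
  then show "a \<in> Obj A \<Longrightarrow> len C (omap (nt_dom t) (Base a)) \<ge> 1"
    "a \<in> Obj A \<Longrightarrow> nt_at t (Base a) = proj C (omap (nt_dom t) (Base a))" by auto
  show "restrict_nt A t = proj_trans A C (restrict_func A (nt_dom t)) (restrict_func A (nt_cod t))"
    using * by (auto simp: restrict_nt_def proj_trans_def intro!: restrict_ext)
qed

text \<open>The vertical sides are gap maps, hence components, and the induced bottom is the
  component of the bottom transformation. The left side being a projection,
  \<open>distinguished\<close> can be replaced by \<open>Qs C\<close>.\<close>

lemma indexed_dist_square_pre_iff:
  assumes S: "nt_comm_square A_pre C S" and l: "indexed_sort A_pre C (sq_left S)"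
    and r: "indexed_sort A_pre C (sq_right S)"
  shows "indexed_dist_square A_pre C S \<longleftrightarrow> (\<forall>a\<in>Obj A. square_at S (Base a) \<in> Qs C)"
proof -
  let ?T = "\<lambda>a. \<lparr>sq_top = nt_at (sq_top S) (Base a),
       sq_bot = induced_map C (gap_pb A_pre C (sq_left S) (Base a)) (gap_pb A_pre C (sq_right S) (Base a))
         (nt_at (sq_bot S) (Base a)) (nt_at (sq_top S) (bdry A_pre (Base a))),
       sq_left = gap_map C (nt_square A_pre (sq_left S) (Base a)),
       sq_right = gap_map C (nt_square A_pre (sq_right S) (Base a))\<rparr>"
  note l' = indexed_sortD[OF l] and r' = indexed_sortD[OF r]
  have nt: "natural_transformation A_pre C (sq_top S)" "natural_transformation A_pre C (sq_bot S)"
    and dc: "nt_dom (sq_top S) = nt_dom (sq_left S)" "nt_cod (sq_top S) = nt_dom (sq_right S)"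
      "nt_dom (sq_bot S) = nt_cod (sq_left S)" "nt_cod (sq_bot S) = nt_cod (sq_right S)"
    using S by (simp_all add: nt_comm_square_def)
  have "?T a = square_at S (Base a)" if a: "a \<in> Obj A" for a
  proof -
    have x: "Base a \<in> Obj A_pre" "Apex \<in> Obj A_pre" using a by auto
    note To = pointed_ToApex[OF l'(3) x(1)] pointed_ToApex[OF r'(3) x(1)]
    let ?h = "nt_at (sq_bot S) (Base a)" and ?k = "nt_at (sq_top S) Apex"
    have h: "?h \<in> homset C (omap (nt_cod (sq_left S)) (Base a)) (omap (nt_cod (sq_right S)) (Base a))"
      and k: "?k \<in> homset C (one C) (one C)"
      using nat_trans_at(4)[OF nt(2) x(1)] nat_trans_at(4)[OF nt(1) x(2)] dc l'(2) r'(2)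
      by (simp_all add: pointed_def)
    let ?f = "amap (nt_cod (sq_left S)) (ToApex (Base a))"
    have "Comp C ?k ?f \<in> homset C (omap (nt_cod (sq_left S)) (Base a)) (one C)"
      using k To(1) by (simp add: homset_def C.Comp_in C.Dom_Comp C.Cod_Comp)
    moreover have "Comp C ?h (Id C (Dom C ?f)) = ?h"
      using h To(1) C.Comp_Id[of ?h] by (simp add: homset_def)
    \<comment> \<open>The corners of the two trivial pullbacks are the values of the codomain
      functors at \<open>Base a\<close>, so \<open>?h\<close> itself is the induced map.\<close>
    ultimately have "induced_map C (C.id_square ?f) (C.id_square (amap (nt_cod (sq_right S)) (ToApex (Base a))))
        ?h ?k = ?h"
      using C.pb_map_id_square[OF To(2) h] by (simp add: induced_map_def C.id_square_def)
    then show ?thesis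
      using gap_pb_pre[OF l'(1-3) a] gap_pb_pre[OF r'(1-3) a] by (simp add: square_at_def)
  qed
  moreover have "square_at S (Base a) \<in> distinguished C \<longleftrightarrow> square_at S (Base a) \<in> Qs C"
    if a: "a \<in> Obj A" for a
    using l'(4,5)[OF a] functor_at(1)[OF pointed_functor[OF l'(2)], of "Base a"] a
    by (intro C.distinguished_proj_iff) simp_all
  ultimately show ?thesis
    using assms by (simp add: indexed_dist_square_def)
qed

end

section \<open>Chains of sorts and sequences of functors\<close>

definition chain_snoc :: "('o, 'm, 'p, 'n) chain \<Rightarrow> ('o, 'm, 'p, 'n) nat_trans \<Rightarrow> ('o, 'm, 'p, 'n) chain"
  where "chain_snoc x t = \<lparr>functors = functors x @ [nt_dom t], sorts = sorts x @ [t]\<rparr>"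

lemma chain_snoc_simps [simp]:
  "functors (chain_snoc x t) = functors x @ [nt_dom t]" "sorts (chain_snoc x t) = sorts x @ [t]"
  "chain_len (chain_snoc x t) = Suc (chain_len x)" "chain_bdry (chain_snoc x t) = x"
  "src (chain_proj y) = y" "tgt (chain_proj y) = chain_bdry y" "und (chain_proj y) = last (sorts y)"
  by (simp_all add: chain_snoc_def chain_len_def chain_bdry_def chain_proj_def)

lemma chain_snoc_in:
  assumes x: "x \<in> sort_chains A C" and t: "indexed_sort A C t" "nt_cod t = last (functors x)"
  shows "chain_snoc x t \<in> sort_chains A C"
proof -
  have l: "length (functors x) = Suc (length (sorts x))" "functors x ! 0 = const_func A C (one C)"
    and s: "\<And>i. i < length (sorts x) \<Longrightarrow> indexed_sort A C (sorts x ! i) \<and>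
      nt_dom (sorts x ! i) = functors x ! Suc i \<and> nt_cod (sorts x ! i) = functors x ! i"
    using x by (auto simp: sort_chains_def)
  have "functors x \<noteq> []" using l by auto
  then have "last (functors x) = functors x ! length (sorts x)"
    using l by (simp add: last_conv_nth)
  then show ?thesis
    using l s t by (simp add: sort_chains_def nth_append less_Suc_eq)
qed

text \<open>Recursive view of the indexwise definition, parallel to \<open>power_seqs_cases\<close>:
  objects on both sides can be compared by peeling off the last entry.\<close>

lemma sort_chains_cases:
  assumes x: "x \<in> sort_chains A C"
  obtains "x = \<lparr>functors = [const_func A C (one C)], sorts = []\<rparr>"
  | y t where "x = chain_snoc y t" "y \<in> sort_chains A C" "indexed_sort A C t"
    "nt_cod t = last (functors y)"
proof -
  have l: "length (functors x) = Suc (length (sorts x))" "functors x ! 0 = const_func A C (one C)"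
    and s: "\<And>i. i < length (sorts x) \<Longrightarrow> indexed_sort A C (sorts x ! i) \<and>
      nt_dom (sorts x ! i) = functors x ! Suc i \<and> nt_cod (sorts x ! i) = functors x ! i"
    using x by (auto simp: sort_chains_def)
  show thesis
  proof (cases "sorts x" rule: rev_cases)
    case Nil
    then have "functors x = [const_func A C (one C)]"
      using l by (cases "functors x") auto
    then show ?thesis using Nil that(1) by simp
  next
    case (snoc ss t)
    then obtain fs G where fs: "functors x = fs @ [G]" "length fs = Suc (length ss)"
      using l by (cases "functors x" rule: rev_cases) auto
    have fne: "fs \<noteq> []" using fs by auto
    have t: "indexed_sort A C t" "nt_dom t = G" "nt_cod t = last fs"
      using s[of "length ss"] snoc fs fne by (auto simp: nth_append last_conv_nth)
    have "indexed_sort A C (ss ! i) \<and> nt_dom (ss ! i) = fs ! Suc i \<and> nt_cod (ss ! i) = fs ! i"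
      if "i < length ss" for i
      using s[of i] that snoc fs by (simp add: nth_append)
    moreover have "fs ! 0 = const_func A C (one C)"
      using l(2) fs(1) fne by (cases fs) auto
    ultimately have "\<lparr>functors = fs, sorts = ss\<rparr> \<in> sort_chains A C"
      using fs by (simp add: sort_chains_def)
    moreover have "x = chain_snoc \<lparr>functors = fs, sorts = ss\<rparr> t"
      using snoc fs t by (simp add: chain_snoc_def)
    ultimately show ?thesis using that(2) t by simp
  qed
qed

lemma one_chain_in: "\<lparr>functors = [const_func A C (one C)], sorts = []\<rparr> \<in> sort_chains A C"
  by (simp add: sort_chains_def)

lemma sort_chains_induct [consumes 1, case_names one snoc]:
  assumes "x \<in> sort_chains A C"
    and one: "P \<lparr>functors = [const_func A C (one C)], sorts = []\<rparr>"
    and snoc: "\<And>y t. y \<in> sort_chains A C \<Longrightarrow> P y \<Longrightarrow> indexed_sort A C t \<Longrightarrow>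
      nt_cod t = last (functors y) \<Longrightarrow> P (chain_snoc y t)"
  shows "P x"
  using assms(1)
proof (induction "length (sorts x)" arbitrary: x rule: less_induct)
  case less
  from less(2) show ?case
  proof (cases x rule: sort_chains_cases)
    case (2 y t)
    then show ?thesis using less(1)[of y] snoc by simp
  qed (simp add: one)
qed

lemma exponential_simps [simp]:
  "Obj (exponential C A) = sort_chains A C"
  "Arr (exponential C A) = Arr (trans_category A C (sort_chains A C) (\<lambda>x. last (functors x)))"
  "Dom (exponential C A) = src" "Cod (exponential C A) = tgt"
  "Id (exponential C A) = Id (trans_category A C (sort_chains A C) (\<lambda>x. last (functors x)))"
  "Comp (exponential C A) = Comp (trans_category A C (sort_chains A C) (\<lambda>x. last (functors x)))"
  "len (exponential C A) = chain_len" "bdry (exponential C A) = chain_bdry"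
  "proj (exponential C A) = chain_proj"
  by (simp_all add: exponential_def exponential_cat_def category.defs precontextual.defs trans_category_def)

lemma comm_square_exponential:
  "comm_square (exponential C A) S =
    comm_square (trans_category A C (sort_chains A C) (\<lambda>x. last (functors x))) S"
  by (simp add: comm_square_def)

lemma Qs_exponential:
  "S \<in> Qs (exponential C A) \<longleftrightarrow> comm_square (exponential C A) S \<and>
    (\<exists>x\<in>sort_chains A C. chain_len x \<ge> 1 \<and> sq_left S = chain_proj x) \<and>
    (\<exists>y\<in>sort_chains A C. chain_len y \<ge> 1 \<and> sq_right S = chain_proj y) \<and>
    indexed_dist_square A C (und_square S)"
  unfolding comm_square_exponential
  by (simp add: exponential_def exponential_cat_def category.defs precontextual.defs)

context contextual_power
begin

section \<open>The bijection on objects\<close>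

definition seq_of :: "('o plus_obj, ('o, 'm) plus_arr, 'p, 'n) chain \<Rightarrow> ('o, 'm, 'p, 'n) func list" where
  "seq_of x = map (restrict_func A) (functors x)"

lemma seq_of_snoc [simp]: "seq_of (chain_snoc y t) = seq_of y @ [restrict_func A (nt_dom t)]"
  by (simp add: seq_of_def)

lemma restrict_const_func: "restrict_func A (const_func A_pre C (one C)) = const_func A C (one C)"
  by (auto simp: restrict_func_def const_func_def intro!: restrict_ext)

lemma last_pointed: "x \<in> sort_chains A_pre C \<Longrightarrow> pointed (last (functors x))"
  by (cases x rule: sort_chains_cases) (auto simp: pointed_const indexed_sortD)

lemma chain_functors: "x \<in> sort_chains A_pre C \<Longrightarrow> functors x \<noteq> []"
  by (cases x rule: sort_chains_cases) auto

lemma last_seq_of: "x \<in> sort_chains A_pre C \<Longrightarrow> last (seq_of x) = restrict_func A (last (functors x))"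
  using chain_functors by (simp add: seq_of_def last_map)

lemma seq_len_seq_of: "x \<in> sort_chains A_pre C \<Longrightarrow> seq_len (seq_of x) = chain_len x"
  by (auto simp: sort_chains_def seq_len_def seq_of_def chain_len_def)

text \<open>A sort only says that its components are projections. The absolute lengths come from the
  induction: the boundary of a value of the new functor is a value of the previous one, whose length
  is already known.\<close>

lemma seq_of_in: "x \<in> sort_chains A_pre C \<Longrightarrow> seq_of x \<in> power_seqs A C"
proof (induct rule: sort_chains_induct)
  case one
  then show ?case using one_seq_in by (simp add: seq_of_def restrict_const_func)
next
  case (snoc y t)
  note t = indexed_sortD[OF snoc(3)]
  have ne: "seq_of y \<noteq> []" using snoc(2) by (auto simp: power_seqs_def)
  have "len C (omap (nt_dom t) (Base a)) = length (seq_of y) \<and>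
      bdry C (omap (nt_dom t) (Base a)) = omap (last (seq_of y)) a" if a: "a \<in> Obj A" for a
  proof -
    have x: "Base a \<in> Obj A_pre" using a by simp
    let ?c = "omap (nt_dom t) (Base a)"
    have c: "?c \<in> Obj C" "len C ?c \<ge> 1"
      using functor_at(1)[OF pointed_functor[OF t(2)] x] t(4)[OF a] by auto
    have "bdry C ?c = omap (nt_cod t) (Base a)"
      using nat_trans_at(3)[OF t(1) x] t(5)[OF a] C.proj_at(3)[OF c] by simp
    then have b: "bdry C ?c = omap (last (seq_of y)) a"
      using snoc(4) last_seq_of[OF snoc(1)] a by simp
    \<comment> \<open>\<open>seq_len\<close> is one less than the length of the list, and both
      subtractions are truncated; positivity of \<open>len C ?c\<close> and nonemptiness of the list
      turn this into the required equality.\<close>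
    have "len C ?c - 1 = seq_len (seq_of y)"
      using C.len_bdry[OF c] last_power_seqs(2)[OF snoc(2) a] b by simp
    then show ?thesis using b c(2) ne by (cases "seq_of y") (auto simp: seq_len_def)
  qed
  then show ?case
    using snoc t nt_restrict[OF t(1)] functor_restrict[OF pointed_functor[OF t(2)]]
      last_seq_of[OF snoc(1)]
    by (simp add: power_seqs_snoc[OF ne])
qed

text \<open>The components over \<open>A\<close> are the projections of the values of the domain
  functor, so this functor and the codomain determine the sort.\<close>

lemma indexed_sort_eqI:
  assumes s: "indexed_sort A_pre C s" and t: "indexed_sort A_pre C t"
    and "nt_cod s = nt_cod t" and "restrict_func A (nt_dom s) = restrict_func A (nt_dom t)"
  shows "s = t"
proof -
  note s' = indexed_sortD[OF s] and t' = indexed_sortD[OF t]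
  have "nt_dom s = nt_dom t" using restrict_func_inject s'(2) t'(2) assms(4) by blast
  then show ?thesis
    using s' t' assms(3,4) by (intro restrict_nt_inject) simp_all
qed

lemma seq_of_inject:
  "x \<in> sort_chains A_pre C \<Longrightarrow> y \<in> sort_chains A_pre C \<Longrightarrow> seq_of x = seq_of y \<Longrightarrow> x = y"
proof (induct arbitrary: y rule: sort_chains_induct)
  case one
  from one(1) show ?case
    by (cases y rule: sort_chains_cases) (use one(2) chain_functors in \<open>auto simp: seq_of_def\<close>)
next
  case (snoc x t)
  from snoc(5) show ?case
  proof (cases y rule: sort_chains_cases)
    case 1
    then show ?thesis using snoc(6) chain_functors[OF snoc(1)] by (simp add: seq_of_def)
  next
    case (2 z s)
    then have "seq_of x = seq_of z" "restrict_func A (nt_dom t) = restrict_func A (nt_dom s)"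
      using snoc(6) by simp_all
    moreover from this(1) have "x = z" using snoc(2) 2 by blast
    ultimately show ?thesis
      using indexed_sort_eqI[OF snoc(3) 2(3)] snoc(4) 2 by simp
  qed
qed

text \<open>The last functor is extended to the apex, and then the projection transformation is
  extended with codomain the last functor of the chain already built. The chain has to come first,
  since a sort must end exactly where the chain does.\<close>

lemma seq_of_surj:
  "z \<in> power_seqs A C \<Longrightarrow> \<exists>x\<in>sort_chains A_pre C. seq_of x = z"
proof (induction z rule: rev_induct)
  case Nil
  then show ?case by (simp add: power_seqs_def)
next
  case (snoc H z)
  from snoc(2) show ?case
  proof (cases "z @ [H]" rule: power_seqs_cases)
    case 1
    then show ?thesis
      by (intro bexI[OF _ one_chain_in]) (simp add: seq_of_def restrict_const_func)
  next
    case (2 y H')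
    then have y: "y = z" "H' = H" by simp_all
    note H = 2(2,5-8)[unfolded y]
    obtain x where x: "x \<in> sort_chains A_pre C" "seq_of x = z"
      using snoc(1) H(1) by blast
    obtain F where F: "pointed F" "restrict_func A F = H"
      using restrict_func_surj[OF H(2)] .
    obtain t where t: "natural_transformation A_pre C t" "nt_dom t = F" "nt_cod t = last (functors x)"
      "restrict_nt A t = proj_trans A C H (last z)"
      using restrict_nt_surj[OF F(1) last_pointed[OF x(1)] H(5)] F(2) last_seq_of[OF x(1)] x(2) by auto
    \<comment> \<open>The values of \<open>H\<close> have length \<open>length z\<close>, so this
      gives the positive length that a sort requires of its domain.\<close>
    have "length z \<ge> 1" using H(1) by (cases z) (auto simp: power_seqs_def)
    moreover have "omap F (Base a) = omap H a" if "a \<in> Obj A" for a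
      using F(2) that by auto
    moreover have "nt_at t (Base a) = proj C (omap H a)" if "a \<in> Obj A" for a
      using arg_cong[OF t(4), of "\<lambda>t. nt_at t a"] that by simp
    ultimately have "indexed_sort A_pre C t"
      using t F last_pointed[OF x(1)] H(3) by (subst indexed_sort_pre_iff) simp_all
    then have "chain_snoc x t \<in> sort_chains A_pre C"
      using chain_snoc_in x t by blast
    then show ?thesis
      using x t F by (intro bexI[of _ "chain_snoc x t"]) simp_all
  qed
qed

lemma seq_bdry_seq_of:
  assumes "x \<in> sort_chains A_pre C"
  shows "seq_of (chain_bdry x) = seq_bdry (seq_of x)"
  using assms
proof (cases x rule: sort_chains_cases)
  case 1
  then show ?thesis by (simp add: chain_bdry_def chain_len_def seq_bdry_def seq_len_def seq_of_def)
next
  case (2 y t)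
  then show ?thesis using chain_functors[of y] by (simp add: seq_bdry_def seq_len_def seq_of_def)
qed

lemma chain_bdry_in:
  assumes "x \<in> sort_chains A_pre C"
  shows "chain_bdry x \<in> sort_chains A_pre C"
  using assms
proof (cases x rule: sort_chains_cases)
  case 1
  then show ?thesis using assms by (simp add: chain_bdry_def chain_len_def)
qed simp

lemma chain_proj_in:
  assumes "x \<in> sort_chains A_pre C" "chain_len x \<ge> 1"
  shows "chain_proj x \<in> Arr (exponential C A_pre)" "indexed_sort A_pre C (und (chain_proj x))"
proof -
  obtain y t where y: "x = chain_snoc y t" "y \<in> sort_chains A_pre C" "indexed_sort A_pre C t"
    "nt_cod t = last (functors y)"
    using assms by (cases x rule: sort_chains_cases) (auto simp: chain_len_def)
  then show "chain_proj x \<in> Arr (exponential C A_pre)" "indexed_sort A_pre C (und (chain_proj x))"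
    using assms(1) by (simp_all add: indexed_sortD)
qed

section \<open>The bijection on arrows\<close>

definition arrow_of :: "(('o plus_obj, ('o, 'm) plus_arr, 'p, 'n) chain,
    ('o plus_obj, ('o, 'm) plus_arr, 'p, 'n) nat_trans) arrow
    \<Rightarrow> (('o, 'm, 'p, 'n) func list, ('o, 'm, 'p, 'n) nat_trans) arrow" where
  "arrow_of f = \<lparr>src = seq_of (src f), tgt = seq_of (tgt f), und = restrict_nt A (und f)\<rparr>"

lemma arrow_of_simps [simp]:
  "src (arrow_of f) = seq_of (src f)" "tgt (arrow_of f) = seq_of (tgt f)"
  "und (arrow_of f) = restrict_nt A (und f)"
  by (simp_all add: arrow_of_def)

lemma arrow_of_in:
  "f \<in> Arr (exponential C A_pre) \<Longrightarrow> arrow_of f \<in> Arr (power_by_cat C A)"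
  by (simp add: seq_of_in nt_restrict last_seq_of)

text \<open>The display map of a chain carries its last sort, and a sort restricts to the
  transformation whose components are canonical projections.\<close>

lemma arrow_of_proj:
  assumes "x \<in> sort_chains A_pre C" "chain_len x \<ge> 1"
  shows "arrow_of (chain_proj x) = seq_proj A C (seq_of x)"
  using assms(1)
proof (cases x rule: sort_chains_cases)
  case 1
  then show ?thesis using assms by (simp add: chain_len_def)
next
  case (2 y t)
  have "seq_bdry (seq_of y @ [restrict_func A (nt_dom t)]) = seq_of y"
    using seq_bdry_seq_of[OF assms(1)] 2 by simp
  then show ?thesis
    using 2 indexed_sortD(6)[OF 2(3)] last_seq_of[OF 2(2)]
    by (intro arrow_eqI) simp_all
qed

text \<open>The endpoints are recovered first, by injectivity on chains; they fix the functors
  between which the transformation runs, and then its restriction determines it.\<close>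

lemma arrow_of_inject:
  assumes "f \<in> Arr (exponential C A_pre)" "g \<in> Arr (exponential C A_pre)" "arrow_of f = arrow_of g"
  shows "f = g"
proof -
  have "seq_of (src f) = seq_of (src g)" "seq_of (tgt f) = seq_of (tgt g)"
    and u: "restrict_nt A (und f) = restrict_nt A (und g)"
    using arg_cong[OF assms(3), of src] arg_cong[OF assms(3), of tgt] arg_cong[OF assms(3), of und]
    by simp_all
  then have st: "src f = src g" "tgt f = tgt g" using seq_of_inject assms(1,2) by auto
  have "und f = und g"
    using assms(1,2) st u last_pointed by (intro restrict_nt_inject) simp_all
  with st show ?thesis by (intro arrow_eqI)
qed

lemma arrow_of_surj:
  assumes g: "g \<in> Arr (power_by_cat C A)"
  shows "\<exists>f\<in>Arr (exponential C A_pre). arrow_of f = g"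
proof -
  obtain x y where x: "x \<in> sort_chains A_pre C" "seq_of x = src g"
    and y: "y \<in> sort_chains A_pre C" "seq_of y = tgt g"
    using g seq_of_surj by (metis power_simps(2) trans_category_simps(6))
  obtain t where t: "natural_transformation A_pre C t" "nt_dom t = last (functors x)"
    "nt_cod t = last (functors y)" "restrict_nt A t = und g"
    using restrict_nt_surj[OF last_pointed[OF x(1)] last_pointed[OF y(1)], of "und g"]
      g last_seq_of[OF x(1)] last_seq_of[OF y(1)] x(2) y(2) by auto
  then show ?thesis
    using x y by (intro bexI[of _ "\<lparr>src = x, tgt = y, und = t\<rparr>"]) (auto intro!: arrow_eqI)
qed

section \<open>The isomorphism and its compatibility with the structure\<close>

definition power_iso where
  "power_iso = \<lparr>omap = (\<lambda>x\<in>sort_chains A_pre C. seq_of x),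
     amap = (\<lambda>f\<in>Arr (exponential C A_pre). arrow_of f)\<rparr>"

lemma power_iso_simps [simp]:
  "x \<in> sort_chains A_pre C \<Longrightarrow> omap power_iso x = seq_of x"
  "f \<in> Arr (exponential C A_pre) \<Longrightarrow> amap power_iso f = arrow_of f"
  by (simp_all add: power_iso_def del: exponential_simps(2))

lemma category_exponential: "category (exponential C A_pre)"
proof -
  have "category (trans_category A_pre C (sort_chains A_pre C) (\<lambda>x. last (functors x)))"
    by (intro category_trans_category category_pre C.category_axioms pointed_functor last_pointed)
  then show ?thesis
    by (subst category_cong[where C = "trans_category A_pre C (sort_chains A_pre C) (\<lambda>x. last (functors x))"])
      simp_all
qed

lemma functor_power_iso: "is_functor (exponential C A_pre) (power_by_cat C A) power_iso"
proof -
  interpret E: category "exponential C A_pre" by (rule category_exponential)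
  show ?thesis
  proof (intro is_functor.intro category_exponential category_power is_functor_axioms.intro)
    show "omap power_iso \<in> Obj (exponential C A_pre) \<rightarrow>\<^sub>E Obj (power_by_cat C A)"
      by (auto simp: power_iso_def seq_of_in)
    show "amap power_iso \<in> Arr (exponential C A_pre) \<rightarrow>\<^sub>E Arr (power_by_cat C A)"
      using arrow_of_in by (auto simp: power_iso_def simp del: exponential_simps(2) power_simps(2))
  next
    fix f assume f: "f \<in> Arr (exponential C A_pre)"
    show "Dom (power_by_cat C A) (amap power_iso f) = omap power_iso (Dom (exponential C A_pre) f)"
      "Cod (power_by_cat C A) (amap power_iso f) = omap power_iso (Cod (exponential C A_pre) f)"
      using E.Dom_in[OF f] E.Cod_in[OF f]
      by (simp_all add: power_iso_simps(2)[OF f])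
    fix g assume g: "g \<in> Arr (exponential C A_pre)"
      and fg: "Cod (exponential C A_pre) f = Dom (exponential C A_pre) g"
    show "amap power_iso (Comp (exponential C A_pre) g f) =
        Comp (power_by_cat C A) (amap power_iso g) (amap power_iso f)"
      unfolding power_iso_simps(2)[OF f] power_iso_simps(2)[OF g]
        power_iso_simps(2)[OF E.Comp_in[OF f g fg]]
      by (intro arrow_eqI) (simp_all add: restrict_nt_comp)
  next
    fix x assume x: "x \<in> Obj (exponential C A_pre)"
    show "amap power_iso (Id (exponential C A_pre) x) = Id (power_by_cat C A) (omap power_iso x)"
      unfolding power_iso_simps(2)[OF E.Id_in[OF x]]
      using x by (intro arrow_eqI) (simp_all add: restrict_nt_id last_seq_of)
  qed
qed

lemma bij_power_iso:
  "bij_betw (omap power_iso) (Obj (exponential C A_pre)) (Obj (power_by_cat C A))"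
  "bij_betw (amap power_iso) (Arr (exponential C A_pre)) (Arr (power_by_cat C A))"
proof -
  show "bij_betw (omap power_iso) (Obj (exponential C A_pre)) (Obj (power_by_cat C A))"
    unfolding exponential_simps(1) power_simps(1)
  proof (rule bij_betw_imageI)
    show "inj_on (omap power_iso) (sort_chains A_pre C)"
      using seq_of_inject by (auto intro!: inj_onI)
    show "omap power_iso ` sort_chains A_pre C = power_seqs A C"
      using seq_of_in seq_of_surj by (auto simp: image_iff)
  qed
  show "bij_betw (amap power_iso) (Arr (exponential C A_pre)) (Arr (power_by_cat C A))"
  proof (rule bij_betw_imageI)
    show "inj_on (amap power_iso) (Arr (exponential C A_pre))"
    proof (rule inj_onI)
      fix f g assume f: "f \<in> Arr (exponential C A_pre)" and g: "g \<in> Arr (exponential C A_pre)"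
        and "amap power_iso f = amap power_iso g"
      then show "f = g"
        unfolding power_iso_simps(2)[OF f] power_iso_simps(2)[OF g] by (intro arrow_of_inject)
    qed
    show "amap power_iso ` Arr (exponential C A_pre) = Arr (power_by_cat C A)"
    proof (intro equalityI subsetI)
      fix g assume "g \<in> Arr (power_by_cat C A)"
      from arrow_of_surj[OF this] obtain f where f: "f \<in> Arr (exponential C A_pre)" "arrow_of f = g"
        by blast
      show "g \<in> amap power_iso ` Arr (exponential C A_pre)"
        by (rule image_eqI[OF _ f(1)]) (simp only: power_iso_simps(2)[OF f(1)] f(2))
    next
      fix g assume "g \<in> amap power_iso ` Arr (exponential C A_pre)"
      then obtain f where f: "f \<in> Arr (exponential C A_pre)" "g = amap power_iso f"
        by blast
      show "g \<in> Arr (power_by_cat C A)"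
        unfolding f(2) power_iso_simps(2)[OF f(1)] by (rule arrow_of_in[OF f(1)])
    qed
  qed
qed

text \<open>For a commuting square the conditions match one by one: sides that are display maps
  correspond, and the component of the image at \<open>a\<close> is the component of
  \<open>S\<close> at \<open>Base a\<close>, where indexed distinguished squares are already known
  to be pointwise in \<open>Qs C\<close>.\<close>

lemma power_iso_Qs:
  "S \<in> Qs (exponential C A_pre) \<longleftrightarrow>
    comm_square (exponential C A_pre) S \<and> map_square power_iso S \<in> Qs (power_by_cat C A)"
proof -
  interpret F: bijective_functor "exponential C A_pre" "power_by_cat C A" power_iso
    using functor_power_iso bij_power_iso
    by (simp add: bijective_functor_def bijective_functor_axioms_def)
  have "S \<in> Qs (exponential C A_pre) \<longleftrightarrow> map_square power_iso S \<in> Qs (power_by_cat C A)"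
    if c: "comm_square (exponential C A_pre) S"
  proof -
    have S: "sq_top S \<in> Arr (exponential C A_pre)" "sq_bot S \<in> Arr (exponential C A_pre)"
      "sq_left S \<in> Arr (exponential C A_pre)" "sq_right S \<in> Arr (exponential C A_pre)"
      using c unfolding comm_square_def by blast+
    note eq = power_iso_simps(2)[OF S(1)] power_iso_simps(2)[OF S(2)]
      power_iso_simps(2)[OF S(3)] power_iso_simps(2)[OF S(4)]
    have c': "comm_square (power_by_cat C A) (map_square power_iso S)"
      using F.comm_square_map_iff[OF S] c by simp
    have nc: "nt_comm_square A_pre C (und_square S)"
      using c unfolding comm_square_exponential comm_square_trans_category by blast
    \<comment> \<open>The backward direction uses surjectivity on objects to write the sequence as
      the image of a chain, and injectivity on arrows to identify \<open>f\<close> with the display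
      map of that chain.\<close>
    have side: "(\<exists>x\<in>sort_chains A_pre C. chain_len x \<ge> 1 \<and> f = chain_proj x) \<longleftrightarrow>
        (\<exists>z\<in>power_seqs A C. seq_len z \<ge> 1 \<and> arrow_of f = seq_proj A C z)"
      if f: "f \<in> Arr (exponential C A_pre)" for f
    proof
      assume "\<exists>x\<in>sort_chains A_pre C. chain_len x \<ge> 1 \<and> f = chain_proj x"
      then show "\<exists>z\<in>power_seqs A C. seq_len z \<ge> 1 \<and> arrow_of f = seq_proj A C z"
        using seq_of_in seq_len_seq_of arrow_of_proj by metis
    next
      assume "\<exists>z\<in>power_seqs A C. seq_len z \<ge> 1 \<and> arrow_of f = seq_proj A C z"
      then obtain x where "x \<in> sort_chains A_pre C" "seq_len (seq_of x) \<ge> 1"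
        "arrow_of f = seq_proj A C (seq_of x)" using seq_of_surj by metis
      then show "\<exists>x\<in>sort_chains A_pre C. chain_len x \<ge> 1 \<and> f = chain_proj x"
        using seq_len_seq_of arrow_of_proj arrow_of_inject[OF f] chain_proj_in(1) by metis
    qed
    have "square_at (und_square (map_square power_iso S)) a = square_at (und_square S) (Base a)"
      if "a \<in> Obj A" for a
      using that by (intro square.equality) (simp_all add: eq)
    \<comment> \<open>The pointwise description of indexed distinguished squares presupposes that
      both sides are sorts; display maps of chains are.\<close>
    moreover have "indexed_sort A_pre C (und f)"
      if "\<exists>x\<in>sort_chains A_pre C. chain_len x \<ge> 1 \<and> f = chain_proj x" for f
      using that chain_proj_in(2) by blast
    ultimately show ?thesis
      unfolding Qs_exponential Qs_power map_square_simps eq side[OF S(3), symmetric]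
        side[OF S(4), symmetric] comm_square_power[symmetric]
      using c c' indexed_dist_square_pre_iff[OF nc] by (auto simp del: chain_snoc_simps)
  qed
  then show ?thesis using Qs_exponential by blast
qed

lemma contextual_isomorphism_power_iso:
  "contextual_isomorphism (exponential C A_pre) (power_by_cat C A) power_iso"
proof (rule contextual_isomorphismI[OF category_exponential contextual_power functor_power_iso
      bij_power_iso])
  fix x assume x: "x \<in> Obj (exponential C A_pre)"
  show "bdry (exponential C A_pre) x \<in> Obj (exponential C A_pre)"
    using x by (simp add: chain_bdry_in)
  show "len (power_by_cat C A) (omap power_iso x) = len (exponential C A_pre) x"
    using x by (simp add: seq_len_seq_of)
  show "omap power_iso (bdry (exponential C A_pre) x) = bdry (power_by_cat C A) (omap power_iso x)"
    using x by (simp add: chain_bdry_in seq_bdry_seq_of)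
  assume l: "1 \<le> len (exponential C A_pre) x"
  have p: "chain_proj x \<in> Arr (exponential C A_pre)"
    using x l chain_proj_in(1) by (simp del: exponential_simps(2))
  then show "proj (exponential C A_pre) x \<in> Arr (exponential C A_pre)" by simp
  show "amap power_iso (proj (exponential C A_pre) x) = proj (power_by_cat C A) (omap power_iso x)"
    using x l power_iso_simps(2)[OF p] arrow_of_proj by simp
qed (rule power_iso_Qs)

end

theorem proposition3p17:
  fixes A :: "('o, 'm) category" and C :: "('p, 'n) precontextual"
  assumes "category A" and "contextual_category C"
  shows "\<exists>\<Phi>. contextual_isomorphism (exponential C (pre_of_cat A)) (power_by_cat C A) \<Phi>"
proof -
  interpret contextual_power A C
    using assms by (simp add: contextual_power_def)
  show ?thesis
    using contextual_isomorphism_power_iso by blast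
qed

end
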